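(* Let $\mathsf M_1,\mathsf M_2$ be matroids on finite sets $S_1,S_2$ with $S_1\cap S_2=\{i\}$, where $\{i\}$ is a flat of $\mathsf M_1$ and $i$ is not a loop of $\mathsf M_2$, and let $\Bbbk$ be a field. Let $\mathsf P=\mathsf M_1\oplus_{\{i\}}\mathsf M_2$ be their parallel connection and $\phi\colon S_1\sqcup S_2'\to S_1\cup S_2$ the identification map. Then there is a short exact sequence of graded $\Bbbk$-vector spaces $$0\to A(\mathsf P)[-1]\to A(\mathsf M_1\oplus\mathsf M_2)\xrightarrow{A(\phi)}A(\mathsf P)\to0,$$ and an isomorphism of graded $\Bbbk$-algebras $\overline A(\mathsf M_1)\otimes_\Bbbk\overline A(\mathsf M_2)\cong\overline A(\mathsf P)$.
   Context: The parallel connection $\mathsf P$ (with basepoint $i$) is the matroid on $S_1\cup S_2$ whose circuits are the circuits of $\mathsf M_1$, the circuits of $\mathsf M_2$, and the sets $(C_1\setminus\{i\})\cup(C_2\setminus\{i\})$ where $C_j$ is a circuit of $\mathsf M_j$ containing $i$. The direct sum $\mathsf M_1\oplus\mathsf M_2$ is taken on $S_1\sqcup S_2'$, where $S_2'$ is a disjoint copy of $S_2$ (the copy of $i$ denoted $i'$); $\phi$ is the identity on $S_1$ and sends each element of $S_2'$ to the corresponding element of $S_2$ (so $\phi(i')=i$). For a matroid $\mathsf N$ on $S$: $V(\mathsf N)=\Bbbk^S$ with basis $\{e_s\}$, $E=\Lambda(V(\mathsf N))$, $\partial$ the graded derivation with $\partial(e_s)=1$, $e_C=\prod_{s\in C}e_s$;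 $A(\mathsf N)=E/I$ with $I$ generated by $\partial(e_C)$ over circuits $C$; $\overline A(\mathsf N)$ is the subalgebra generated by $\overline V(\mathsf N)=\{v:\sum_s v_s=0\}$. $A(\phi)$ is the algebra homomorphism induced by $e_s\mapsto e_{\phi(s)}$. For a graded space $B$, $B[-1]$ has degree-$p$ part $B^{p-1}$. *)

theory Defs
  imports "HOL-Algebra.Module" "HOL-Algebra.QuotRing" "HOL-Algebra.Subrings"
begin

section \<open>Matroids\<close>

text \<open>Matroids are presented by their circuits.\<close>

record 'a matroid =
  ground :: "'a set"
  circuits :: "'a set set"

definition is_matroid :: "'a matroid \<Rightarrow> bool" where
  "is_matroid M \<longleftrightarrow>
     finite (ground M) \<and>
     (\<forall>C\<in>circuits M. C \<subseteq> ground M) \<and>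
     {} \<notin> circuits M \<and>
     (\<forall>C\<in>circuits M. \<forall>C'\<in>circuits M. C \<subseteq> C' \<longrightarrow> C = C') \<and>
     (\<forall>C\<in>circuits M. \<forall>C'\<in>circuits M. C \<noteq> C' \<longrightarrow>
        (\<forall>e\<in>C \<inter> C'. \<exists>C''\<in>circuits M. C'' \<subseteq> (C \<union> C') - {e}))"

definition indep :: "'a matroid \<Rightarrow> 'a set \<Rightarrow> bool" where
  "indep M X \<longleftrightarrow> X \<subseteq> ground M \<and> (\<forall>C\<in>circuits M. \<not> C \<subseteq> X)"

definition rank :: "'a matroid \<Rightarrow> 'a set \<Rightarrow> nat" where
  "rank M X = Max (card ` {I. I \<subseteq> X \<and> indep M I})"

definition flat :: "'a matroid \<Rightarrow> 'a set \<Rightarrow> bool" where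
  "flat M F \<longleftrightarrow> F \<subseteq> ground M \<and> (\<forall>x\<in>ground M - F. rank M F < rank M (insert x F))"

definition is_loop :: "'a matroid \<Rightarrow> 'a \<Rightarrow> bool" where
  "is_loop M x \<longleftrightarrow> {x} \<in> circuits M"

definition parallel_connection :: "'a \<Rightarrow> 'a matroid \<Rightarrow> 'a matroid \<Rightarrow> 'a matroid" where
  "parallel_connection i M\<^sub>1 M\<^sub>2 =
     \<lparr>ground = ground M\<^sub>1 \<union> ground M\<^sub>2,
      circuits = circuits M\<^sub>1 \<union> circuits M\<^sub>2 \<union>
        {(C\<^sub>1 - {i}) \<union> (C\<^sub>2 - {i}) | C\<^sub>1 C\<^sub>2.
           C\<^sub>1 \<in> circuits M\<^sub>1 \<and> C\<^sub>2 \<in> circuits M\<^sub>2 \<and> i \<in> C\<^sub>1 \<and> i \<in> C\<^sub>2}\<rparr>"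

definition direct_sum :: "'a matroid \<Rightarrow> 'b matroid \<Rightarrow> ('a + 'b) matroid" where
  "direct_sum M\<^sub>1 M\<^sub>2 =
     \<lparr>ground = ground M\<^sub>1 <+> ground M\<^sub>2,
      circuits = (`) Inl ` circuits M\<^sub>1 \<union> (`) Inr ` circuits M\<^sub>2\<rparr>"

text \<open>The first summand of the sum type plays the role of \<open>S\<^sub>1\<close> and the second
  one that of the disjoint copy \<open>S\<^sub>2'\<close>; thus \<open>i'\<close> is \<open>Inr i\<close>.\<close>

definition identification :: "'a + 'a \<Rightarrow> 'a" where
  "identification = case_sum id id"


section \<open>Graded algebras and graded vector spaces\<close>

text \<open>A graded algebra over the field \<open>'k\<close>; \<open>homog A p\<close> is its part of degree \<open>p\<close>.
  The same record is used for graded vector spaces, the multiplication then being ignored.\<close>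

record ('k, 'x) graded_algebra = "('k, 'x) module" +
  homog :: "nat \<Rightarrow> 'x set"

text \<open>\<open>shift B\<close> is the graded vector space \<open>B[-1]\<close>.\<close>

definition shift :: "('k, 'x) graded_algebra \<Rightarrow> ('k, 'x) graded_algebra" where
  "shift B = B\<lparr>homog := (\<lambda>p. if p = 0 then {\<zero>\<^bsub>B\<^esub>} else homog B (p - 1))\<rparr>"

definition linear_maps ::
  "('k, 'x) graded_algebra \<Rightarrow> ('k, 'y) graded_algebra \<Rightarrow> ('x \<Rightarrow> 'y) set" where
  "linear_maps A B = {f \<in> carrier A \<rightarrow> carrier B.
     (\<forall>x\<in>carrier A. \<forall>y\<in>carrier A. f (x \<oplus>\<^bsub>A\<^esub> y) = f x \<oplus>\<^bsub>B\<^esub> f y) \<and>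
     (\<forall>c. \<forall>x\<in>carrier A. f (c \<odot>\<^bsub>A\<^esub> x) = c \<odot>\<^bsub>B\<^esub> f x)}"

definition graded_linear_maps ::
  "('k, 'x) graded_algebra \<Rightarrow> ('k, 'y) graded_algebra \<Rightarrow> ('x \<Rightarrow> 'y) set" where
  "graded_linear_maps A B = {f \<in> linear_maps A B. \<forall>p. f ` homog A p \<subseteq> homog B p}"

definition alg_hom ::
  "('k, 'x) graded_algebra \<Rightarrow> ('k, 'y) graded_algebra \<Rightarrow> ('x \<Rightarrow> 'y) set" where
  "alg_hom A B = ring_hom A B \<inter> linear_maps A B"

definition graded_alg_iso ::
  "('k, 'x) graded_algebra \<Rightarrow> ('k, 'y) graded_algebra \<Rightarrow> bool" where
  "graded_alg_iso A B \<longleftrightarrow>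
     (\<exists>f\<in>alg_hom A B. bij_betw f (carrier A) (carrier B) \<and>
        (\<forall>p. f ` homog A p = homog B p))"

text \<open>Exactness of \<open>0 \<rightarrow> A \<rightarrow> B \<rightarrow> C \<rightarrow> 0\<close> with maps \<open>f\<close> and \<open>g\<close>.\<close>

definition short_exact ::
  "('k, 'x) graded_algebra \<Rightarrow> ('x \<Rightarrow> 'y) \<Rightarrow> ('k, 'y) graded_algebra \<Rightarrow> ('y \<Rightarrow> 'z) \<Rightarrow>
   ('k, 'z) graded_algebra \<Rightarrow> bool" where
  "short_exact A f B g C \<longleftrightarrow>
     f \<in> graded_linear_maps A B \<and> g \<in> graded_linear_maps B C \<and>
     inj_on f (carrier A) \<and>
     f ` carrier A = {y \<in> carrier B. g y = \<zero>\<^bsub>C\<^esub>} \<and>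
     g ` carrier B = carrier C"

text \<open>A graded derivation is a derivation of degree \<open>-1\<close> obeying the signed Leibniz rule.\<close>

definition graded_derivation ::
  "('k::field, 'x) graded_algebra \<Rightarrow> ('x \<Rightarrow> 'x) \<Rightarrow> bool" where
  "graded_derivation A d \<longleftrightarrow>
     d \<in> graded_linear_maps A (shift A) \<and>
     (\<forall>p. \<forall>x\<in>homog A p. \<forall>y\<in>carrier A.
        d (x \<otimes>\<^bsub>A\<^esub> y) = (d x \<otimes>\<^bsub>A\<^esub> y) \<oplus>\<^bsub>A\<^esub> ((- 1) ^ p \<odot>\<^bsub>A\<^esub> (x \<otimes>\<^bsub>A\<^esub> d y)))"

definition quot_algebra ::
  "('k, 'x) graded_algebra \<Rightarrow> 'x set \<Rightarrow> ('k, 'x set) graded_algebra" where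
  "quot_algebra A I =
     \<lparr>carrier = carrier (A Quot I), mult = mult (A Quot I), one = one (A Quot I),
      zero = zero (A Quot I), add = add (A Quot I),
      smult = (\<lambda>c X. \<Union>x\<in>X. I +>\<^bsub>A\<^esub> (c \<odot>\<^bsub>A\<^esub> x)),
      homog = (\<lambda>p. (\<lambda>x. I +>\<^bsub>A\<^esub> x) ` homog A p)\<rparr>"

definition generated_subalgebra ::
  "('k, 'x) graded_algebra \<Rightarrow> 'x set \<Rightarrow> ('k, 'x) graded_algebra" where
  "generated_subalgebra A X =
     (let B = \<Inter>{B. subring B A \<and> (\<forall>c. \<forall>x\<in>B. c \<odot>\<^bsub>A\<^esub> x \<in> B) \<and> X \<subseteq> B}
      in A\<lparr>carrier := B, homog := (\<lambda>p. homog A p \<inter> B)\<rparr>)"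

text \<open>The algebra with \<open>'k\<close>-basis \<open>B\<close>, in which the product of the basis elements \<open>b\<close> and
  \<open>c\<close> is \<open>\<epsilon> b c\<close> times the basis element \<open>m b c\<close>, \<open>u\<close> is the unit, and the basis element
  \<open>b\<close> has degree \<open>dg b\<close>. An element is given by its finitely supported coefficient function.\<close>

definition based_algebra ::
  "'b set \<Rightarrow> ('b \<Rightarrow> 'b \<Rightarrow> 'b) \<Rightarrow> ('b \<Rightarrow> 'b \<Rightarrow> 'k) \<Rightarrow> 'b \<Rightarrow> ('b \<Rightarrow> nat) \<Rightarrow>
   ('k::field, 'b \<Rightarrow> 'k) graded_algebra" where
  "based_algebra B m \<epsilon> u dg =
     \<lparr>carrier = {x. finite {b. x b \<noteq> 0} \<and> {b. x b \<noteq> 0} \<subseteq> B},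
      mult = (\<lambda>x y w. \<Sum>(b, c) \<in> {(b, c). x b \<noteq> 0 \<and> y c \<noteq> 0 \<and> m b c = w}. \<epsilon> b c * x b * y c),
      one = (\<lambda>w. if w = u then 1 else 0),
      zero = (\<lambda>w. 0),
      add = (\<lambda>x y w. x w + y w),
      smult = (\<lambda>c x w. c * x w),
      homog = (\<lambda>p. {x. finite {b. x b \<noteq> 0} \<and> {b. x b \<noteq> 0} \<subseteq> {b \<in> B. dg b = p}})\<rparr>"

definition basis_vec :: "'b \<Rightarrow> 'b \<Rightarrow> 'k::field" where
  "basis_vec b = (\<lambda>w. if w = b then 1 else 0)"


section \<open>Tensor products of graded algebras\<close>

text \<open>The tensor product of graded algebras has degree \<open>n\<close> part the direct sum of the
  \<open>A\<^sup>p \<otimes> B\<^sup>q\<close> with \<open>p + q = n\<close>, and multiplication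
  \<open>(a \<otimes> b)(a' \<otimes> b') = (-1)\<^sup>q\<^sup>p\<^sup>' aa' \<otimes> bb'\<close> for \<open>b \<in> B\<^sup>q\<close> and \<open>a' \<in> A\<^sup>p\<^sup>'\<close>.
  It is the free vector space on the symbols \<open>(p, a, q, b)\<close> with \<open>a \<in> A\<^sup>p\<close>, \<open>b \<in> B\<^sup>q\<close>,
  modulo bilinearity in \<open>a\<close> and \<open>b\<close>. The degrees are part of the symbols because
  \<open>0\<close> lies in every degree.\<close>

definition free_tensor ::
  "('k::field, 'x) graded_algebra \<Rightarrow> ('k, 'y) graded_algebra \<Rightarrow>
   ('k, nat \<times> 'x \<times> nat \<times> 'y \<Rightarrow> 'k) graded_algebra" where
  "free_tensor A B = based_algebra
     {(p, a, q, b). a \<in> homog A p \<and> b \<in> homog B q}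
     (\<lambda>(p, a, q, b) (p', a', q', b'). (p + p', a \<otimes>\<^bsub>A\<^esub> a', q + q', b \<otimes>\<^bsub>B\<^esub> b'))
     (\<lambda>(p, a, q, b) (p', a', q', b'). (- 1) ^ (q * p'))
     (0, \<one>\<^bsub>A\<^esub>, 0, \<one>\<^bsub>B\<^esub>)
     (\<lambda>(p, a, q, b). p + q)"

definition bilinearity_relations ::
  "('k::field, 'x) graded_algebra \<Rightarrow> ('k, 'y) graded_algebra \<Rightarrow>
   (nat \<times> 'x \<times> nat \<times> 'y \<Rightarrow> 'k) set" where
  "bilinearity_relations A B =
     {(\<lambda>w. basis_vec (p, a \<oplus>\<^bsub>A\<^esub> a', q, b) w - basis_vec (p, a, q, b) w
            - basis_vec (p, a', q, b) w) | p a a' q b.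
        a \<in> homog A p \<and> a' \<in> homog A p \<and> b \<in> homog B q} \<union>
     {(\<lambda>w. basis_vec (p, a, q, b \<oplus>\<^bsub>B\<^esub> b') w - basis_vec (p, a, q, b) w
            - basis_vec (p, a, q, b') w) | p a q b b'.
        a \<in> homog A p \<and> b \<in> homog B q \<and> b' \<in> homog B q} \<union>
     {(\<lambda>w. basis_vec (p, c \<odot>\<^bsub>A\<^esub> a, q, b) w - c * basis_vec (p, a, q, b) w) | p c a q b.
        a \<in> homog A p \<and> b \<in> homog B q} \<union>
     {(\<lambda>w. basis_vec (p, a, q, c \<odot>\<^bsub>B\<^esub> b) w - c * basis_vec (p, a, q, b) w) | p c a q b.
        a \<in> homog A p \<and> b \<in> homog B q}"

definition tensor_product ::
  "('k::field, 'x) graded_algebra \<Rightarrow> ('k, 'y) graded_algebra \<Rightarrow>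
   ('k, (nat \<times> 'x \<times> nat \<times> 'y \<Rightarrow> 'k) set) graded_algebra" where
  "tensor_product A B =
     quot_algebra (free_tensor A B) (Idl\<^bsub>free_tensor A B\<^esub> (bilinearity_relations A B))"


section \<open>Exterior algebras\<close>

text \<open>The tensor algebra of the vector space with basis \<open>S\<close>; its part of degree \<open>1\<close>
  is that vector space. Here and below the first argument only names the field.\<close>

definition tensor_algebra ::
  "'k::field itself \<Rightarrow> 'a set \<Rightarrow> ('k, 'a list \<Rightarrow> 'k) graded_algebra" where
  "tensor_algebra k S = based_algebra (lists S) (@) (\<lambda>_ _. 1) [] length"

definition exterior_ideal :: "'k::field itself \<Rightarrow> 'a set \<Rightarrow> ('a list \<Rightarrow> 'k) set" where
  "exterior_ideal k S = Idl\<^bsub>tensor_algebra k S\<^esub>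
     {v \<otimes>\<^bsub>tensor_algebra k S\<^esub> v | v. v \<in> homog (tensor_algebra k S) 1}"

definition exterior_algebra ::
  "'k::field itself \<Rightarrow> 'a set \<Rightarrow> ('k, ('a list \<Rightarrow> 'k) set) graded_algebra" where
  "exterior_algebra k S = quot_algebra (tensor_algebra k S) (exterior_ideal k S)"

definition ext_gen :: "'k::field itself \<Rightarrow> 'a set \<Rightarrow> 'a \<Rightarrow> ('a list \<Rightarrow> 'k) set" where
  "ext_gen k S s = exterior_ideal k S +>\<^bsub>tensor_algebra k S\<^esub> basis_vec [s]"

definition ext_monomial :: "'k::field itself \<Rightarrow> 'a set \<Rightarrow> 'a list \<Rightarrow> ('a list \<Rightarrow> 'k) set" where
  "ext_monomial k S ss =
     foldr (\<lambda>s x. ext_gen k S s \<otimes>\<^bsub>exterior_algebra k S\<^esub> x) ss \<one>\<^bsub>exterior_algebra k S\<^esub>"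

text \<open>The unique graded derivation sending every generator to \<open>1\<close>.\<close>

definition ext_deriv ::
  "'k::field itself \<Rightarrow> 'a set \<Rightarrow> ('a list \<Rightarrow> 'k) set \<Rightarrow> ('a list \<Rightarrow> 'k) set" where
  "ext_deriv k S = (THE d. d \<in> extensional (carrier (exterior_algebra k S)) \<and>
     graded_derivation (exterior_algebra k S) d \<and>
     (\<forall>s\<in>S. d (ext_gen k S s) = \<one>\<^bsub>exterior_algebra k S\<^esub>))"


section \<open>Orlik--Solomon algebras\<close>

text \<open>The product \<open>e\<^sub>C\<close> depends up to sign on an ordering of \<open>C\<close>; all orderings are admitted,
  which does not change the ideal.\<close>

definition os_ideal :: "'k::field itself \<Rightarrow> 'a matroid \<Rightarrow> ('a list \<Rightarrow> 'k) set set" where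
  "os_ideal k M = Idl\<^bsub>exterior_algebra k (ground M)\<^esub>
     {ext_deriv k (ground M) (ext_monomial k (ground M) ss) | ss.
        distinct ss \<and> set ss \<in> circuits M}"

definition os_algebra ::
  "'k::field itself \<Rightarrow> 'a matroid \<Rightarrow> ('k, ('a list \<Rightarrow> 'k) set set) graded_algebra" where
  "os_algebra k M = quot_algebra (exterior_algebra k (ground M)) (os_ideal k M)"

definition os_gen :: "'k::field itself \<Rightarrow> 'a matroid \<Rightarrow> 'a \<Rightarrow> ('a list \<Rightarrow> 'k) set set" where
  "os_gen k M s = os_ideal k M +>\<^bsub>exterior_algebra k (ground M)\<^esub> ext_gen k (ground M) s"

text \<open>The subalgebra generated by the images of the vectors with coordinate sum \<open>0\<close>.\<close>

definition reduced_os_algebra ::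
  "'k::field itself \<Rightarrow> 'a matroid \<Rightarrow> ('k, ('a list \<Rightarrow> 'k) set set) graded_algebra" where
  "reduced_os_algebra k M = generated_subalgebra (os_algebra k M)
     {\<Oplus>\<^bsub>os_algebra k M\<^esub>s\<in>ground M. v s \<odot>\<^bsub>os_algebra k M\<^esub> os_gen k M s | v.
        (\<Sum>s\<in>ground M. v s) = 0}"

text \<open>The unique algebra homomorphism sending \<open>e\<^sub>s\<close> to \<open>e\<^bsub>\<phi> s\<^esub>\<close>, where it exists.\<close>

definition os_map ::
  "'k::field itself \<Rightarrow> 'a matroid \<Rightarrow> 'b matroid \<Rightarrow> ('a \<Rightarrow> 'b) \<Rightarrow>
   ('a list \<Rightarrow> 'k) set set \<Rightarrow> ('b list \<Rightarrow> 'k) set set" where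
  "os_map k M N \<phi> = (THE f. f \<in> extensional (carrier (os_algebra k M)) \<and>
     f \<in> alg_hom (os_algebra k M) (os_algebra k N) \<and>
     (\<forall>s\<in>ground M. f (os_gen k M s) = os_gen k N (\<phi> s)))"

end

theory Submission
  imports Defs
begin

text \<open>
  Each ideal of relations is generated by the \<open>\<partial>(e\<^sub>C)\<close>, which involve only differences of
  generators. Modulo \<open>\<partial>(e\<^bsub>C\<^sub>1\<^esub>)\<close> and \<open>\<partial>(e\<^bsub>C\<^sub>2\<^esub>)\<close> with \<open>i \<in> C\<^sub>1 \<inter> C\<^sub>2\<close>, the element \<open>\<partial>\<close> of the glued
  circuit vanishes, so \<open>A(P)\<close> is presented by the circuits of \<open>M\<^sub>1\<close> and \<open>M\<^sub>2\<close> alone. All maps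
  therefore come from the universal property of Orlik--Solomon algebras.

  For the exact sequence put \<open>\<delta> = e\<^sub>i - e\<^bsub>i'\<^esub>\<close>. Sending \<open>e\<^sub>s\<close> to \<open>e\<^sub>s\<close> for \<open>s \<in> S\<^sub>1\<close> and to
  \<open>e\<^bsub>s'\<^esub> + \<delta>\<close> for \<open>s \<in> S\<^sub>2\<close> is a section \<open>\<sigma>\<close> of \<open>\<phi> = A(\<phi>)\<close>. There is a \<open>\<phi>\<close>-derivation \<open>\<tau>\<close> with
  \<open>\<tau>(e\<^sub>s) = 0\<close> and \<open>\<tau>(e\<^bsub>s'\<^esub>) = -1\<close>, and \<open>x = \<sigma>(\<phi> x) + \<delta> \<sigma>(\<tau> x)\<close>; hence \<open>b \<mapsto> \<delta> \<sigma>(b)\<close> is a kernel of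
  \<open>\<phi>\<close>, with left inverse \<open>\<tau>\<close>.

  For the isomorphism, \<open>e\<^sub>s \<mapsto> e\<^sub>s - e\<^sub>i\<close> is a retraction of \<open>A\<close> onto its reduced subalgebra. It
  factors through a homomorphism from \<open>A(P)\<close> to the tensor product, whose restriction to the
  reduced subalgebra is inverse to \<open>a \<otimes> b \<mapsto> a b\<close>.
\<close>

section \<open>Algebras over a field\<close>

text \<open>No basis of an Orlik--Solomon algebra is ever chosen. Injectivity and surjectivity come
  from explicit inverses, and equations between maps are tested on generators or on words in them.
  What makes the shift by \<delta> legitimate is that \<partial> is translation invariant: if t
  anticommutes with every generator and t t = 0, then replacing each e_s by e_s - t leaves
  \<partial>(e_C) unchanged. With t = -\<delta> this gives the section, with t = e_i the retraction.
  Two obstacles shape the development. The universal property yields algebra homomorphisms only,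
  while \<partial> and \<tau> are derivations; both are therefore read off as off-diagonal entries
  of homomorphisms into an algebra of triangular matrices, the signs of the Leibniz rule being
  supplied by an endomorphism that negates the generators. And a pure tensor carries the degrees of
  its factors as data, so a -> a \<otimes> 1 is available only as a family of maps, one for each
  degree; this is why homomorphisms given degree by degree are treated separately.\<close>

locale kalg = ring A for A :: "('k::field, 'x) graded_algebra" (structure) +
  assumes smult_closed [simp, intro]: "x \<in> carrier A \<Longrightarrow> c \<odot> x \<in> carrier A"
    and smult_r_distr: "x \<in> carrier A \<Longrightarrow> y \<in> carrier A \<Longrightarrow> c \<odot> (x \<oplus> y) = c \<odot> x \<oplus> c \<odot> y"
    and smult_l_distr: "x \<in> carrier A \<Longrightarrow> (c + d) \<odot> x = c \<odot> x \<oplus> d \<odot> x"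
    and smult_smult [simp]: "x \<in> carrier A \<Longrightarrow> c \<odot> (d \<odot> x) = (c * d) \<odot> x"
    and smult_one [simp]: "x \<in> carrier A \<Longrightarrow> 1 \<odot> x = x"
    and smult_mult_l [simp]:
      "x \<in> carrier A \<Longrightarrow> y \<in> carrier A \<Longrightarrow> (c \<odot> x) \<otimes> y = c \<odot> (x \<otimes> y)"
    and smult_mult_r [simp]:
      "x \<in> carrier A \<Longrightarrow> y \<in> carrier A \<Longrightarrow> x \<otimes> (c \<odot> y) = c \<odot> (x \<otimes> y)"
begin

lemma smult_0 [simp]:
  assumes x: "x \<in> carrier A"
  shows "0 \<odot> x = \<zero>"
proof -
  have "0 \<odot> x \<oplus> 0 \<odot> x = 0 \<odot> x" using smult_l_distr[OF x, of 0 0] by simp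
  then show ?thesis using x by (metis add.l_cancel_one' smult_closed)
qed

lemma smult_zero [simp]: "c \<odot> \<zero> = \<zero>"
  using smult_0[of \<zero>] smult_smult[of \<zero> c 0] by simp

lemma smult_uminus_one [simp]:
  assumes x: "x \<in> carrier A"
  shows "(- 1) \<odot> x = \<ominus> x"
proof -
  have "(- 1) \<odot> x \<oplus> x = \<zero>" using smult_l_distr[OF x, of "- 1" 1] x by simp
  then show ?thesis using x by (metis minus_equality smult_closed)
qed

lemma smult_uminus [simp]: "x \<in> carrier A \<Longrightarrow> (- c) \<odot> x = \<ominus> (c \<odot> x)"
  by (metis mult_minus1 smult_closed smult_smult smult_uminus_one)

lemma uminus_smult [simp]: "x \<in> carrier A \<Longrightarrow> c \<odot> (\<ominus> x) = \<ominus> (c \<odot> x)"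
  by (metis mult_minus1 mult_minus1_right smult_closed smult_smult smult_uminus_one)

end

text \<open>Only closure conditions are imposed; neither spanning by homogeneous elements nor
  directness of their sum is part of the notion. In this form it passes to quotients by arbitrary
  ideals and to arbitrary generated subalgebras.\<close>

locale galg = kalg +
  assumes homog_subset: "homog A p \<subseteq> carrier A"
    and homog_zero [simp, intro]: "\<zero> \<in> homog A p"
    and homog_add [intro]: "x \<in> homog A p \<Longrightarrow> y \<in> homog A p \<Longrightarrow> x \<oplus> y \<in> homog A p"
    and homog_smult [intro]: "x \<in> homog A p \<Longrightarrow> c \<odot> x \<in> homog A p"
    and homog_one [simp, intro]: "\<one> \<in> homog A 0"
    and homog_mult [intro]: "x \<in> homog A p \<Longrightarrow> y \<in> homog A q \<Longrightarrow> x \<otimes> y \<in> homog A (p + q)"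
begin

lemma homog_carrier: "x \<in> homog A p \<Longrightarrow> x \<in> carrier A"
  using homog_subset by blast

lemma homog_minus: "x \<in> homog A p \<Longrightarrow> y \<in> homog A p \<Longrightarrow> x \<ominus> y \<in> homog A p"
  by (metis a_minus_def homog_add homog_carrier homog_smult smult_uminus_one)

end

locale kalg_hom = A: kalg A + B: kalg B
  for A :: "('k::field, 'x) graded_algebra" and B :: "('k, 'y) graded_algebra" and h +
  assumes h: "h \<in> alg_hom A B"
begin

lemma closed [simp, intro]: "x \<in> carrier A \<Longrightarrow> h x \<in> carrier B"
  and add [simp]: "\<lbrakk>x \<in> carrier A; y \<in> carrier A\<rbrakk> \<Longrightarrow> h (x \<oplus>\<^bsub>A\<^esub> y) = h x \<oplus>\<^bsub>B\<^esub> h y"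
  and mult [simp]: "\<lbrakk>x \<in> carrier A; y \<in> carrier A\<rbrakk> \<Longrightarrow> h (x \<otimes>\<^bsub>A\<^esub> y) = h x \<otimes>\<^bsub>B\<^esub> h y"
  and one [simp]: "h \<one>\<^bsub>A\<^esub> = \<one>\<^bsub>B\<^esub>"
  and smult [simp]: "x \<in> carrier A \<Longrightarrow> h (c \<odot>\<^bsub>A\<^esub> x) = c \<odot>\<^bsub>B\<^esub> h x"
  using h by (auto simp: alg_hom_def linear_maps_def ring_hom_def)

lemma zero [simp]: "h \<zero>\<^bsub>A\<^esub> = \<zero>\<^bsub>B\<^esub>"
  using smult[of "\<zero>\<^bsub>A\<^esub>" 0] by simp

lemma uminus [simp]: "x \<in> carrier A \<Longrightarrow> h (\<ominus>\<^bsub>A\<^esub> x) = \<ominus>\<^bsub>B\<^esub> h x"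
  using smult[of x "- 1"] by simp

lemma minus [simp]: "\<lbrakk>x \<in> carrier A; y \<in> carrier A\<rbrakk> \<Longrightarrow> h (x \<ominus>\<^bsub>A\<^esub> y) = h x \<ominus>\<^bsub>B\<^esub> h y"
  by (simp add: a_minus_def)

lemma linear: "h \<in> linear_maps A B"
  using h by (simp add: alg_hom_def)

lemma kernel_ideal: "ideal {x \<in> carrier A. h x = \<zero>\<^bsub>B\<^esub>} A"
proof (rule idealI[OF A.ring_axioms])
  show "subgroup {x \<in> carrier A. h x = \<zero>\<^bsub>B\<^esub>} (add_monoid A)"
    by (rule A.add.subgroupI) (auto simp: a_inv_def[symmetric])
qed auto

text \<open>Every ideal of relations in the development is given by generators; this reduces its
  vanishing under a homomorphism to theirs.\<close>

lemma kernel_genideal: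
  assumes "X \<subseteq> carrier A" "\<And>x. x \<in> X \<Longrightarrow> h x = \<zero>\<^bsub>B\<^esub>" "x \<in> Idl\<^bsub>A\<^esub> X"
  shows "h x = \<zero>\<^bsub>B\<^esub>"
  using A.genideal_minimal[OF kernel_ideal, of X] assms by auto

end

lemma alg_homI:
  assumes "\<And>x. x \<in> carrier A \<Longrightarrow> h x \<in> carrier B"
    and "\<And>x y. \<lbrakk>x \<in> carrier A; y \<in> carrier A\<rbrakk> \<Longrightarrow> h (x \<oplus>\<^bsub>A\<^esub> y) = h x \<oplus>\<^bsub>B\<^esub> h y"
    and "\<And>x y. \<lbrakk>x \<in> carrier A; y \<in> carrier A\<rbrakk> \<Longrightarrow> h (x \<otimes>\<^bsub>A\<^esub> y) = h x \<otimes>\<^bsub>B\<^esub> h y"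
    and "h \<one>\<^bsub>A\<^esub> = \<one>\<^bsub>B\<^esub>"
    and "\<And>c x. x \<in> carrier A \<Longrightarrow> h (c \<odot>\<^bsub>A\<^esub> x) = c \<odot>\<^bsub>B\<^esub> h x"
  shows "h \<in> alg_hom A B"
  using assms by (auto simp: alg_hom_def linear_maps_def ring_hom_def)

lemma alg_hom_compose:
  assumes "f \<in> alg_hom A B" "g \<in> alg_hom B C"
  shows "(\<lambda>x. g (f x)) \<in> alg_hom A C"
  using assms by (auto simp: alg_hom_def linear_maps_def ring_hom_def Pi_iff)

lemma kalg_hom_compose:
  assumes "kalg_hom A B f" "kalg_hom B C g"
  shows "kalg_hom A C (\<lambda>x. g (f x))"
  using assms alg_hom_compose by (auto simp: kalg_hom_def kalg_hom_axioms_def)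

lemma linear_mapsI:
  assumes "\<And>x. x \<in> carrier A \<Longrightarrow> h x \<in> carrier B"
    and "\<And>x y. \<lbrakk>x \<in> carrier A; y \<in> carrier A\<rbrakk> \<Longrightarrow> h (x \<oplus>\<^bsub>A\<^esub> y) = h x \<oplus>\<^bsub>B\<^esub> h y"
    and "\<And>c x. x \<in> carrier A \<Longrightarrow> h (c \<odot>\<^bsub>A\<^esub> x) = c \<odot>\<^bsub>B\<^esub> h x"
  shows "h \<in> linear_maps A B"
  using assms by (auto simp: linear_maps_def)

lemma linear_mapsD:
  assumes "h \<in> linear_maps A B"
  shows "x \<in> carrier A \<Longrightarrow> h x \<in> carrier B"
    and "\<lbrakk>x \<in> carrier A; y \<in> carrier A\<rbrakk> \<Longrightarrow> h (x \<oplus>\<^bsub>A\<^esub> y) = h x \<oplus>\<^bsub>B\<^esub> h y"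
    and "x \<in> carrier A \<Longrightarrow> h (c \<odot>\<^bsub>A\<^esub> x) = c \<odot>\<^bsub>B\<^esub> h x"
  using assms by (auto simp: linear_maps_def)

lemma linear_maps_zero:
  assumes "kalg A" "kalg B" "h \<in> linear_maps A B"
  shows "h \<zero>\<^bsub>A\<^esub> = \<zero>\<^bsub>B\<^esub>"
proof -
  interpret A: kalg A by fact
  interpret B: kalg B by fact
  show ?thesis
    using linear_mapsD(3)[OF assms(3) A.zero_closed, of 0] linear_mapsD(1)[OF assms(3) A.zero_closed]
    by simp
qed

text \<open>Defined by closure rather than by finite linear combinations, so that equality of linear
  maps and homogeneity of images follow by rule induction without handling coefficients.\<close>

inductive_set lspan :: "('k, 'x) graded_algebra \<Rightarrow> 'x set \<Rightarrow> 'x set" for A X where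
  zero: "\<zero>\<^bsub>A\<^esub> \<in> lspan A X"
| base: "x \<in> X \<Longrightarrow> x \<in> lspan A X"
| add: "x \<in> lspan A X \<Longrightarrow> y \<in> lspan A X \<Longrightarrow> x \<oplus>\<^bsub>A\<^esub> y \<in> lspan A X"
| smult: "x \<in> lspan A X \<Longrightarrow> c \<odot>\<^bsub>A\<^esub> x \<in> lspan A X"

lemma (in kalg) lspan_carrier:
  assumes "X \<subseteq> carrier A" "x \<in> lspan A X"
  shows "x \<in> carrier A"
  using assms(2,1) by induction auto

lemma lspan_linear_eq:
  assumes "kalg A" "kalg B" "f \<in> linear_maps A B" "g \<in> linear_maps A B"
    and "X \<subseteq> carrier A" "\<And>x. x \<in> X \<Longrightarrow> f x = g x" "x \<in> lspan A X"
  shows "f x = g x"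
  using assms(7)
proof induction
  case (add x y)
  then show ?case
    using kalg.lspan_carrier[OF assms(1,5)] assms(3,4) by (simp add: linear_mapsD)
next
  case (smult x c)
  then show ?case
    using kalg.lspan_carrier[OF assms(1,5)] assms(3,4) by (simp add: linear_mapsD)
qed (use assms linear_maps_zero in \<open>auto simp: linear_maps_zero\<close>)

lemma lspan_linear_image:
  assumes "kalg A" "kalg B" "f \<in> linear_maps A B" "X \<subseteq> carrier A"
  shows "f ` lspan A X = lspan B (f ` X)"
proof (intro equalityI subsetI)
  fix y assume "y \<in> f ` lspan A X"
  then obtain x where "x \<in> lspan A X" "y = f x" by blast
  then show "y \<in> lspan B (f ` X)"
  proof (induction arbitrary: y)
    case zero
    then show ?case by (simp add: linear_maps_zero[OF assms(1-3)] lspan.zero)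
  next
    case (add x y)
    then show ?case
      using kalg.lspan_carrier[OF assms(1,4)] assms(3) by (simp add: linear_mapsD lspan.add)
  next
    case (smult x c)
    then show ?case
      using kalg.lspan_carrier[OF assms(1,4)] assms(3) by (simp add: linear_mapsD lspan.smult)
  qed (auto intro: lspan.base)
next
  fix y assume "y \<in> lspan B (f ` X)"
  then show "y \<in> f ` lspan A X"
  proof induction
    case zero
    then show ?case
      by (metis image_eqI linear_maps_zero[OF assms(1-3)] lspan.zero)
  next
    case (add x y)
    then obtain x' y' where "x' \<in> lspan A X" "y' \<in> lspan A X" "x = f x'" "y = f y'" by blast
    then show ?case
      using kalg.lspan_carrier[OF assms(1,4)] linear_mapsD(2)[OF assms(3)] lspan.add
      by (metis image_eqI)
  next
    case (smult x c)
    then obtain x' where "x' \<in> lspan A X" "x = f x'" by blast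
    then show ?case
      using kalg.lspan_carrier[OF assms(1,4)] linear_mapsD(3)[OF assms(3)] lspan.smult
      by (metis image_eqI)
  qed (auto intro: lspan.base)
qed

lemma (in galg) lspan_homog:
  assumes "x \<in> lspan A X" "X \<subseteq> homog A p"
  shows "x \<in> homog A p"
  using assms by induction auto

text \<open>Here \<open>B\<close> is a bare record with no axioms known beforehand: they are
  transported along a surjection compatible with the operations. The quotient algebra obtains its
  structure in this way from the coset map.\<close>

lemma kalg_image:
  assumes "kalg A"
    and c: "carrier B = h ` carrier A"
    and a: "\<And>x y. \<lbrakk>x \<in> carrier A; y \<in> carrier A\<rbrakk> \<Longrightarrow> h x \<oplus>\<^bsub>B\<^esub> h y = h (x \<oplus>\<^bsub>A\<^esub> y)"
    and m: "\<And>x y. \<lbrakk>x \<in> carrier A; y \<in> carrier A\<rbrakk> \<Longrightarrow> h x \<otimes>\<^bsub>B\<^esub> h y = h (x \<otimes>\<^bsub>A\<^esub> y)"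
    and o: "\<one>\<^bsub>B\<^esub> = h \<one>\<^bsub>A\<^esub>" and z: "\<zero>\<^bsub>B\<^esub> = h \<zero>\<^bsub>A\<^esub>"
    and s: "\<And>c x. x \<in> carrier A \<Longrightarrow> c \<odot>\<^bsub>B\<^esub> h x = h (c \<odot>\<^bsub>A\<^esub> x)"
  shows "kalg B"
proof -
  interpret A: kalg A by fact
  have "ring B"
  proof (rule ringI)
    show "abelian_group B"
    proof (rule abelian_groupI)
      fix x assume "x \<in> carrier B"
      then obtain x' where "x = h x'" "x' \<in> carrier A" using c by auto
      then show "\<exists>y\<in>carrier B. y \<oplus>\<^bsub>B\<^esub> x = \<zero>\<^bsub>B\<^esub>"
        by (intro bexI[of _ "h (\<ominus>\<^bsub>A\<^esub> x')"]) (auto simp: a c z A.l_neg)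
    qed (auto simp: a c z A.a_ac)
    show "monoid B"
      by (rule monoidI) (auto simp: c m o A.m_assoc)
  qed (auto simp: c a m A.l_distr A.r_distr)
  then show ?thesis
    unfolding kalg_def kalg_axioms_def
    by (auto simp: c a m s A.smult_r_distr A.smult_l_distr)
qed

lemma galg_image:
  assumes "galg A"
    and c: "carrier B = h ` carrier A" and H: "\<And>p. homog B p = h ` homog A p"
    and a: "\<And>x y. \<lbrakk>x \<in> carrier A; y \<in> carrier A\<rbrakk> \<Longrightarrow> h x \<oplus>\<^bsub>B\<^esub> h y = h (x \<oplus>\<^bsub>A\<^esub> y)"
    and m: "\<And>x y. \<lbrakk>x \<in> carrier A; y \<in> carrier A\<rbrakk> \<Longrightarrow> h x \<otimes>\<^bsub>B\<^esub> h y = h (x \<otimes>\<^bsub>A\<^esub> y)"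
    and o: "\<one>\<^bsub>B\<^esub> = h \<one>\<^bsub>A\<^esub>" and z: "\<zero>\<^bsub>B\<^esub> = h \<zero>\<^bsub>A\<^esub>"
    and s: "\<And>c x. x \<in> carrier A \<Longrightarrow> c \<odot>\<^bsub>B\<^esub> h x = h (c \<odot>\<^bsub>A\<^esub> x)"
  shows "galg B"
proof -
  interpret A: galg A by fact
  have "kalg B" using assms A.kalg_axioms by (intro kalg_image[of A B h])
  then show ?thesis
    unfolding galg_def galg_axioms_def using A.homog_subset
    by (auto simp: H c a m s o z A.homog_carrier image_iff subset_iff; blast)
qed

section \<open>Quotients and subalgebras\<close>

locale kalg_ideal = kalg + I: ideal I A for I
begin

abbreviation proj where "proj \<equiv> (\<lambda>x. I +> x)"

text \<open>A scalar acts as multiplication by its multiple of the unit, so a ring ideal is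
  automatically a subspace.\<close>

lemma I_smult: 
  assumes "x \<in> I" shows "c \<odot> x \<in> I"
proof -
  have "(c \<odot> \<one>) \<otimes> x \<in> I" using assms by (intro I.I_l_closed) auto
  then show ?thesis using I.Icarr[OF assms] by simp
qed

lemma proj_eq_iff:
  assumes "x \<in> carrier A" "y \<in> carrier A"
  shows "I +> x = I +> y \<longleftrightarrow> x \<ominus> y \<in> I"
  using quotient_eq_iff_same_a_r_cos[OF I.is_ideal assms] by blast

text \<open>Scalar multiplication on cosets is a union over all representatives. Two representatives
  differ by an element of \<open>I\<close>, which stays in \<open>I\<close> after scaling, so all
  members of the union coincide.\<close>

lemma proj_smult:
  assumes x: "x \<in> carrier A"
  shows "(\<Union>y\<in>I +> x. I +> (c \<odot> y)) = I +> (c \<odot> x)"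
proof -
  have "I +> (c \<odot> y) = I +> (c \<odot> x)" if y: "y \<in> I +> x" for y
  proof -
    obtain z where z: "z \<in> I" "y = z \<oplus> x" using y by (auto simp: a_r_coset_def r_coset_def)
    have zc: "z \<in> carrier A" using z I.Icarr by auto
    have "c \<odot> y \<ominus> c \<odot> x = c \<odot> z"
      using z x zc by (simp add: smult_r_distr a_minus_def a_assoc r_neg)
    then show ?thesis using z x zc I_smult by (subst proj_eq_iff) auto
  qed
  moreover have "x \<in> I +> x" using x by (simp add: I.a_rcos_self)
  ultimately show ?thesis by blast
qed

abbreviation "Q \<equiv> quot_algebra A I"

lemma quot_simps:
  shows "carrier Q = proj ` carrier A"
    and "\<lbrakk>x \<in> carrier A; y \<in> carrier A\<rbrakk> \<Longrightarrow> proj x \<oplus>\<^bsub>Q\<^esub> proj y = proj (x \<oplus> y)"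
    and "\<lbrakk>x \<in> carrier A; y \<in> carrier A\<rbrakk> \<Longrightarrow> proj x \<otimes>\<^bsub>Q\<^esub> proj y = proj (x \<otimes> y)"
    and "\<one>\<^bsub>Q\<^esub> = proj \<one>" and "\<zero>\<^bsub>Q\<^esub> = proj \<zero>"
    and "x \<in> carrier A \<Longrightarrow> c \<odot>\<^bsub>Q\<^esub> proj x = proj (c \<odot> x)"
    and "homog Q p = proj ` homog A p"
proof -
  have "proj \<zero> = I" using I.a_subset by (simp add: a_coset_add_zero)
  then show "\<zero>\<^bsub>Q\<^esub> = proj \<zero>" by (simp add: quot_algebra_def FactRing_def)
  show "x \<in> carrier A \<Longrightarrow> c \<odot>\<^bsub>Q\<^esub> proj x = proj (c \<odot> x)"
    using proj_smult[of x c] by (simp only: quot_algebra_def module.select_convs)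
qed (auto simp: quot_algebra_def FactRing_def A_RCOSETS_def' I.rcoset_mult_add I.a_rcos_sum)

lemma kalg_quot: "kalg Q"
  by (rule kalg_image[OF kalg_axioms, where h = proj]) (simp_all add: quot_simps)

lemma kalg_hom_proj: "kalg_hom A Q proj"
  using kalg_quot kalg_axioms
  by (auto simp: kalg_hom_def kalg_hom_axioms_def quot_simps intro!: alg_homI)

lemma proj_zero_iff: "x \<in> carrier A \<Longrightarrow> proj x = \<zero>\<^bsub>Q\<^esub> \<longleftrightarrow> x \<in> I"
  by (simp add: quot_simps proj_eq_iff a_minus_def)

text \<open>The induced map evaluates \<open>h\<close> at a chosen representative of a coset; the
  choice is harmless because differences of representatives lie in \<open>I\<close>, where
  \<open>h\<close> vanishes.\<close>

lemma factor:
  assumes "kalg_hom A B h" "\<And>x. x \<in> I \<Longrightarrow> h x = \<zero>\<^bsub>B\<^esub>"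
  shows "\<exists>g. kalg_hom Q B g \<and> (\<forall>x\<in>carrier A. g (proj x) = h x)"
proof -
  interpret h: kalg_hom A B h by fact
  define g where "g X = h (SOME x. x \<in> carrier A \<and> X = proj x)" for X
  have g: "g (proj x) = h x" if x: "x \<in> carrier A" for x
  proof -
    define y where "y = (SOME y. y \<in> carrier A \<and> proj x = proj y)"
    have y: "y \<in> carrier A \<and> proj x = proj y"
      unfolding y_def by (rule someI) (use x in auto)
    then have "h (x \<ominus> y) = \<zero>\<^bsub>B\<^esub>" using proj_eq_iff x assms(2) by blast
    then have "h x \<ominus>\<^bsub>B\<^esub> h y = \<zero>\<^bsub>B\<^esub>" using x y by simp
    then have "h x = h y" using x y h.B.r_right_minus_eq by blast
    then show ?thesis by (simp add: g_def y_def)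
  qed
  have "g \<in> alg_hom Q B"
    by (rule alg_homI) (auto simp: quot_simps g)
  then show ?thesis using kalg_quot h.B.kalg_axioms g
    by (auto simp: kalg_hom_def kalg_hom_axioms_def)
qed

end

lemma (in kalg) kalg_ideal_genideal: "X \<subseteq> carrier A \<Longrightarrow> kalg_ideal A (Idl X)"
  by (simp add: genideal_ideal kalg_axioms kalg_ideal.intro)

lemma (in galg) galg_quot:
  assumes "ideal I A"
  shows "galg (quot_algebra A I)"
proof -
  interpret kalg_ideal A I using assms by (simp add: kalg_axioms kalg_ideal.intro)
  show ?thesis
    by (rule galg_image[OF galg_axioms, where h = proj]) (simp_all add: quot_simps)
qed

section \<open>Subalgebras and the subalgebra generated by a set\<close>

lemma (in kalg) subalgebra_kalg:
  assumes "subring H A" "\<And>c x. x \<in> H \<Longrightarrow> c \<odot> x \<in> H"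
  shows "kalg (A\<lparr>carrier := H, homog := g\<rparr>)"
proof -
  have sub: "\<And>x. x \<in> H \<Longrightarrow> x \<in> carrier A" using subringE(1)[OF assms(1)] by blast
  note s = subringE[OF assms(1)]
  have "ring (A\<lparr>carrier := H, homog := g\<rparr>)"
  proof (rule ringI)
    show "abelian_group (A\<lparr>carrier := H, homog := g\<rparr>)"
    proof (rule abelian_groupI)
      fix x assume "x \<in> carrier (A\<lparr>carrier := H, homog := g\<rparr>)"
      then show "\<exists>y\<in>carrier (A\<lparr>carrier := H, homog := g\<rparr>).
          y \<oplus>\<^bsub>A\<lparr>carrier := H, homog := g\<rparr>\<^esub> x = \<zero>\<^bsub>A\<lparr>carrier := H, homog := g\<rparr>\<^esub>"
        by (intro bexI[of _ "\<ominus> x"]) (auto simp: s l_neg sub)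
    qed (auto simp: s sub a_ac)
    show "monoid (A\<lparr>carrier := H, homog := g\<rparr>)"
      by (rule monoidI) (auto simp: s sub m_assoc)
  qed (auto simp: s sub l_distr r_distr)
  then show ?thesis
    unfolding kalg_def kalg_axioms_def
    by (auto simp: assms(2) sub smult_r_distr smult_l_distr)
qed

lemma generated_subalgebra_carrier:
  "carrier (generated_subalgebra A X) =
    \<Inter>{B. subring B A \<and> (\<forall>c. \<forall>x\<in>B. c \<odot>\<^bsub>A\<^esub> x \<in> B) \<and> X \<subseteq> B}"
  by (simp add: generated_subalgebra_def Let_def)

lemma generated_subalgebra_eq:
  "generated_subalgebra A X = A\<lparr>carrier := carrier (generated_subalgebra A X),
     homog := (\<lambda>p. homog A p \<inter> carrier (generated_subalgebra A X))\<rparr>"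
  by (simp add: generated_subalgebra_def Let_def)

lemma generated_subalgebra_simps [simp]:
  shows "x \<oplus>\<^bsub>generated_subalgebra A X\<^esub> y = x \<oplus>\<^bsub>A\<^esub> y"
    and "x \<otimes>\<^bsub>generated_subalgebra A X\<^esub> y = x \<otimes>\<^bsub>A\<^esub> y"
    and "c \<odot>\<^bsub>generated_subalgebra A X\<^esub> x = c \<odot>\<^bsub>A\<^esub> x"
    and "\<one>\<^bsub>generated_subalgebra A X\<^esub> = \<one>\<^bsub>A\<^esub>"
    and "\<zero>\<^bsub>generated_subalgebra A X\<^esub> = \<zero>\<^bsub>A\<^esub>"
    and "homog (generated_subalgebra A X) p = homog A p \<inter> carrier (generated_subalgebra A X)"
  by (simp_all add: generated_subalgebra_def Let_def)

lemma generated_subalgebra_minimal: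
  assumes "subring B A" "\<And>c x. x \<in> B \<Longrightarrow> c \<odot>\<^bsub>A\<^esub> x \<in> B" "X \<subseteq> B"
  shows "carrier (generated_subalgebra A X) \<subseteq> B"
  using assms by (auto simp: generated_subalgebra_carrier)

context kalg
begin

lemma generated_subalgebra_subring:
  assumes "X \<subseteq> carrier A"
  shows "subring (carrier (generated_subalgebra A X)) A"
    and "x \<in> carrier (generated_subalgebra A X) \<Longrightarrow>
      c \<odot> x \<in> carrier (generated_subalgebra A X)"
    and "X \<subseteq> carrier (generated_subalgebra A X)"
proof -
  show "subring (carrier (generated_subalgebra A X)) A"
    unfolding generated_subalgebra_carrier
    by (rule subring_Inter) (use carrier_is_subring assms in auto)
qed (auto simp: generated_subalgebra_carrier)

lemma generated_subalgebra_kalg: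
  assumes "X \<subseteq> carrier A"
  shows "kalg (generated_subalgebra A X)"
  by (subst generated_subalgebra_eq, rule subalgebra_kalg)
    (use generated_subalgebra_subring[OF assms] in auto)

end

lemma (in galg) generated_subalgebra_galg:
  assumes "X \<subseteq> carrier A"
  shows "galg (generated_subalgebra A X)"
  unfolding galg_def galg_axioms_def
  using generated_subalgebra_kalg[OF assms] generated_subalgebra_subring[OF assms]
    subringE[OF generated_subalgebra_subring(1)[OF assms]]
  by auto

section \<open>Algebras with a basis\<close>

text \<open>Both sides of the multiplicativity equation are bilinear, so it extends from
  \<open>X\<close> to the span, in the second argument (fact \<open>1\<close>) and then in the first
  (fact \<open>2\<close>).\<close>

lemma mult_extends_from_spanning_set:
  assumes "kalg A" "kalg B" and f: "f \<in> linear_maps A B" and "f \<one>\<^bsub>A\<^esub> = \<one>\<^bsub>B\<^esub>"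
    and X: "X \<subseteq> carrier A" "carrier A = lspan A X"
    and m: "\<And>x y. x \<in> X \<Longrightarrow> y \<in> X \<Longrightarrow> f (x \<otimes>\<^bsub>A\<^esub> y) = f x \<otimes>\<^bsub>B\<^esub> f y"
  shows "kalg_hom A B f"
proof -
  interpret A: kalg A by fact
  interpret B: kalg B by fact
  note l = linear_mapsD[OF f]
  have z: "f \<zero>\<^bsub>A\<^esub> = \<zero>\<^bsub>B\<^esub>" using linear_maps_zero assms by blast
  have sub: "x \<in> lspan A X \<Longrightarrow> x \<in> carrier A" for x using X by simp
  have 1: "f (x \<otimes>\<^bsub>A\<^esub> y) = f x \<otimes>\<^bsub>B\<^esub> f y" if x: "x \<in> X" and y: "y \<in> lspan A X" for x y
    using y
  proof induction
    case zero
    then show ?case using x X l(1) by (auto simp: z subset_iff)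
  next
    case (base y)
    then show ?case using x m by auto
  next
    case (add y y')
    then have "y \<in> carrier A" "y' \<in> carrier A" "x \<in> carrier A" using sub x X(1) by blast+
    then show ?case using add by (simp add: l A.r_distr B.r_distr)
  next
    case (smult y c)
    then have "y \<in> carrier A" "x \<in> carrier A" using sub x X(1) by blast+
    then show ?case using smult by (simp add: l)
  qed
  have 2: "f (x \<otimes>\<^bsub>A\<^esub> y) = f x \<otimes>\<^bsub>B\<^esub> f y" if x: "x \<in> lspan A X" and y: "y \<in> carrier A" for x y
    using x
  proof induction
    case zero
    then show ?case using y l(1) by (simp add: z)
  next
    case (base x)
    then show ?case using y 1 X by auto
  next
    case (add x x')
    then have "x \<in> carrier A" "x' \<in> carrier A" using sub by blast+
    then show ?case using add y by (simp add: l A.l_distr B.l_distr)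
  next
    case (smult x c)
    then have "x \<in> carrier A" using sub by blast+
    then show ?case using smult y by (simp add: l)
  qed
  have "f \<in> alg_hom A B"
    by (rule alg_homI) (use 2 X l assms in auto)
  then show ?thesis using assms by (simp add: kalg_hom_def kalg_hom_axioms_def)
qed

text \<open>Reindexing along the fibres of \<open>m\<close>: a sum over values d of pairs with
  \<open>m b c = d\<close> becomes a sum over the pairs. It eliminates the intermediate basis
  element in a triple product.\<close>

lemma sum_fibre:
  fixes k :: "'b \<Rightarrow> 'c \<Rightarrow> 'k::field"
  assumes "finite D" "\<And>b c. b \<in> F \<Longrightarrow> c \<in> G \<Longrightarrow> m b c \<in> D"
  shows "(\<Sum>d\<in>D. (\<Sum>b\<in>F. \<Sum>c\<in>G. if m b c = d then k b c else 0) * T d) =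
    (\<Sum>b\<in>F. \<Sum>c\<in>G. k b c * T (m b c))"
proof -
  have "(\<Sum>d\<in>D. (\<Sum>b\<in>F. \<Sum>c\<in>G. if m b c = d then k b c else 0) * T d) =
      (\<Sum>d\<in>D. \<Sum>b\<in>F. \<Sum>c\<in>G. if m b c = d then k b c * T d else 0)"
    by (auto simp: sum_distrib_right intro!: sum.cong)
  also have "\<dots> = (\<Sum>b\<in>F. \<Sum>d\<in>D. \<Sum>c\<in>G. if m b c = d then k b c * T d else 0)"
    by (rule sum.swap)
  also have "\<dots> = (\<Sum>b\<in>F. \<Sum>c\<in>G. \<Sum>d\<in>D. if m b c = d then k b c * T d else 0)"
    by (intro sum.cong refl sum.swap)
  also have "\<dots> = (\<Sum>b\<in>F. \<Sum>c\<in>G. k b c * T (m b c))"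
    by (intro sum.cong refl) (use assms in \<open>simp add: sum.delta'\<close>)
  finally show ?thesis .
qed

text \<open>A twisted monoid algebra: \<open>\<epsilon>\<close> is a normalized 2-cocycle on the
  monoid \<open>B\<close>, and the cocycle identity is associativity of the product on basis
  elements. Words with trivial \<open>\<epsilon>\<close> give the tensor algebra; symbols
  \<open>(p, a, q, b)\<close> with the Koszul sign give the free algebra behind a tensor
  product.\<close>

locale based =
  fixes B :: "'b set" and m :: "'b \<Rightarrow> 'b \<Rightarrow> 'b" and \<epsilon> :: "'b \<Rightarrow> 'b \<Rightarrow> 'k::field"
    and u :: 'b and dg :: "'b \<Rightarrow> nat"
  assumes u: "u \<in> B" and m: "\<And>b c. b \<in> B \<Longrightarrow> c \<in> B \<Longrightarrow> m b c \<in> B"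
    and m_assoc: "\<And>b c d. \<lbrakk>b \<in> B; c \<in> B; d \<in> B\<rbrakk> \<Longrightarrow> m (m b c) d = m b (m c d)"
    and m_unit: "\<And>b. b \<in> B \<Longrightarrow> m u b = b" "\<And>b. b \<in> B \<Longrightarrow> m b u = b"
    and \<epsilon>_unit: "\<And>b. b \<in> B \<Longrightarrow> \<epsilon> u b = 1" "\<And>b. b \<in> B \<Longrightarrow> \<epsilon> b u = 1"
    and \<epsilon>_cocycle: "\<And>b c d. \<lbrakk>b \<in> B; c \<in> B; d \<in> B\<rbrakk> \<Longrightarrow>
      \<epsilon> b c * \<epsilon> (m b c) d = \<epsilon> c d * \<epsilon> b (m c d)"
    and dg_u: "dg u = 0" and dg_m: "\<And>b c. b \<in> B \<Longrightarrow> c \<in> B \<Longrightarrow> dg (m b c) = dg b + dg c"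
begin

abbreviation "X \<equiv> based_algebra B m \<epsilon> u dg"

abbreviation (input) supp where "supp x \<equiv> {b. x b \<noteq> (0::'k)}"

lemma carrier_iff: "x \<in> carrier X \<longleftrightarrow> finite (supp x) \<and> supp x \<subseteq> B"
  by (simp add: based_algebra_def)

lemma homog_iff: "x \<in> homog X p \<longleftrightarrow> finite (supp x) \<and> supp x \<subseteq> {b \<in> B. dg b = p}"
  by (simp add: based_algebra_def)

lemma X_simps:
  shows "x \<oplus>\<^bsub>X\<^esub> y = (\<lambda>w. x w + y w)" "\<zero>\<^bsub>X\<^esub> = (\<lambda>w. 0)" "c \<odot>\<^bsub>X\<^esub> x = (\<lambda>w. c * x w)"
    "\<one>\<^bsub>X\<^esub> = basis_vec u"
  by (simp_all add: based_algebra_def basis_vec_def)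

text \<open>The definition sums over the exact supports. Since the additional terms vanish, any
  finite sets containing the supports will do, which allows products of elements with different
  supports to be compared over common index sets.\<close>

lemma mult_eq:
  assumes F: "finite F" "supp x \<subseteq> F" and G: "finite G" "supp y \<subseteq> G"
  shows "(x \<otimes>\<^bsub>X\<^esub> y) w = (\<Sum>b\<in>F. \<Sum>c\<in>G. if m b c = w then \<epsilon> b c * x b * y c else 0)"
proof -
  have "(x \<otimes>\<^bsub>X\<^esub> y) w = (\<Sum>(b, c) \<in> {(b, c). x b \<noteq> 0 \<and> y c \<noteq> 0 \<and> m b c = w}. \<epsilon> b c * x b * y c)"
    by (simp add: based_algebra_def)
  also have "\<dots> = (\<Sum>(b, c) \<in> F \<times> G. if m b c = w then \<epsilon> b c * x b * y c else 0)"
    by (rule sum.mono_neutral_cong_left) (use F G in \<open>auto split: if_splits\<close>)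
  finally show ?thesis by (simp add: sum.cartesian_product)
qed

lemma mult_supp:
  assumes "finite F" "supp x \<subseteq> F" "finite G" "supp y \<subseteq> G"
  shows "supp (x \<otimes>\<^bsub>X\<^esub> y) \<subseteq> (\<lambda>(b, c). m b c) ` (F \<times> G)"
proof
  fix w assume "w \<in> supp (x \<otimes>\<^bsub>X\<^esub> y)"
  then have ne: "(\<Sum>b\<in>F. \<Sum>c\<in>G. if m b c = w then \<epsilon> b c * x b * y c else 0) \<noteq> 0"
    using mult_eq[OF assms] by simp
  show "w \<in> (\<lambda>(b, c). m b c) ` (F \<times> G)"
  proof (rule ccontr)
    assume "w \<notin> (\<lambda>(b, c). m b c) ` (F \<times> G)"
    then have "(\<Sum>b\<in>F. \<Sum>c\<in>G. if m b c = w then \<epsilon> b c * x b * y c else 0) = 0"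
      by (intro sum.neutral ballI) force
    then show False using ne by contradiction
  qed
qed

lemma homog_closed_mult:
  assumes "x \<in> homog X p" "y \<in> homog X q"
  shows "x \<otimes>\<^bsub>X\<^esub> y \<in> homog X (p + q)"
proof -
  have "supp (x \<otimes>\<^bsub>X\<^esub> y) \<subseteq> (\<lambda>(b, c). m b c) ` (supp x \<times> supp y)"
    by (rule mult_supp) (use assms in \<open>auto simp: homog_iff\<close>)
  moreover have "(\<lambda>(b, c). m b c) ` (supp x \<times> supp y) \<subseteq> {b \<in> B. dg b = p + q}"
    using assms by (auto simp: homog_iff m dg_m subset_iff)
  moreover have "finite ((\<lambda>(b, c). m b c) ` (supp x \<times> supp y))"
    using assms by (auto simp: homog_iff)
  ultimately show ?thesis unfolding homog_iff by (meson finite_subset subset_trans)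
qed

lemma closed_mult:
  assumes "x \<in> carrier X" "y \<in> carrier X"
  shows "x \<otimes>\<^bsub>X\<^esub> y \<in> carrier X"
proof -
  have "supp (x \<otimes>\<^bsub>X\<^esub> y) \<subseteq> (\<lambda>(b, c). m b c) ` (supp x \<times> supp y)"
    by (rule mult_supp) (use assms in \<open>auto simp: carrier_iff\<close>)
  moreover have "(\<lambda>(b, c). m b c) ` (supp x \<times> supp y) \<subseteq> B"
    using assms by (auto simp: carrier_iff m subset_iff)
  moreover have "finite ((\<lambda>(b, c). m b c) ` (supp x \<times> supp y))"
    using assms by (auto simp: carrier_iff)
  ultimately show ?thesis unfolding carrier_iff by (meson finite_subset subset_trans)
qed

lemma supp_add: "supp (\<lambda>w. x w + y w) \<subseteq> supp x \<union> supp y"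
  and supp_smult: "supp (\<lambda>w. c * x w) \<subseteq> supp x"
  by auto

lemma supp_add_in:
  assumes "finite (supp x) \<and> supp x \<subseteq> D" "finite (supp y) \<and> supp y \<subseteq> D"
  shows "finite (supp (\<lambda>w. x w + y w)) \<and> supp (\<lambda>w. x w + y w) \<subseteq> D"
proof
  show "finite (supp (\<lambda>w. x w + y w))" by (rule finite_subset[OF supp_add]) (use assms in simp)
  show "supp (\<lambda>w. x w + y w) \<subseteq> D" by (rule subset_trans[OF supp_add]) (use assms in simp)
qed

lemma supp_smult_in:
  assumes "finite (supp x) \<and> supp x \<subseteq> D"
  shows "finite (supp (\<lambda>w. c * x w)) \<and> supp (\<lambda>w. c * x w) \<subseteq> D"
proof
  show "finite (supp (\<lambda>w. c * x w))" by (rule finite_subset[OF supp_smult]) (use assms in simp)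
  show "supp (\<lambda>w. c * x w) \<subseteq> D" by (rule subset_trans[OF supp_smult]) (use assms in simp)
qed

lemma closed_add: "\<lbrakk>x \<in> carrier X; y \<in> carrier X\<rbrakk> \<Longrightarrow> x \<oplus>\<^bsub>X\<^esub> y \<in> carrier X"
  and closed_smult: "x \<in> carrier X \<Longrightarrow> c \<odot>\<^bsub>X\<^esub> x \<in> carrier X"
  unfolding carrier_iff X_simps
  by (rule supp_add_in supp_smult_in, assumption+)+

lemma homog_closed_add: "\<lbrakk>x \<in> homog X p; y \<in> homog X p\<rbrakk> \<Longrightarrow> x \<oplus>\<^bsub>X\<^esub> y \<in> homog X p"
  and homog_closed_smult: "x \<in> homog X p \<Longrightarrow> c \<odot>\<^bsub>X\<^esub> x \<in> homog X p"
  unfolding homog_iff X_simps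
  by (rule supp_add_in supp_smult_in, assumption+)+

lemma basis_vec_homog: "b \<in> B \<Longrightarrow> dg b = p \<Longrightarrow> basis_vec b \<in> homog X p"
  by (auto simp: homog_iff basis_vec_def)

lemma basis_vec_carrier: "b \<in> B \<Longrightarrow> basis_vec b \<in> carrier X"
  by (auto simp: carrier_iff basis_vec_def)

text \<open>Both bracketings expand to one triple sum over the three supports; the cocycle identity
  matches their summands.\<close>

lemma mult_assoc_aux:
  assumes x: "x \<in> carrier X" and y: "y \<in> carrier X" and z: "z \<in> carrier X"
  shows "(x \<otimes>\<^bsub>X\<^esub> y) \<otimes>\<^bsub>X\<^esub> z = x \<otimes>\<^bsub>X\<^esub> (y \<otimes>\<^bsub>X\<^esub> z)"
proof
  fix w
  let ?F = "supp x" and ?G = "supp y" and ?H = "supp z"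
  have fin: "finite ?F" "finite ?G" "finite ?H" and sub: "?F \<subseteq> B" "?G \<subseteq> B" "?H \<subseteq> B"
    using assms by (auto simp: carrier_iff)
  let ?D = "(\<lambda>(b, c). m b c) ` (?F \<times> ?G)" and ?E = "(\<lambda>(b, c). m b c) ` (?G \<times> ?H)"
  \<comment> \<open>\<open>T\<close> and \<open>U\<close> collect what depends on the inner product
    only through its index, which is the shape in which \<open>sum_fibre\<close> applies.\<close>
  define T where "T d = (\<Sum>e\<in>?H. if m d e = w then \<epsilon> d e * z e else 0)" for d
  define U where "U b d = (if m b d = w then \<epsilon> b d * x b else 0)" for b d
  have "((x \<otimes>\<^bsub>X\<^esub> y) \<otimes>\<^bsub>X\<^esub> z) w =
      (\<Sum>d\<in>?D. \<Sum>e\<in>?H. if m d e = w then \<epsilon> d e * (x \<otimes>\<^bsub>X\<^esub> y) d * z e else 0)"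
    by (rule mult_eq) (use fin mult_supp[of ?F x ?G y] in auto)
  also have "\<dots> = (\<Sum>d\<in>?D. (x \<otimes>\<^bsub>X\<^esub> y) d * T d)"
    by (auto simp: T_def sum_distrib_left intro!: sum.cong)
  also have "\<dots> = (\<Sum>d\<in>?D. (\<Sum>b\<in>?F. \<Sum>c\<in>?G. if m b c = d then \<epsilon> b c * x b * y c else 0) * T d)"
    using mult_eq[of ?F x ?G y] fin by simp
  also have "\<dots> = (\<Sum>b\<in>?F. \<Sum>c\<in>?G. \<epsilon> b c * x b * y c * T (m b c))"
    by (rule sum_fibre) (use fin in auto)
  also have "\<dots> = (\<Sum>b\<in>?F. \<Sum>c\<in>?G. \<Sum>e\<in>?H.
      if m (m b c) e = w then \<epsilon> b c * \<epsilon> (m b c) e * x b * y c * z e else 0)"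
    by (auto simp: T_def sum_distrib_left intro!: sum.cong)
  also have "\<dots> = (\<Sum>b\<in>?F. \<Sum>c\<in>?G. \<Sum>e\<in>?H.
      if m b (m c e) = w then \<epsilon> c e * \<epsilon> b (m c e) * x b * y c * z e else 0)"
  proof (intro sum.cong refl)
    fix b c e assume "b \<in> ?F" "c \<in> ?G" "e \<in> ?H"
    then have "b \<in> B" "c \<in> B" "e \<in> B" using sub by blast+
    then show "(if m (m b c) e = w then \<epsilon> b c * \<epsilon> (m b c) e * x b * y c * z e else 0) =
      (if m b (m c e) = w then \<epsilon> c e * \<epsilon> b (m c e) * x b * y c * z e else 0)"
      by (simp add: m_assoc \<epsilon>_cocycle)
  qed
  also have "\<dots> = (\<Sum>b\<in>?F. \<Sum>c\<in>?G. \<Sum>e\<in>?H. \<epsilon> c e * y c * z e * U b (m c e))"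
    by (auto simp: U_def intro!: sum.cong)
  also have "\<dots> = (\<Sum>b\<in>?F. \<Sum>d\<in>?E.
      (\<Sum>c\<in>?G. \<Sum>e\<in>?H. if m c e = d then \<epsilon> c e * y c * z e else 0) * U b d)"
    by (intro sum.cong refl sum_fibre[symmetric]) (use fin in auto)
  also have "\<dots> = (\<Sum>b\<in>?F. \<Sum>d\<in>?E. (y \<otimes>\<^bsub>X\<^esub> z) d * U b d)"
    using mult_eq[of ?G y ?H z] fin by simp
  also have "\<dots> = (\<Sum>b\<in>?F. \<Sum>d\<in>?E. if m b d = w then \<epsilon> b d * x b * (y \<otimes>\<^bsub>X\<^esub> z) d else 0)"
    by (auto simp: U_def intro!: sum.cong)
  also have "\<dots> = (x \<otimes>\<^bsub>X\<^esub> (y \<otimes>\<^bsub>X\<^esub> z)) w"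
    by (rule mult_eq[symmetric]) (use fin mult_supp[of ?G y ?H z] in auto)
  finally show "((x \<otimes>\<^bsub>X\<^esub> y) \<otimes>\<^bsub>X\<^esub> z) w = (x \<otimes>\<^bsub>X\<^esub> (y \<otimes>\<^bsub>X\<^esub> z)) w" .
qed

lemma mult_add_left:
  assumes "x \<in> carrier X" "x' \<in> carrier X" "y \<in> carrier X"
  shows "(\<lambda>w. x w + x' w) \<otimes>\<^bsub>X\<^esub> y = (\<lambda>w. (x \<otimes>\<^bsub>X\<^esub> y) w + (x' \<otimes>\<^bsub>X\<^esub> y) w)"
proof
  fix w
  let ?F = "supp x \<union> supp x'" and ?G = "supp y"
  have fin: "finite ?F" "finite ?G" using assms by (auto simp: carrier_iff)
  show "((\<lambda>w. x w + x' w) \<otimes>\<^bsub>X\<^esub> y) w = (x \<otimes>\<^bsub>X\<^esub> y) w + (x' \<otimes>\<^bsub>X\<^esub> y) w"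
    by (subst (1 2 3) mult_eq[of ?F _ ?G])
      (use fin in \<open>auto simp: algebra_simps simp flip: sum.distrib intro!: sum.cong\<close>)
qed

lemma mult_add_right:
  assumes "x \<in> carrier X" "y \<in> carrier X" "y' \<in> carrier X"
  shows "x \<otimes>\<^bsub>X\<^esub> (\<lambda>w. y w + y' w) = (\<lambda>w. (x \<otimes>\<^bsub>X\<^esub> y) w + (x \<otimes>\<^bsub>X\<^esub> y') w)"
proof
  fix w
  let ?F = "supp x" and ?G = "supp y \<union> supp y'"
  have fin: "finite ?F" "finite ?G" using assms by (auto simp: carrier_iff)
  show "(x \<otimes>\<^bsub>X\<^esub> (\<lambda>w. y w + y' w)) w = (x \<otimes>\<^bsub>X\<^esub> y) w + (x \<otimes>\<^bsub>X\<^esub> y') w"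
    by (subst (1 2 3) mult_eq[of ?F _ ?G])
      (use fin in \<open>auto simp: algebra_simps simp flip: sum.distrib intro!: sum.cong\<close>)
qed

lemma mult_smult_aux:
  assumes "x \<in> carrier X" "y \<in> carrier X"
  shows "(\<lambda>w. c * x w) \<otimes>\<^bsub>X\<^esub> y = (\<lambda>w. c * (x \<otimes>\<^bsub>X\<^esub> y) w)"
    and "x \<otimes>\<^bsub>X\<^esub> (\<lambda>w. c * y w) = (\<lambda>w. c * (x \<otimes>\<^bsub>X\<^esub> y) w)"
proof -
  have fin: "finite (supp x)" "finite (supp y)" using assms by (auto simp: carrier_iff)
  show "(\<lambda>w. c * x w) \<otimes>\<^bsub>X\<^esub> y = (\<lambda>w. c * (x \<otimes>\<^bsub>X\<^esub> y) w)"
    by (rule ext, subst (1 2) mult_eq[of "supp x" _ "supp y"])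
      (auto simp: fin sum_distrib_left intro!: sum.cong)
  show "x \<otimes>\<^bsub>X\<^esub> (\<lambda>w. c * y w) = (\<lambda>w. c * (x \<otimes>\<^bsub>X\<^esub> y) w)"
    by (rule ext, subst (1 2) mult_eq[of "supp x" _ "supp y"])
      (auto simp: fin sum_distrib_left intro!: sum.cong)
qed

lemma basis_vec_mult:
  assumes "b \<in> B" "c \<in> B"
  shows "basis_vec b \<otimes>\<^bsub>X\<^esub> basis_vec c = \<epsilon> b c \<odot>\<^bsub>X\<^esub> basis_vec (m b c)"
  by (rule ext, subst mult_eq[of "{b}" _ "{c}"])
    (auto simp: basis_vec_def X_simps)

lemma mult_one_aux:
  assumes x: "x \<in> carrier X"
  shows "basis_vec u \<otimes>\<^bsub>X\<^esub> x = x" "x \<otimes>\<^bsub>X\<^esub> basis_vec u = x"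
proof -
  have fin: "finite (supp x)" and sub: "supp x \<subseteq> B" using x by (auto simp: carrier_iff)
  show "basis_vec u \<otimes>\<^bsub>X\<^esub> x = x"
  proof
    fix w
    have "(basis_vec u \<otimes>\<^bsub>X\<^esub> x) w =
        (\<Sum>b\<in>{u}. \<Sum>c\<in>supp x. if m b c = w then \<epsilon> b c * basis_vec u b * x c else 0)"
      by (rule mult_eq) (use fin in \<open>auto simp: basis_vec_def\<close>)
    also have "\<dots> = (\<Sum>c\<in>supp x. if c = w then x c else 0)"
      using sub by (auto simp: basis_vec_def m_unit \<epsilon>_unit subset_iff intro!: sum.cong)
    finally show "(basis_vec u \<otimes>\<^bsub>X\<^esub> x) w = x w" using fin by simp
  qed
  show "x \<otimes>\<^bsub>X\<^esub> basis_vec u = x"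
  proof
    fix w
    have "(x \<otimes>\<^bsub>X\<^esub> basis_vec u) w =
        (\<Sum>b\<in>supp x. \<Sum>c\<in>{u}. if m b c = w then \<epsilon> b c * x b * basis_vec u c else 0)"
      by (rule mult_eq) (use fin in \<open>auto simp: basis_vec_def\<close>)
    also have "\<dots> = (\<Sum>c\<in>supp x. if c = w then x c else 0)"
      using sub by (auto simp: basis_vec_def m_unit \<epsilon>_unit subset_iff intro!: sum.cong)
    finally show "(x \<otimes>\<^bsub>X\<^esub> basis_vec u) w = x w" using fin by simp
  qed
qed

lemma kalg: "kalg X"
proof -
  have "ring X"
  proof (rule ringI)
    show "abelian_group X"
    proof (rule abelian_groupI)
      fix x assume x: "x \<in> carrier X"
      then show "\<exists>y\<in>carrier X. y \<oplus>\<^bsub>X\<^esub> x = \<zero>\<^bsub>X\<^esub>"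
        by (intro bexI[of _ "(- 1) \<odot>\<^bsub>X\<^esub> x"] closed_smult) (auto simp: X_simps)
      show "\<zero>\<^bsub>X\<^esub> \<oplus>\<^bsub>X\<^esub> x = x" by (simp add: X_simps)
    next
      show "\<zero>\<^bsub>X\<^esub> \<in> carrier X" by (simp add: X_simps carrier_iff)
    qed (rule closed_add, assumption+, auto simp: X_simps algebra_simps)
    show "monoid X"
      by (rule monoidI) (auto simp: closed_mult mult_assoc_aux X_simps basis_vec_carrier u mult_one_aux)
  qed (auto simp: X_simps mult_add_left mult_add_right)
  then show ?thesis
    unfolding kalg_def kalg_axioms_def
    by (auto simp: closed_smult) (auto simp: X_simps mult_smult_aux algebra_simps)
qed

lemma galg: "galg X"
proof -
  have "\<one>\<^bsub>X\<^esub> \<in> homog X 0" by (simp add: X_simps basis_vec_homog u dg_u)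
  moreover have "\<zero>\<^bsub>X\<^esub> \<in> homog X p" for p by (simp add: X_simps homog_iff)
  moreover have "homog X p \<subseteq> carrier X" for p by (auto simp: homog_iff carrier_iff)
  ultimately show ?thesis
    unfolding galg_def galg_axioms_def
    using kalg homog_closed_add homog_closed_smult homog_closed_mult by blast
qed

lemma lspan_basis:
  assumes "finite F" "supp x \<subseteq> F" "F \<subseteq> B'"
  shows "x \<in> lspan X (basis_vec ` B')"
  using assms
proof (induction F arbitrary: x rule: finite_induct)
  case empty
  then have "x = \<zero>\<^bsub>X\<^esub>" by (auto simp: X_simps)
  then show ?case by (simp add: lspan.zero)
next
  case (insert b F)
  let ?y = "x(b := 0)"
  have "?y \<in> lspan X (basis_vec ` B')" by (rule insert.IH) (use insert.prems in auto)
  moreover have "x b \<odot>\<^bsub>X\<^esub> basis_vec b \<in> lspan X (basis_vec ` B')"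
    using insert.prems by (intro lspan.smult lspan.base) auto
  moreover have "x = ?y \<oplus>\<^bsub>X\<^esub> (x b \<odot>\<^bsub>X\<^esub> basis_vec b)"
    by (auto simp: X_simps basis_vec_def)
  ultimately show ?case using lspan.add by metis
qed

lemma homog_span: "homog X p = lspan X (basis_vec ` {b \<in> B. dg b = p})"
proof (intro equalityI subsetI)
  fix x assume "x \<in> lspan X (basis_vec ` {b \<in> B. dg b = p})"
  then show "x \<in> homog X p"
    by (rule galg.lspan_homog[OF galg]) (auto simp: basis_vec_homog)
qed (rule lspan_basis, auto simp: homog_iff)

lemma carrier_span: "carrier X = lspan X (basis_vec ` B)"
proof (intro equalityI subsetI)
  fix x assume "x \<in> lspan X (basis_vec ` B)"
  then show "x \<in> carrier X"
    by (rule kalg.lspan_carrier[OF kalg, rotated]) (auto simp: basis_vec_carrier)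
qed (rule lspan_basis, auto simp: carrier_iff)

lemma extend_linear:
  assumes "kalg R" and f: "\<And>b. b \<in> B \<Longrightarrow> f b \<in> carrier R"
  shows "\<exists>h \<in> linear_maps X R. \<forall>b\<in>B. h (basis_vec b) = f b"
proof -
  interpret R: kalg R by fact
  define h where "h x = finsum R (\<lambda>b. x b \<odot>\<^bsub>R\<^esub> f b) (supp x)" for x
  \<comment> \<open>The support of a sum or a multiple may be smaller than expected; freedom in the
    summation set lets all terms be written over one finite set.\<close>
  have heq: "h x = finsum R (\<lambda>b. x b \<odot>\<^bsub>R\<^esub> f b) F" if "finite F" "supp x \<subseteq> F" "F \<subseteq> B" for x F
    unfolding h_def by (rule R.add.finprod_mono_neutral_cong_left) (use that f in auto)
  have "h \<in> linear_maps X R"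
  proof (rule linear_mapsI)
    fix x assume x: "x \<in> carrier X"
    have fin: "finite (supp x)" and sub: "supp x \<subseteq> B" using x by (auto simp: carrier_iff)
    show "h x \<in> carrier R" unfolding h_def
      by (rule R.finsum_closed) (use sub f in blast)
    { fix y assume y: "y \<in> carrier X"
      let ?F = "supp x \<union> supp y"
      have F: "finite ?F" "?F \<subseteq> B" using x y by (auto simp: carrier_iff)
      have "h (x \<oplus>\<^bsub>X\<^esub> y) = finsum R (\<lambda>b. (x b + y b) \<odot>\<^bsub>R\<^esub> f b) ?F"
        using F supp_add[of x y] heq[of ?F "x \<oplus>\<^bsub>X\<^esub> y"] by (simp add: X_simps)
      also have "\<dots> = finsum R (\<lambda>b. x b \<odot>\<^bsub>R\<^esub> f b \<oplus>\<^bsub>R\<^esub> y b \<odot>\<^bsub>R\<^esub> f b) ?F"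
        by (rule R.finsum_cong') (use F f in \<open>auto simp: R.smult_l_distr\<close>)
      also have "\<dots> = h x \<oplus>\<^bsub>R\<^esub> h y"
        using F f by (subst (1 2) heq[of ?F]) (auto intro!: R.finsum_addf)
      finally show "h (x \<oplus>\<^bsub>X\<^esub> y) = h x \<oplus>\<^bsub>R\<^esub> h y" . }
    fix c
    have "finsum R (\<lambda>b. (c * x b) \<odot>\<^bsub>R\<^esub> f b) F = c \<odot>\<^bsub>R\<^esub> finsum R (\<lambda>b. x b \<odot>\<^bsub>R\<^esub> f b) F"
      if "finite F" "F \<subseteq> B" for F
      using that
    proof (induction F rule: finite_induct)
      case (insert b F)
      then show ?case using f
        by (subst (1 2) R.finsum_insert) (auto simp: R.smult_r_distr subset_iff)
    qed simp
    then have "finsum R (\<lambda>b. (c * x b) \<odot>\<^bsub>R\<^esub> f b) (supp x) = c \<odot>\<^bsub>R\<^esub> h x"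
      using fin sub by (simp add: h_def)
    then show "h (c \<odot>\<^bsub>X\<^esub> x) = c \<odot>\<^bsub>R\<^esub> h x"
      using fin sub heq[of "supp x" "c \<odot>\<^bsub>X\<^esub> x"] by (auto simp: X_simps)
  qed
  moreover have "h (basis_vec b) = f b" if "b \<in> B" for b
    using heq[of "{b}" "basis_vec b"] that f by (simp add: basis_vec_def)
  ultimately show ?thesis by blast
qed

lemma extend_hom:
  assumes "kalg R" and f: "\<And>b. b \<in> B \<Longrightarrow> f b \<in> carrier R"
    and f_mult: "\<And>b c. b \<in> B \<Longrightarrow> c \<in> B \<Longrightarrow> f b \<otimes>\<^bsub>R\<^esub> f c = \<epsilon> b c \<odot>\<^bsub>R\<^esub> f (m b c)"
    and f_u: "f u = \<one>\<^bsub>R\<^esub>"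
  shows "\<exists>h. kalg_hom X R h \<and> (\<forall>b\<in>B. h (basis_vec b) = f b)"
proof -
  obtain h where h: "h \<in> linear_maps X R" "\<And>b. b \<in> B \<Longrightarrow> h (basis_vec b) = f b"
    using extend_linear[of R f, OF assms(1) f] by blast
  have "kalg_hom X R h"
  proof (rule mult_extends_from_spanning_set[OF kalg assms(1) h(1) _ _ carrier_span])
    show "h \<one>\<^bsub>X\<^esub> = \<one>\<^bsub>R\<^esub>" using h(2) u f_u by (simp add: X_simps)
  qed (auto simp: basis_vec_carrier basis_vec_mult h f_mult linear_mapsD(3)[OF h(1)] m)
  then show ?thesis using h(2) by blast
qed

end

section \<open>Words in anticommuting elements and their derivatives\<close>

definition word :: "('k, 'x) graded_algebra \<Rightarrow> ('a \<Rightarrow> 'x) \<Rightarrow> 'a list \<Rightarrow> 'x" where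
  "word A r ss = foldr (\<lambda>s x. r s \<otimes>\<^bsub>A\<^esub> x) ss \<one>\<^bsub>A\<^esub>"

text \<open>The Leibniz rule unrolled along a product of odd elements that all have derivative 1.
  The formula makes sense in every algebra, including those on which no derivation is given, and
  homomorphisms preserve it; the relations can therefore be checked directly in the target of a
  map.\<close>

fun word_deriv :: "('k, 'x) graded_algebra \<Rightarrow> ('a \<Rightarrow> 'x) \<Rightarrow> 'a list \<Rightarrow> 'x" where
  "word_deriv A r [] = \<zero>\<^bsub>A\<^esub>"
| "word_deriv A r (s # ss) = word A r ss \<ominus>\<^bsub>A\<^esub> r s \<otimes>\<^bsub>A\<^esub> word_deriv A r ss"

lemma word_simps [simp]:
  "word A r [] = \<one>\<^bsub>A\<^esub>" "word A r (s # ss) = r s \<otimes>\<^bsub>A\<^esub> word A r ss"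
  by (simp_all add: word_def)

lemma word_cong: "(\<And>s. s \<in> set ss \<Longrightarrow> r s = r' s) \<Longrightarrow> word A r ss = word A r' ss"
  by (induction ss) auto

lemma word_deriv_cong:
  "(\<And>s. s \<in> set ss \<Longrightarrow> r s = r' s) \<Longrightarrow> word_deriv A r ss = word_deriv A r' ss"
  by (induction ss) (auto simp: word_cong[of _ r r'])

lemma word_map: "word A r (map f ss) = word A (\<lambda>s. r (f s)) ss"
  by (induction ss) auto

lemma word_deriv_map: "word_deriv A r (map f ss) = word_deriv A (\<lambda>s. r (f s)) ss"
  by (induction ss) (auto simp: word_map)

lemma (in kalg) word_closed:
  "(\<And>s. s \<in> set ss \<Longrightarrow> r s \<in> carrier A) \<Longrightarrow> word A r ss \<in> carrier A"
  by (induction ss) auto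

lemma (in kalg) word_deriv_closed:
  "(\<And>s. s \<in> set ss \<Longrightarrow> r s \<in> carrier A) \<Longrightarrow> word_deriv A r ss \<in> carrier A"
  by (induction ss) (auto simp: word_closed)

lemma (in galg) word_homog:
  "(\<And>s. s \<in> set ss \<Longrightarrow> r s \<in> homog A 1) \<Longrightarrow> word A r ss \<in> homog A (length ss)"
  using homog_mult[of _ 1] by (induction ss) fastforce+

lemma (in galg) word_deriv_homog:
  assumes "\<And>s. s \<in> set ss \<Longrightarrow> r s \<in> homog A 1"
  shows "word_deriv A r ss \<in> homog A (length ss - 1)"
  using assms
proof (induction ss)
  case (Cons s ss)
  have w: "word A r ss \<in> homog A (length ss)" using Cons.prems by (intro word_homog) auto
  \<comment> \<open>For empty \<open>ss\<close> the truncated \<open>length ss - 1\<close> would put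
    the product in degree 1 instead of 0. The derivative is then zero, which lies in every
    degree.\<close>
  have "r s \<otimes> word_deriv A r ss \<in> homog A (length ss)"
  proof (cases ss)
    case Nil
    then show ?thesis using Cons.prems homog_carrier[of "r s" 1] by simp
  next
    case (Cons t tt)
    then show ?thesis
      using homog_mult[of "r s" 1 "word_deriv A r ss" "length ss - 1"] Cons.IH Cons.prems by simp
  qed
  then show ?case using w by (simp add: homog_minus)
qed simp

lemma (in kalg_hom) hom_word:
  "(\<And>s. s \<in> set ss \<Longrightarrow> r s \<in> carrier A) \<Longrightarrow> h (word A r ss) = word B (\<lambda>s. h (r s)) ss"
  by (induction ss) (auto simp: A.word_closed)

lemma (in kalg_hom) hom_word_deriv:
  "(\<And>s. s \<in> set ss \<Longrightarrow> r s \<in> carrier A) \<Longrightarrow>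
    h (word_deriv A r ss) = word_deriv B (\<lambda>s. h (r s)) ss"
  by (induction ss) (auto simp: A.word_closed A.word_deriv_closed hom_word)

lemma (in kalg) anti_lcomm:
  assumes "x \<in> carrier A" "y \<in> carrier A" "z \<in> carrier A" "x \<otimes> y = \<ominus> (y \<otimes> x)"
  shows "x \<otimes> (y \<otimes> z) = \<ominus> (y \<otimes> (x \<otimes> z))"
  using assms m_assoc[of x y z] by (simp add: l_minus m_assoc)

text \<open>In characteristic 2 anticommutation at s = t says nothing about squares, so these are
  required to vanish by a condition of their own.\<close>

locale anticommuting = kalg A for A :: "('k::field, 'x) graded_algebra" (structure) +
  fixes S :: "'a set" and r :: "'a \<Rightarrow> 'x"
  assumes r_closed [simp]: "s \<in> S \<Longrightarrow> r s \<in> carrier A"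
    and r_anti: "\<lbrakk>s \<in> S; t \<in> S\<rbrakk> \<Longrightarrow> r s \<otimes> r t = \<ominus> (r t \<otimes> r s)"
    and r_sq: "s \<in> S \<Longrightarrow> r s \<otimes> r s = \<zero>"
begin

abbreviation "w \<equiv> word A r"
abbreviation "d \<equiv> word_deriv A r"

lemma w_closed [simp]: "set ss \<subseteq> S \<Longrightarrow> w ss \<in> carrier A"
  by (rule word_closed) auto

lemma d_closed [simp]: "set ss \<subseteq> S \<Longrightarrow> d ss \<in> carrier A"
  by (rule word_deriv_closed) auto

lemma w_append: "\<lbrakk>set xs \<subseteq> S; set ys \<subseteq> S\<rbrakk> \<Longrightarrow> w (xs @ ys) = w xs \<otimes> w ys"
  by (induction xs) (auto simp: m_assoc)

lemma d_append:
  assumes "set xs \<subseteq> S" "set ys \<subseteq> S"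
  shows "d (xs @ ys) = d xs \<otimes> w ys \<oplus> (- 1) ^ length xs \<odot> (w xs \<otimes> d ys)"
  using assms
proof (induction xs)
  case (Cons s xs)
  then show ?case
    by (simp add: w_append a_minus_def l_distr r_distr l_minus r_minus minus_add m_assoc a_assoc)
qed (auto simp: w_append)

lemma anti_word:
  assumes t: "t \<in> carrier A" "\<And>s. s \<in> S \<Longrightarrow> t \<otimes> r s = \<ominus> (r s \<otimes> t)" and ss: "set ss \<subseteq> S"
  shows "t \<otimes> w ss = (- 1) ^ length ss \<odot> (w ss \<otimes> t)"
  using ss
proof (induction ss)
  case (Cons s ss)
  have "t \<otimes> (r s \<otimes> w ss) = \<ominus> (r s \<otimes> (t \<otimes> w ss))"
    by (rule anti_lcomm) (use Cons.prems t in auto)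
  then show ?case using Cons t(1) by (simp add: m_assoc)
qed (use t in simp)

text \<open>The derivative of a word has one factor fewer than the word, so the sign is that of
  \<open>anti_word\<close> with one more minus; writing it this way avoids a truncated subtraction
  in the exponent.\<close>

lemma anti_deriv:
  assumes t: "t \<in> carrier A" "\<And>s. s \<in> S \<Longrightarrow> t \<otimes> r s = \<ominus> (r s \<otimes> t)" and ss: "set ss \<subseteq> S"
  shows "t \<otimes> d ss = \<ominus> ((- 1) ^ length ss \<odot> (d ss \<otimes> t))"
  using ss
proof (induction ss)
  case (Cons s ss)
  have "t \<otimes> (r s \<otimes> d ss) = \<ominus> (r s \<otimes> (t \<otimes> d ss))"
    by (rule anti_lcomm) (use Cons.prems t in auto)
  then have "t \<otimes> (r s \<otimes> d ss) = (- 1) ^ length ss \<odot> (r s \<otimes> (d ss \<otimes> t))"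
    using Cons t(1) by (simp add: m_assoc r_minus minus_minus)
  moreover have "t \<otimes> w ss = (- 1) ^ length ss \<odot> (w ss \<otimes> t)"
    by (rule anti_word) (use t Cons.prems in auto)
  ultimately show ?case using Cons.prems t(1)
    by (simp add: a_minus_def l_distr r_distr l_minus r_minus minus_add m_assoc smult_r_distr
        minus_minus)
qed (use t in simp)

text \<open>The elements \<open>\<partial>(e\<^sub>C)\<close> depend only on differences of the generators.\<close>

lemma translate:
  assumes t: "t \<in> carrier A" "\<And>s. s \<in> S \<Longrightarrow> t \<otimes> r s = \<ominus> (r s \<otimes> t)" "t \<otimes> t = \<zero>"
    and ss: "set ss \<subseteq> S"
  shows "word A (\<lambda>s. r s \<ominus> t) ss = w ss \<ominus> t \<otimes> d ss \<and> word_deriv A (\<lambda>s. r s \<ominus> t) ss = d ss"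
  using ss
proof (induction ss)
  case (Cons s ss)
  then have IH: "word A (\<lambda>s. r s \<ominus> t) ss = w ss \<ominus> t \<otimes> d ss"
    "word_deriv A (\<lambda>s. r s \<ominus> t) ss = d ss" and s: "s \<in> S" "set ss \<subseteq> S"
    by auto
  have tt: "t \<otimes> (t \<otimes> d ss) = \<zero>" using t s m_assoc[of t t "d ss"] by simp
  have ts: "r s \<otimes> (t \<otimes> d ss) = \<ominus> (t \<otimes> (r s \<otimes> d ss))"
    by (rule anti_lcomm) (use s t(1) t(2)[OF s(1)] in \<open>simp_all add: minus_minus\<close>)
  \<comment> \<open>In the derivative of \<open>s # ss\<close> the translated word contributes
    \<open>- t \<otimes> d ss\<close>, and so does the part of the subtracted term that contains
    \<open>t\<close>. These cancel, which is the invariance; the formula for the word is proved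
    along with it because the recursion of the derivative refers to the word.\<close>
  have cancel: "(p \<ominus> q) \<ominus> (u \<ominus> q) = p \<ominus> u"
    if "p \<in> carrier A" "q \<in> carrier A" "u \<in> carrier A" for p q u
  proof -
    have "(p \<ominus> q) \<ominus> (u \<ominus> q) = p \<oplus> (\<ominus> q \<oplus> (q \<oplus> \<ominus> u))"
      using that by (simp add: a_minus_def minus_add minus_minus a_assoc a_comm)
    then show ?thesis using that by (simp add: a_minus_def r_neg1)
  qed
  have "word A (\<lambda>s. r s \<ominus> t) (s # ss) = r s \<otimes> w ss \<ominus> t \<otimes> (w ss \<ominus> r s \<otimes> d ss)"
  proof -
    have c: "w ss \<in> carrier A" "d ss \<in> carrier A" "r s \<in> carrier A" using s by auto
    have "(r s \<ominus> t) \<otimes> (w ss \<ominus> t \<otimes> d ss) =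
        (r s \<otimes> w ss \<oplus> \<ominus> (r s \<otimes> (t \<otimes> d ss))) \<oplus> (\<ominus> (t \<otimes> w ss) \<oplus> t \<otimes> (t \<otimes> d ss))"
      using c t(1)
      by (simp add: a_minus_def l_distr r_distr l_minus r_minus minus_minus minus_add a_ac)
    also have "\<dots> = r s \<otimes> w ss \<oplus> (t \<otimes> (r s \<otimes> d ss) \<oplus> \<ominus> (t \<otimes> w ss))"
      using c t(1) by (simp add: tt ts minus_minus a_assoc)
    also have "\<dots> = r s \<otimes> w ss \<ominus> t \<otimes> (w ss \<ominus> r s \<otimes> d ss)"
      using c t(1) by (simp add: a_minus_def r_distr r_minus minus_minus minus_add a_comm)
    finally show ?thesis by (simp add: IH)
  qed
  moreover have "word_deriv A (\<lambda>s. r s \<ominus> t) (s # ss) = (w ss \<ominus> t \<otimes> d ss) \<ominus> (r s \<otimes> d ss \<ominus> t \<otimes> d ss)"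
    using s t(1) by (simp add: IH) (simp add: a_minus_def l_distr l_minus)
  ultimately show ?case using s t(1) by (simp add: cancel)
qed (use t in \<open>simp add: a_minus_def\<close>)

text \<open>One common sign for the word and its derivative: prefixing a letter mixes the two, so
  separate signs would not survive \<open>sgn_eq_Cons\<close>. Leaving the sign unspecified avoids
  computing the parity of a permutation.\<close>

definition sgn_eq :: "'a list \<Rightarrow> 'a list \<Rightarrow> bool" where
  "sgn_eq xs ys \<longleftrightarrow> w xs = w ys \<and> d xs = d ys \<or> w xs = \<ominus> w ys \<and> d xs = \<ominus> d ys"

lemma sgn_eq_Cons: "\<lbrakk>set ys \<subseteq> S; s \<in> S; sgn_eq xs ys\<rbrakk> \<Longrightarrow> sgn_eq (s # xs) (s # ys)"
  unfolding sgn_eq_def by (auto simp: a_minus_def r_minus minus_add)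

lemma sgn_eq_trans: "\<lbrakk>set zs \<subseteq> S; sgn_eq xs ys; sgn_eq ys zs\<rbrakk> \<Longrightarrow> sgn_eq xs zs"
  unfolding sgn_eq_def by (auto simp: minus_minus)

text \<open>The derivative of e_s e_t x is e_t x - e_s x + e_s e_t \<partial>(x), visibly
  antisymmetric in s and t.\<close>

lemma sgn_eq_swap:
  assumes "s \<in> S" "t \<in> S" "set ss \<subseteq> S"
  shows "sgn_eq (s # t # ss) (t # s # ss)"
proof -
  have st: "r s \<otimes> (r t \<otimes> x) = \<ominus> (r t \<otimes> (r s \<otimes> x))" if "x \<in> carrier A" for x
    by (rule anti_lcomm) (use assms that r_anti[of s t] in auto)
  show ?thesis unfolding sgn_eq_def using assms
    by (intro disjI2 conjI)
      (simp_all add: st a_minus_def r_distr r_minus minus_add minus_minus a_ac)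
qed

lemma sgn_eq_move:
  "\<lbrakk>set xs \<subseteq> S; set ys \<subseteq> S; s \<in> S\<rbrakk> \<Longrightarrow> sgn_eq (s # xs @ ys) (xs @ s # ys)"
proof (induction xs)
  case Nil
  then show ?case by (simp add: sgn_eq_def)
next
  case (Cons x xs)
  then have "sgn_eq (x # s # xs @ ys) (x # xs @ s # ys)" by (intro sgn_eq_Cons) auto
  moreover have "sgn_eq (s # x # xs @ ys) (x # s # xs @ ys)"
    using Cons.prems by (intro sgn_eq_swap) auto
  ultimately show ?case using Cons.prems sgn_eq_trans[of "x # xs @ s # ys"] by simp
qed

lemma sgn_eq_permute:
  "\<lbrakk>distinct xs; distinct ys; set xs = set ys; set ys \<subseteq> S\<rbrakk> \<Longrightarrow> sgn_eq xs ys"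
proof (induction xs arbitrary: ys)
  case Nil
  then show ?case by (simp add: sgn_eq_def)
next
  case (Cons x xs)
  then have "x \<in> set ys" by auto
  then obtain as bs where ys: "ys = as @ x # bs" by (meson split_list)
  then have "set xs = set (as @ bs)" using Cons.prems by (auto simp: insert_ident)
  then have "sgn_eq xs (as @ bs)" using Cons ys by auto
  then have "sgn_eq (x # xs) (x # as @ bs)" using Cons.prems ys by (intro sgn_eq_Cons) auto
  moreover have "sgn_eq (x # as @ bs) ys" using Cons.prems ys sgn_eq_move[of as bs x] by auto
  ultimately show ?case using Cons.prems sgn_eq_trans by blast
qed

text \<open>The key computation: modulo \<open>\<partial>(e\<^sub>i e\<^sub>X)\<close> and \<open>\<partial>(e\<^sub>i e\<^sub>Y)\<close> one has
  \<open>e\<^sub>X = e\<^sub>i \<partial>(e\<^sub>X)\<close> and \<open>e\<^sub>Y = e\<^sub>i \<partial>(e\<^sub>Y)\<close>, so that the two terms of \<open>\<partial>(e\<^sub>X e\<^sub>Y)\<close> cancel.\<close>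

lemma glue_append:
  assumes "i \<in> S" and xs: "set xs \<subseteq> S" and ys: "set ys \<subseteq> S"
    and "d (i # xs) = \<zero>" "d (i # ys) = \<zero>"
  shows "d (xs @ ys) = \<zero>"
proof -
  have X: "w xs = r i \<otimes> d xs" and Y: "w ys = r i \<otimes> d ys" using assms by auto
  have "r i \<otimes> d xs = \<ominus> ((- 1) ^ length xs \<odot> (d xs \<otimes> r i))"
    by (rule anti_deriv[OF r_closed[OF assms(1)] r_anti[OF assms(1)] xs])
  \<comment> \<open>Carrying \<open>r i\<close> to the right of \<open>d xs\<close> produces the
    same power of -1 again and one further minus. The powers cancel,
    \<open>r i \<otimes> d ys\<close> is \<open>w ys\<close>, and the result is the negative of the
    first term in \<open>d_append\<close>.\<close>
  then have "(- 1) ^ length xs \<odot> (w xs \<otimes> d ys) =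
      \<ominus> (((- 1) ^ length xs * (- 1) ^ length xs) \<odot> (d xs \<otimes> (r i \<otimes> d ys)))"
    using assms(1-3) by (simp add: X m_assoc l_minus)
  then show ?thesis
    using assms(1-3) by (simp add: d_append Y r_neg flip: power_mult_distrib)
qed

text \<open>An arbitrary ordering of \<open>X \<union> Y\<close> is brought into the form
  \<open>xs @ ys\<close> by filtering, at the cost of a sign that does not affect vanishing.
  Prefixing \<open>i\<close> to \<open>xs\<close> or \<open>ys\<close> gives an ordering to which
  the hypotheses apply.\<close>

lemma glue:
  assumes i: "i \<in> S" and XY: "X \<subseteq> S" "Y \<subseteq> S" "X \<inter> Y = {}" "i \<notin> X" "i \<notin> Y"
    and X: "\<And>xs. distinct xs \<Longrightarrow> set xs = insert i X \<Longrightarrow> d xs = \<zero>"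
    and Y: "\<And>ys. distinct ys \<Longrightarrow> set ys = insert i Y \<Longrightarrow> d ys = \<zero>"
    and ss: "distinct ss" "set ss = X \<union> Y"
  shows "d ss = \<zero>"
proof -
  define xs where "xs = filter (\<lambda>s. s \<in> X) ss"
  define ys where "ys = filter (\<lambda>s. s \<notin> X) ss"
  have xs: "distinct xs" "set xs = X" and ys: "distinct ys" "set ys = Y"
    using ss XY by (auto simp: xs_def ys_def)
  have "d (xs @ ys) = \<zero>"
    by (rule glue_append[OF i]) (use xs ys XY X[of "i # xs"] Y[of "i # ys"] in auto)
  moreover have "sgn_eq ss (xs @ ys)"
    by (rule sgn_eq_permute) (use ss XY xs ys in auto)
  ultimately show ?thesis by (auto simp: sgn_eq_def)
qed

end

section \<open>A triangular extension\<close>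

text \<open>The algebra of matrices \<open>((\<alpha> a, b), (0, a))\<close>. The second component of a homomorphism
  into it is a derivation twisted by \<open>\<alpha>\<close>.\<close>

definition tri :: "('k, 'x) graded_algebra \<Rightarrow> ('x \<Rightarrow> 'x) \<Rightarrow> ('k, 'x \<times> 'x) graded_algebra" where
  "tri A \<alpha> =
     \<lparr>carrier = carrier A \<times> carrier A,
      mult = (\<lambda>(a, b) (a', b'). (a \<otimes>\<^bsub>A\<^esub> a', (\<alpha> a \<otimes>\<^bsub>A\<^esub> b') \<oplus>\<^bsub>A\<^esub> (b \<otimes>\<^bsub>A\<^esub> a'))),
      one = (\<one>\<^bsub>A\<^esub>, \<zero>\<^bsub>A\<^esub>),
      zero = (\<zero>\<^bsub>A\<^esub>, \<zero>\<^bsub>A\<^esub>),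
      add = (\<lambda>(a, b) (a', b'). (a \<oplus>\<^bsub>A\<^esub> a', b \<oplus>\<^bsub>A\<^esub> b')),
      smult = (\<lambda>c (a, b). (c \<odot>\<^bsub>A\<^esub> a, c \<odot>\<^bsub>A\<^esub> b)),
      homog = (\<lambda>p. {})\<rparr>"

lemma tri_simps [simp]:
  "carrier (tri A \<alpha>) = carrier A \<times> carrier A"
  "(a, b) \<otimes>\<^bsub>tri A \<alpha>\<^esub> (a', b') = (a \<otimes>\<^bsub>A\<^esub> a', (\<alpha> a \<otimes>\<^bsub>A\<^esub> b') \<oplus>\<^bsub>A\<^esub> (b \<otimes>\<^bsub>A\<^esub> a'))"
  "\<one>\<^bsub>tri A \<alpha>\<^esub> = (\<one>\<^bsub>A\<^esub>, \<zero>\<^bsub>A\<^esub>)"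
  "\<zero>\<^bsub>tri A \<alpha>\<^esub> = (\<zero>\<^bsub>A\<^esub>, \<zero>\<^bsub>A\<^esub>)"
  "(a, b) \<oplus>\<^bsub>tri A \<alpha>\<^esub> (a', b') = (a \<oplus>\<^bsub>A\<^esub> a', b \<oplus>\<^bsub>A\<^esub> b')"
  "c \<odot>\<^bsub>tri A \<alpha>\<^esub> (a, b) = (c \<odot>\<^bsub>A\<^esub> a, c \<odot>\<^bsub>A\<^esub> b)"
  by (simp_all add: tri_def)

lemma tri_components [simp]:
  "fst (x \<otimes>\<^bsub>tri A \<alpha>\<^esub> y) = fst x \<otimes>\<^bsub>A\<^esub> fst y"
  "snd (x \<otimes>\<^bsub>tri A \<alpha>\<^esub> y) = (\<alpha> (fst x) \<otimes>\<^bsub>A\<^esub> snd y) \<oplus>\<^bsub>A\<^esub> (snd x \<otimes>\<^bsub>A\<^esub> fst y)"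
  "fst (x \<oplus>\<^bsub>tri A \<alpha>\<^esub> y) = fst x \<oplus>\<^bsub>A\<^esub> fst y"
  "snd (x \<oplus>\<^bsub>tri A \<alpha>\<^esub> y) = snd x \<oplus>\<^bsub>A\<^esub> snd y"
  "fst (c \<odot>\<^bsub>tri A \<alpha>\<^esub> x) = c \<odot>\<^bsub>A\<^esub> fst x"
  "snd (c \<odot>\<^bsub>tri A \<alpha>\<^esub> x) = c \<odot>\<^bsub>A\<^esub> snd x"
  by (cases x; cases y; simp)+

lemma tri_hom_components:
  assumes "kalg_hom A (tri R \<alpha>) h" "kalg R"
  shows "kalg_hom A R (\<lambda>x. fst (h x))" and "(\<lambda>x. snd (h x)) \<in> linear_maps A R"
    and "\<lbrakk>x \<in> carrier A; y \<in> carrier A\<rbrakk> \<Longrightarrow> snd (h (x \<otimes>\<^bsub>A\<^esub> y)) =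
      (\<alpha> (fst (h x)) \<otimes>\<^bsub>R\<^esub> snd (h y)) \<oplus>\<^bsub>R\<^esub> (snd (h x) \<otimes>\<^bsub>R\<^esub> fst (h y))"
proof -
  interpret h: kalg_hom A "tri R \<alpha>" h by fact
  have c: "fst (h x) \<in> carrier R" "snd (h x) \<in> carrier R" if "x \<in> carrier A" for x
    using h.closed[OF that] by (cases "h x"; simp)+
  have "(\<lambda>x. fst (h x)) \<in> alg_hom A R" by (rule alg_homI) (simp_all add: c)
  then show "kalg_hom A R (\<lambda>x. fst (h x))"
    using assms(2) h.A.kalg_axioms by (simp add: kalg_hom_def kalg_hom_axioms_def)
  show "(\<lambda>x. snd (h x)) \<in> linear_maps A R" by (rule linear_mapsI) (simp_all add: c)
qed (simp add: kalg_hom.mult[OF assms(1)])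

lemma kalg_tri:
  assumes "kalg_hom A A \<alpha>"
  shows "kalg (tri A \<alpha>)"
proof -
  interpret \<alpha>: kalg_hom A A \<alpha> by fact
  have "ring (tri A \<alpha>)"
  proof (rule ringI)
    show "abelian_group (tri A \<alpha>)"
    proof (rule abelian_groupI)
      fix x assume "x \<in> carrier (tri A \<alpha>)"
      then show "\<exists>y\<in>carrier (tri A \<alpha>). y \<oplus>\<^bsub>tri A \<alpha>\<^esub> x = \<zero>\<^bsub>tri A \<alpha>\<^esub>"
        by (intro bexI[of _ "(\<ominus>\<^bsub>A\<^esub> fst x, \<ominus>\<^bsub>A\<^esub> snd x)"]) (auto simp: \<alpha>.A.l_neg)
    qed (auto simp: \<alpha>.A.a_ac)
    show "monoid (tri A \<alpha>)"
      by (rule monoidI) (auto simp: \<alpha>.A.m_assoc \<alpha>.A.l_distr \<alpha>.A.r_distr \<alpha>.A.a_assoc)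
  qed (auto simp: \<alpha>.A.l_distr \<alpha>.A.r_distr \<alpha>.A.a_ac)
  then show ?thesis
    unfolding kalg_def kalg_axioms_def
    by (auto simp: \<alpha>.A.smult_r_distr \<alpha>.A.smult_l_distr)
qed

text \<open>With \<open>\<alpha>\<close> acting as (-1)^p on words of length p, the twisted product
  rule of \<open>tri A \<alpha>\<close> turns into the signed Leibniz rule.\<close>

locale odd_family = anticommuting A S r + \<alpha>: kalg_hom A A \<alpha>
  for A :: "('k::field, 'x) graded_algebra" (structure) and S :: "'a set" and r \<alpha> +
  assumes \<alpha>_odd: "s \<in> S \<Longrightarrow> \<alpha> (r s) = \<ominus> r s"
begin

lemma uminus_tri: "\<lbrakk>a \<in> carrier A; b \<in> carrier A\<rbrakk> \<Longrightarrow> \<ominus>\<^bsub>tri A \<alpha>\<^esub> (a, b) = (\<ominus> a, \<ominus> b)"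
  using kalg.smult_uminus_one[OF kalg_tri[OF \<alpha>.kalg_hom_axioms], of "(a, b)"] by simp

text \<open>A homomorphism taking generators to these pairs has as second component a derivation
  with value \<open>c s\<close> on the generator s. Constant weight 1 produces \<partial>; weights 0
  and -1 on the two copies produce \<tau>.\<close>

abbreviation weighted where "weighted c s \<equiv> (r s, c s \<odot> \<one>)"

text \<open>The off-diagonal entry of the product for s and t is \<open>c s\<close> times
  \<open>r t\<close> minus \<open>c t\<close> times \<open>r s\<close>: antisymmetric in s and t,
  and zero for s = t, whatever the weights.\<close>

lemma weighted_anticommuting: "anticommuting (tri A \<alpha>) S (weighted c)"
proof -
  interpret T: kalg "tri A \<alpha>" by (rule kalg_tri[OF \<alpha>.kalg_hom_axioms])
  show ?thesis
  proof
    fix s t assume "s \<in> S" "t \<in> S"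
    then show "weighted c s \<otimes>\<^bsub>tri A \<alpha>\<^esub> weighted c t = \<ominus>\<^bsub>tri A \<alpha>\<^esub> (weighted c t \<otimes>\<^bsub>tri A \<alpha>\<^esub> weighted c s)"
      using r_anti[of s t] by (simp add: \<alpha>_odd uminus_tri l_minus minus_add minus_minus a_ac)
  qed (auto simp: r_sq \<alpha>_odd l_minus l_neg)
qed

lemma weighted_word:
  "\<lbrakk>set ss \<subseteq> S; \<And>s. s \<in> set ss \<Longrightarrow> c s = c0\<rbrakk> \<Longrightarrow>
    word (tri A \<alpha>) (weighted c) ss = (w ss, c0 \<odot> d ss)"
proof (induction ss)
  case (Cons s ss)
  then show ?case
    by (simp add: \<alpha>_odd a_minus_def l_minus smult_r_distr a_comm)
qed simp

text \<open>The vanishing second component expresses \<partial>\<partial> = 0: the term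
  \<open>c0 \<odot> d ss\<close> coming from the word cancels against the one coming from the weight
  of s. Hence a circuit relation valid in \<open>A\<close> remains valid in the triangular algebra
  when the weight is constant on the circuit.\<close>

lemma weighted_deriv:
  "\<lbrakk>set ss \<subseteq> S; \<And>s. s \<in> set ss \<Longrightarrow> c s = c0\<rbrakk> \<Longrightarrow>
    word_deriv (tri A \<alpha>) (weighted c) ss = (d ss, \<zero>)"
proof (induction ss)
  case (Cons s ss)
  then have "word (tri A \<alpha>) (weighted c) ss = (w ss, c0 \<odot> d ss)" by (intro weighted_word) auto
  with Cons show ?case by (simp add: a_minus_def uminus_tri r_neg)
qed simp

end

section \<open>Algebras generated in degree one\<close>

text \<open>Words are asked to span, not to be independent. Spanning, both of the whole algebra and
  of each degree, survives passage to any quotient and suffices for testing maps and degrees word by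
  word.\<close>

locale generated = galg A for A :: "('k::field, 'x) graded_algebra" (structure) +
  fixes S :: "'a set" and e :: "'a \<Rightarrow> 'x"
  assumes e_homog: "s \<in> S \<Longrightarrow> e s \<in> homog A 1"
    and carrier_words: "carrier A = lspan A (word A e ` lists S)"
    and homog_words: "homog A p = lspan A (word A e ` {ss \<in> lists S. length ss = p})"
begin

lemma e_closed [simp]: "s \<in> S \<Longrightarrow> e s \<in> carrier A"
  using e_homog homog_carrier by blast

lemma words_closed: "word A e ` lists S \<subseteq> carrier A"
  by (auto intro!: word_closed)

lemma linear_eq:
  assumes "kalg R" "f \<in> linear_maps A R" "g \<in> linear_maps A R"
    and "\<And>ss. set ss \<subseteq> S \<Longrightarrow> f (word A e ss) = g (word A e ss)" "x \<in> carrier A"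
  shows "f x = g x"
  by (rule lspan_linear_eq[OF kalg_axioms assms(1-3) words_closed])
    (use assms(4,5) carrier_words in auto)

lemma hom_eq:
  assumes "kalg_hom A R f" "kalg_hom A R g" "\<And>s. s \<in> S \<Longrightarrow> f (e s) = g (e s)" "x \<in> carrier A"
  shows "f x = g x"
proof -
  interpret f: kalg_hom A R f by fact
  interpret g: kalg_hom A R g by fact
  show ?thesis
  proof (rule linear_eq[OF f.B.kalg_axioms f.linear g.linear _ assms(4)])
    fix ss assume ss: "set ss \<subseteq> S"
    have "word R (\<lambda>s. f (e s)) ss = word R (\<lambda>s. g (e s)) ss"
      using ss assms(3) by (intro word_cong) auto
    then show "f (word A e ss) = g (word A e ss)"
      using ss f.hom_word[of ss e] g.hom_word[of ss e] by (simp add: subset_iff)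
  qed
qed

lemma linear_homog:
  assumes R: "galg R" and f: "f \<in> linear_maps A R"
    and "\<And>ss. \<lbrakk>set ss \<subseteq> S; length ss = p\<rbrakk> \<Longrightarrow> f (word A e ss) \<in> homog R q"
    and x: "x \<in> homog A p"
  shows "f x \<in> homog R q"
proof -
  interpret R: galg R by fact
  let ?W = "word A e ` {ss \<in> lists S. length ss = p}"
  have "?W \<subseteq> carrier A" using words_closed by blast
  then have "f x \<in> lspan R (f ` ?W)"
    using lspan_linear_image[OF kalg_axioms R.kalg_axioms f] x homog_words by blast
  then show ?thesis by (rule R.lspan_homog) (use assms(3) in auto)
qed

lemma hom_homog:
  assumes "galg R" "kalg_hom A R h" "\<And>s. s \<in> S \<Longrightarrow> h (e s) \<in> homog R 1" "x \<in> homog A p"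
  shows "h x \<in> homog R p"
proof -
  interpret R: galg R by fact
  interpret h: kalg_hom A R h by fact
  show ?thesis
  proof (rule linear_homog[OF assms(1) h.linear _ assms(4)])
    fix ss assume ss: "set ss \<subseteq> S" "length ss = p"
    then have "h (word A e ss) = word R (\<lambda>s. h (e s)) ss" by (intro h.hom_word) auto
    then show "h (word A e ss) \<in> homog R p"
      using R.word_homog[of ss "\<lambda>s. h (e s)"] ss assms(3) by auto
  qed
qed

lemma words_induct [consumes 1, case_names word zero add smult]:
  assumes "x \<in> carrier A"
    and "\<And>ss. set ss \<subseteq> S \<Longrightarrow> P (word A e ss)" "P \<zero>"
    and "\<And>x y. \<lbrakk>x \<in> carrier A; y \<in> carrier A; P x; P y\<rbrakk> \<Longrightarrow> P (x \<oplus> y)"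
    and "\<And>c x. \<lbrakk>x \<in> carrier A; P x\<rbrakk> \<Longrightarrow> P (c \<odot> x)"
  shows "P x"
proof -
  have "x \<in> lspan A (word A e ` lists S)" using assms(1) carrier_words by simp
  then show ?thesis
  proof induction
    case (base x)
    then show ?case using assms(2) by auto
  next
    case (add x y)
    then show ?case using assms(4) lspan_carrier[OF words_closed] by blast
  next
    case (smult x c)
    then show ?case using assms(5) lspan_carrier[OF words_closed] by blast
  qed (rule assms(3))
qed

lemma homog_induct [consumes 1, case_names word zero add smult]:
  assumes "x \<in> homog A p"
    and "\<And>ss. \<lbrakk>set ss \<subseteq> S; length ss = p\<rbrakk> \<Longrightarrow> P (word A e ss)" "P \<zero>"
    and "\<And>x y. \<lbrakk>x \<in> homog A p; y \<in> homog A p; P x; P y\<rbrakk> \<Longrightarrow> P (x \<oplus> y)"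
    and "\<And>c x. \<lbrakk>x \<in> homog A p; P x\<rbrakk> \<Longrightarrow> P (c \<odot> x)"
  shows "P x"
proof -
  have "x \<in> lspan A (word A e ` {ss \<in> lists S. length ss = p})" using assms(1) homog_words by simp
  then show ?thesis
  proof induction
    case (base x)
    then show ?case using assms(2) by auto
  next
    case (add x y)
    then show ?case using assms(4) homog_words by blast
  next
    case (smult x c)
    then show ?case using assms(5) homog_words by blast
  qed (rule assms(3))
qed

lemma generated_quot:
  assumes "ideal I A"
  shows "generated (quot_algebra A I) S (\<lambda>s. I +> e s)"
proof -
  interpret kalg_ideal A I using assms by (simp add: kalg_axioms kalg_ideal.intro)
  interpret proj: kalg_hom A Q proj by (rule kalg_hom_proj)
  interpret Q: galg Q by (rule galg_quot[OF assms])
  have W: "proj ` word A e ` L = word Q (\<lambda>s. I +> e s) ` L" if "L \<subseteq> lists S" for L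
    unfolding image_image by (rule image_cong[OF refl]) (use that in \<open>auto intro!: proj.hom_word\<close>)
  have im: "proj ` lspan A (word A e ` L) = lspan Q (word Q (\<lambda>s. I +> e s) ` L)"
    if "L \<subseteq> lists S" for L
  proof -
    have "word A e ` L \<subseteq> carrier A" using words_closed that by blast
    then show ?thesis
      using lspan_linear_image[OF kalg_axioms proj.B.kalg_axioms proj.linear] by (simp add: W that)
  qed
  show ?thesis
  proof
    fix s assume "s \<in> S"
    then show "I +> e s \<in> homog Q 1" using e_homog by (auto simp: quot_simps)
  next
    show "carrier Q = lspan Q (word Q (\<lambda>s. I +> e s) ` lists S)"
      using im[of "lists S"] carrier_words by (simp add: quot_simps)
  next
    fix p
    show "homog Q p = lspan Q (word Q (\<lambda>s. I +> e s) ` {ss \<in> lists S. length ss = p})"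
      using im[of "{ss \<in> lists S. length ss = p}"] homog_words by (auto simp: quot_simps)
  qed
qed

end

section \<open>Tensor and exterior algebras\<close>

lemma based_lists: "based (lists S) (@) (\<lambda>_ _. 1 :: 'k::field) [] length"
  by unfold_locales auto

lemma word_basis_vec:
  assumes "set ss \<subseteq> S"
  shows "word (tensor_algebra (k :: 'k::field itself) S) (\<lambda>s. basis_vec [s]) ss = basis_vec ss"
proof -
  interpret T: based "lists S" "(@)" "\<lambda>_ _. 1 :: 'k" "[]" length by (rule based_lists)
  interpret kalg T.X by (rule T.kalg)
  show ?thesis
    using assms unfolding tensor_algebra_def
  proof (induction ss)
    case (Cons s ss)
    then show ?case
      using T.basis_vec_mult[of "[s]" ss] smult_one[OF T.basis_vec_carrier[of "s # ss"]]
      by (simp add: in_lists_conv_set subset_iff)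
  qed (simp add: T.X_simps)
qed

lemma generated_tensor:
  "generated (tensor_algebra (k :: 'k::field itself) S) S (\<lambda>s. basis_vec [s])"
proof -
  interpret T: based "lists S" "(@)" "\<lambda>_ _. 1 :: 'k" "[]" length by (rule based_lists)
  interpret galg T.X by (rule T.galg)
  have W: "word T.X (\<lambda>s. basis_vec [s]) ` L = basis_vec ` L" if "L \<subseteq> lists S" for L
    using word_basis_vec[of _ S k] that by (intro image_cong) (auto simp: tensor_algebra_def)
  show ?thesis unfolding tensor_algebra_def
  proof
    fix s assume "s \<in> S"
    then show "basis_vec [s] \<in> homog T.X 1" by (intro T.basis_vec_homog) auto
  next
    show "carrier T.X = lspan T.X (word T.X (\<lambda>s. basis_vec [s]) ` lists S)"
      by (simp add: W T.carrier_span)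
  next
    fix p
    show "homog T.X p = lspan T.X (word T.X (\<lambda>s. basis_vec [s]) ` {ss \<in> lists S. length ss = p})"
      by (subst W) (auto simp: T.homog_span)
  qed
qed

lemma tensor_lift:
  assumes "kalg R" "\<And>s. s \<in> S \<Longrightarrow> r s \<in> carrier R"
  shows "\<exists>h. kalg_hom (tensor_algebra (k :: 'k::field itself) S) R h \<and>
    (\<forall>s\<in>S. h (basis_vec [s]) = r s)"
proof -
  interpret T: based "lists S" "(@)" "\<lambda>_ _. 1 :: 'k" "[]" length by (rule based_lists)
  interpret R: kalg R by fact
  have app: "word R r (xs @ ys) = word R r xs \<otimes>\<^bsub>R\<^esub> word R r ys"
    if "set xs \<subseteq> S" "set ys \<subseteq> S" for xs ys
    using that
  proof (induction xs)
    case (Cons x xs)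
    then show ?case using assms(2)
      by (simp add: R.m_assoc R.word_closed subset_iff)
  qed (use assms(2) in \<open>auto simp: R.word_closed subset_iff\<close>)
  have "\<exists>h. kalg_hom T.X R h \<and> (\<forall>ss\<in>lists S. h (basis_vec ss) = word R r ss)"
  proof (rule T.extend_hom[OF assms(1)])
    fix ss assume "ss \<in> lists S"
    then show "word R r ss \<in> carrier R" using assms(2) by (intro R.word_closed) auto
    fix ts assume "ts \<in> lists S"
    then show "word R r ss \<otimes>\<^bsub>R\<^esub> word R r ts = 1 \<odot>\<^bsub>R\<^esub> word R r (ss @ ts)"
      using \<open>ss \<in> lists S\<close> assms(2) app[of ss ts]
      by (subst R.smult_one) (auto simp: in_lists_conv_set subset_iff intro!: R.word_closed)
  qed simp
  then obtain h where h: "kalg_hom T.X R h" "\<forall>ss\<in>lists S. h (basis_vec ss) = word R r ss" by blast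
  have "\<forall>s\<in>S. h (basis_vec [s]) = r s" using h(2) assms(2) by simp
  then show ?thesis using h(1) unfolding tensor_algebra_def by blast
qed

lemma ext_relations_closed:
  "{v \<otimes>\<^bsub>tensor_algebra k S\<^esub> v | v. v \<in> homog (tensor_algebra k S) 1}
    \<subseteq> carrier (tensor_algebra k S)"
proof -
  interpret generated "tensor_algebra k S" S "\<lambda>s. basis_vec [s]" by (rule generated_tensor)
  show ?thesis using homog_carrier by auto
qed

lemma ext_ideal: "ideal (exterior_ideal k S) (tensor_algebra k S)"
proof -
  interpret generated "tensor_algebra k S" S "\<lambda>s. basis_vec [s]" by (rule generated_tensor)
  show ?thesis unfolding exterior_ideal_def using ext_relations_closed by (rule genideal_ideal)
qed

lemma generated_ext: "generated (exterior_algebra k S) S (ext_gen k S)"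
proof -
  interpret generated "tensor_algebra k S" S "\<lambda>s. basis_vec [s]" by (rule generated_tensor)
  show ?thesis
    using generated_quot[OF ext_ideal] unfolding exterior_algebra_def ext_gen_def .
qed

lemma ext_homog_one_sq:
  assumes "v \<in> homog (exterior_algebra k S) 1"
  shows "v \<otimes>\<^bsub>exterior_algebra k S\<^esub> v = \<zero>\<^bsub>exterior_algebra k S\<^esub>"
proof -
  let ?T = "tensor_algebra k S"
  interpret generated ?T S "\<lambda>s. basis_vec [s]" by (rule generated_tensor)
  interpret I: kalg_ideal ?T "exterior_ideal k S"
    using ext_ideal[of k S] by (simp add: kalg_axioms kalg_ideal.intro)
  obtain x where x: "x \<in> homog ?T 1" "v = I.proj x"
    using assms by (auto simp: exterior_algebra_def I.quot_simps)
  have "x \<otimes>\<^bsub>?T\<^esub> x \<in> exterior_ideal k S"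
    unfolding exterior_ideal_def using genideal_self[OF ext_relations_closed] x by blast
  then have "I.proj (x \<otimes>\<^bsub>?T\<^esub> x) = \<zero>\<^bsub>I.Q\<^esub>"
    using homog_carrier x by (subst I.proj_zero_iff) auto
  then show ?thesis
    using x homog_carrier by (simp add: exterior_algebra_def I.quot_simps(3))
qed

text \<open>Polarization: expand the square of e_s + e_t, a vector of degree 1.\<close>

lemma anticommuting_ext: "anticommuting (exterior_algebra k S) S (ext_gen k S)"
proof -
  interpret generated "exterior_algebra k S" S "ext_gen k S" by (rule generated_ext)
  show ?thesis
  proof
    fix s t assume st: "s \<in> S" "t \<in> S"
    let ?s = "ext_gen k S s" and ?t = "ext_gen k S t" and ?A = "exterior_algebra k S"
    have sq: "?s \<otimes>\<^bsub>?A\<^esub> ?s = \<zero>\<^bsub>?A\<^esub>" "?t \<otimes>\<^bsub>?A\<^esub> ?t = \<zero>\<^bsub>?A\<^esub>"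
      "(?s \<oplus>\<^bsub>?A\<^esub> ?t) \<otimes>\<^bsub>?A\<^esub> (?s \<oplus>\<^bsub>?A\<^esub> ?t) = \<zero>\<^bsub>?A\<^esub>"
      using st e_homog by (intro ext_homog_one_sq homog_add e_homog; simp)+
    then have "?s \<otimes>\<^bsub>?A\<^esub> ?t \<oplus>\<^bsub>?A\<^esub> ?t \<otimes>\<^bsub>?A\<^esub> ?s = \<zero>\<^bsub>?A\<^esub>"
      using st by (simp add: l_distr r_distr a_comm)
    then show "?s \<otimes>\<^bsub>?A\<^esub> ?t = \<ominus>\<^bsub>?A\<^esub> (?t \<otimes>\<^bsub>?A\<^esub> ?s)"
      using st by (intro minus_equality[symmetric]) auto
  qed (simp, rule ext_homog_one_sq, rule e_homog)
qed

text \<open>The exterior ideal is generated by squares of all vectors of degree 1, whereas the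
  hypothesis concerns the elements \<open>r s\<close> only. The lift to the tensor algebra is
  therefore shown to kill all these squares, by induction over the span of the generators.\<close>

lemma ext_lift:
  assumes "anticommuting R S r"
  shows "\<exists>h. kalg_hom (exterior_algebra (k :: 'k::field itself) S) R h \<and>
    (\<forall>s\<in>S. h (ext_gen k S s) = r s)"
proof -
  let ?T = "tensor_algebra k S"
  interpret generated ?T S "\<lambda>s. basis_vec [s]" by (rule generated_tensor)
  interpret I: kalg_ideal ?T "exterior_ideal k S"
    using ext_ideal[of k S] by (simp add: kalg_axioms kalg_ideal.intro)
  interpret R: anticommuting R S r by fact
  obtain h where h: "kalg_hom ?T R h" "\<forall>s\<in>S. h (basis_vec [s]) = r s"
    using tensor_lift[OF R.kalg_axioms, of S r k] by auto
  interpret h: kalg_hom ?T R h by fact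
  \<comment> \<open>Anticommutation with every \<open>r s\<close> strengthens the induction: for a
    sum x + y the mixed terms must cancel, and the inner induction on y obtains this from what is
    known of x against the generators.\<close>
  have sq: "h v \<otimes>\<^bsub>R\<^esub> h v = \<zero>\<^bsub>R\<^esub> \<and> (\<forall>s\<in>S. h v \<otimes>\<^bsub>R\<^esub> r s = \<ominus>\<^bsub>R\<^esub> (r s \<otimes>\<^bsub>R\<^esub> h v))"
    if "v \<in> homog ?T 1" for v
    using that
  proof (induction rule: homog_induct)
    case (word ss)
    then obtain s where "ss = [s]" "s \<in> S" by (cases ss) auto
    moreover have "h (basis_vec [s]) \<otimes>\<^bsub>R\<^esub> r t = \<ominus>\<^bsub>R\<^esub> (r t \<otimes>\<^bsub>R\<^esub> h (basis_vec [s]))" if "t \<in> S" for t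
      using h(2) \<open>s \<in> S\<close> R.r_anti[OF \<open>s \<in> S\<close> that] by simp
    ultimately show ?case using h(2) R.r_sq by simp
  next
    case zero
    then show ?case by simp
  next
    case (add x y)
    then have c: "h x \<in> carrier R" "h y \<in> carrier R" and xc: "x \<in> carrier ?T" "y \<in> carrier ?T"
      using homog_carrier by auto
    have "h x \<otimes>\<^bsub>R\<^esub> h y = \<ominus>\<^bsub>R\<^esub> (h y \<otimes>\<^bsub>R\<^esub> h x)"
      using \<open>y \<in> homog ?T 1\<close>
    proof (induction rule: homog_induct)
      case (word ss)
      then obtain s where "ss = [s]" "s \<in> S" by (cases ss) auto
      then show ?case using h(2) add.IH by simp
    next
      case zero
      then show ?case using c by simp
    next
      case (add u v)
      then have "u \<in> carrier ?T" "v \<in> carrier ?T" using homog_carrier by auto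
      then show ?case using add c by (simp add: R.l_distr R.r_distr R.minus_add)
    next
      case (smult c' u)
      then have "u \<in> carrier ?T" using homog_carrier by auto
      then show ?case using smult c by simp
    qed
    then show ?case using add.IH c xc
      by (auto simp: R.l_distr R.r_distr R.minus_add R.l_neg R.r_neg)
  next
    case (smult c v)
    then show ?case using homog_carrier by auto
  qed
  have "h x = \<zero>\<^bsub>R\<^esub>" if "x \<in> exterior_ideal k S" for x
    by (rule h.kernel_genideal[OF ext_relations_closed _ that[unfolded exterior_ideal_def]])
      (use sq homog_carrier in auto)
  then obtain g where "kalg_hom I.Q R g" "\<forall>x\<in>carrier ?T. g (I.proj x) = h x"
    using I.factor[OF h(1)] by blast
  then show ?thesis using h(2) unfolding exterior_algebra_def ext_gen_def
    by (intro exI[of _ g]) auto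
qed

section \<open>Existence and uniqueness of the derivation of the exterior algebra\<close>

lemma (in anticommuting) anticommuting_uminus: "anticommuting A S (\<lambda>s. \<ominus> r s)"
  by unfold_locales (auto simp: l_minus r_minus minus_minus r_sq intro: r_anti)

lemma involution_homog:
  assumes "generated A S e" "kalg_hom A A \<alpha>" "\<And>s. s \<in> S \<Longrightarrow> \<alpha> (e s) = \<ominus>\<^bsub>A\<^esub> e s" "x \<in> homog A p"
  shows "\<alpha> x = (- 1) ^ p \<odot>\<^bsub>A\<^esub> x"
proof -
  interpret generated A S e by fact
  interpret \<alpha>: kalg_hom A A \<alpha> by fact
  show ?thesis using assms(4)
  proof (induction rule: homog_induct)
    case (word ss)
    have "\<alpha> (word A e ss) = (- 1) ^ length ss \<odot>\<^bsub>A\<^esub> word A e ss"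
      using \<open>set ss \<subseteq> S\<close>
    proof (induction ss)
      case (Cons s ss)
      then have "word A e ss \<in> carrier A" by (intro word_closed) auto
      with Cons show ?case by (simp add: assms(3) l_minus)
    qed simp
    then show ?case using word by simp
  next
    case (add x y)
    then show ?case using homog_carrier by (simp add: smult_r_distr)
  next
    case (smult c x)
    then show ?case using homog_carrier by (simp add: mult.commute)
  qed simp
qed

lemma graded_derivation_word:
  assumes A: "generated A S e" and D: "graded_derivation A D" and De: "\<And>s. s \<in> S \<Longrightarrow> D (e s) = \<one>\<^bsub>A\<^esub>"
    and ss: "set ss \<subseteq> S"
  shows "D (word A e ss) = word_deriv A e ss"
proof -
  interpret generated A S e by fact
  have lin: "D \<in> linear_maps A A"
    using D by (auto simp: graded_derivation_def graded_linear_maps_def linear_maps_def shift_def)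
  have leib: "D (x \<otimes>\<^bsub>A\<^esub> y) = (D x \<otimes>\<^bsub>A\<^esub> y) \<oplus>\<^bsub>A\<^esub> ((- 1) ^ p \<odot>\<^bsub>A\<^esub> (x \<otimes>\<^bsub>A\<^esub> D y))"
    if "x \<in> homog A p" "y \<in> carrier A" for x y p
    using D that by (auto simp: graded_derivation_def)
  have D1: "D \<one>\<^bsub>A\<^esub> \<in> carrier A" using linear_mapsD(1)[OF lin] by simp
  have "D \<one>\<^bsub>A\<^esub> = D \<one>\<^bsub>A\<^esub> \<oplus>\<^bsub>A\<^esub> D \<one>\<^bsub>A\<^esub>"
    using leib[of "\<one>\<^bsub>A\<^esub>" 0 "\<one>\<^bsub>A\<^esub>"] D1 by simp
  then have "D \<one>\<^bsub>A\<^esub> = \<zero>\<^bsub>A\<^esub>" using D1 by (metis add.l_cancel_one')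
  then show ?thesis using ss
  proof (induction ss)
    case (Cons s ss)
    then have c: "word A e ss \<in> carrier A" "word_deriv A e ss \<in> carrier A" "s \<in> S"
      by (auto intro!: word_closed word_deriv_closed)
    then show ?case using leib[of "e s" 1 "word A e ss"] e_homog Cons De
      by (simp add: a_minus_def)
  qed simp
qed

text \<open>\<open>ext_deriv\<close> is a definite description, so no value is available before
  existence and uniqueness. Existence comes from the triangular algebra with all weights 1;
  uniqueness from the fact that the Leibniz rule determines the value on every word.\<close>

lemma ext_deriv_word:
  fixes k :: "'k::field itself"
  assumes ss: "set ss \<subseteq> S"
  shows "ext_deriv k S (word (exterior_algebra k S) (ext_gen k S) ss) =
    word_deriv (exterior_algebra k S) (ext_gen k S) ss"
proof -
  let ?E = "exterior_algebra k S" and ?e = "ext_gen k S"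
  interpret generated ?E S ?e by (rule generated_ext)
  interpret anticommuting ?E S ?e by (rule anticommuting_ext)
  obtain \<alpha> where \<alpha>: "kalg_hom ?E ?E \<alpha>" "\<forall>s\<in>S. \<alpha> (?e s) = \<ominus>\<^bsub>?E\<^esub> ?e s"
    using ext_lift[OF anticommuting_uminus] by blast
  interpret odd_family ?E S ?e \<alpha>
    using \<alpha> by (intro odd_family.intro odd_family_axioms.intro anticommuting_axioms) auto
  let ?r = "\<lambda>s. (?e s, 1 \<odot>\<^bsub>?E\<^esub> \<one>\<^bsub>?E\<^esub>)"
  obtain h where h: "kalg_hom ?E (tri ?E \<alpha>) h" "\<forall>s\<in>S. h (?e s) = ?r s"
    using ext_lift[OF weighted_anticommuting[of "\<lambda>_. 1"]] by blast
  interpret h: kalg_hom ?E "tri ?E \<alpha>" h by (rule h(1))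
  have h_word: "h (word ?E ?e ss) = (word ?E ?e ss, word_deriv ?E ?e ss)" if "set ss \<subseteq> S" for ss
  proof -
    have "h (word ?E ?e ss) = word (tri ?E \<alpha>) (\<lambda>s. h (?e s)) ss"
      by (rule h.hom_word) (use that in auto)
    also have "\<dots> = word (tri ?E \<alpha>) ?r ss"
      by (rule word_cong) (use h(2) that in auto)
    also have "\<dots> = (word ?E ?e ss, 1 \<odot>\<^bsub>?E\<^esub> word_deriv ?E ?e ss)"
      by (rule weighted_word) (use that in auto)
    finally show ?thesis using that by simp
  qed
  have fst_lin: "(\<lambda>x. fst (h x)) \<in> linear_maps ?E ?E"
    using kalg_hom.linear[OF tri_hom_components(1)[OF h(1) kalg_axioms]] .
  have snd_lin: "(\<lambda>x. snd (h x)) \<in> linear_maps ?E ?E"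
    by (rule tri_hom_components(2)[OF h(1) kalg_axioms])
  have id_lin: "(\<lambda>x. x) \<in> linear_maps ?E ?E" by (rule linear_mapsI) auto
  \<comment> \<open>With first component the identity, the product rule of \<open>tri\<close>
    becomes a rule for the second component alone, twisted by \<open>\<alpha>\<close>, which is
    (-1)^p in degree p.\<close>
  have fst_h: "fst (h x) = x" if "x \<in> carrier ?E" for x
    by (rule linear_eq[OF kalg_axioms fst_lin id_lin _ that]) (simp add: h_word)
  define D where "D = restrict (\<lambda>x. snd (h x)) (carrier ?E)"
  have D_word: "D (word ?E ?e ss) = word_deriv ?E ?e ss" if "set ss \<subseteq> S" for ss
    using h_word that by (simp add: D_def)
  have D_lin: "D \<in> linear_maps ?E ?E"
    using snd_lin by (auto simp: D_def linear_maps_def)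
  have "graded_derivation ?E D"
    unfolding graded_derivation_def graded_linear_maps_def
  proof (intro conjI CollectI allI ballI subsetI)
    show "D \<in> linear_maps ?E (shift ?E)"
      using D_lin by (auto simp: linear_maps_def shift_def)
  next
    fix p y assume "y \<in> D ` homog ?E p"
    then obtain x where x: "x \<in> homog ?E p" "y = D x" by blast
    show "y \<in> homog (shift ?E) p"
    \<comment> \<open>Degree 0 of the shifted algebra is zero by definition, so \<open>D\<close> has
      to kill scalars; for p > 0 the subtraction in the degree is genuine.\<close>
    proof (cases "p = 0")
      case True
      have "D x = \<zero>\<^bsub>?E\<^esub>" using x(1) unfolding True
      proof (induction rule: homog_induct)
        case (word ss)
        then show ?case using D_word[of "[]"] by simp
      next
        case zero
        show ?case using linear_maps_zero[OF kalg_axioms kalg_axioms D_lin] .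
      next
        case (add x y)
        then show ?case using linear_mapsD(2)[OF D_lin] homog_carrier by simp
      next
        case (smult c x)
        then show ?case using linear_mapsD(3)[OF D_lin] homog_carrier by simp
      qed
      then show ?thesis using x True by (simp add: shift_def)
    next
      case False
      have "D x \<in> homog ?E (p - 1)"
      proof (rule linear_homog[OF galg_axioms D_lin _ x(1)])
        fix ss assume "set ss \<subseteq> S" "length ss = p"
        then show "D (word ?E ?e ss) \<in> homog ?E (p - 1)"
          using word_deriv_homog[of ss ?e] e_homog D_word by auto
      qed
      then show ?thesis using x False by (simp add: shift_def)
    qed
  next
    fix p x y assume x: "x \<in> homog ?E p" and y: "y \<in> carrier ?E"
    have xc: "x \<in> carrier ?E" using x homog_carrier by blast
    have "D (x \<otimes>\<^bsub>?E\<^esub> y) = (\<alpha> x \<otimes>\<^bsub>?E\<^esub> D y) \<oplus>\<^bsub>?E\<^esub> (D x \<otimes>\<^bsub>?E\<^esub> y)"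
      using tri_hom_components(3)[OF h(1) kalg_axioms xc y] xc y fst_h by (simp add: D_def)
    moreover have "\<alpha> x = (- 1) ^ p \<odot>\<^bsub>?E\<^esub> x"
      by (rule involution_homog[OF generated_axioms \<alpha>(1) _ x]) (use \<alpha>(2) in auto)
    moreover have "D x \<in> carrier ?E" "D y \<in> carrier ?E"
      using xc y linear_mapsD(1)[OF D_lin] by auto
    ultimately show "D (x \<otimes>\<^bsub>?E\<^esub> y) =
        (D x \<otimes>\<^bsub>?E\<^esub> y) \<oplus>\<^bsub>?E\<^esub> ((- 1) ^ p \<odot>\<^bsub>?E\<^esub> (x \<otimes>\<^bsub>?E\<^esub> D y))"
      using xc y by (simp add: a_comm)
  qed
  moreover have "D (?e s) = \<one>\<^bsub>?E\<^esub>" if "s \<in> S" for s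
    using that h(2) by (simp add: D_def)
  moreover have "D \<in> extensional (carrier ?E)" by (simp add: D_def)
  \<comment> \<open>Extensionality pins down the values outside the carrier; on the carrier both
    maps are linear and agree on words.\<close>
  moreover have "D' = D" if D': "D' \<in> extensional (carrier ?E)" "graded_derivation ?E D'"
      "\<forall>s\<in>S. D' (?e s) = \<one>\<^bsub>?E\<^esub>" for D'
  proof (rule extensionalityI[OF D'(1)])
    have lin: "D' \<in> linear_maps ?E ?E"
      using D'(2) by (auto simp: graded_derivation_def graded_linear_maps_def linear_maps_def shift_def)
    fix x assume "x \<in> carrier ?E"
    then show "D' x = D x"
    proof (rule linear_eq[OF kalg_axioms lin D_lin, rotated])
      fix ss assume ss: "set ss \<subseteq> S"
      then show "D' (word ?E ?e ss) = D (word ?E ?e ss)"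
        using graded_derivation_word[OF generated_axioms D'(2) _ ss] D'(3) D_word by simp
    qed
  qed (simp add: D_def)
  ultimately have "ext_deriv k S = D"
    unfolding ext_deriv_def by (intro the_equality) blast+
  then show ?thesis using D_word ss by simp
qed

section \<open>Orlik--Solomon algebras by generators and relations\<close>

lemma ext_monomial_word: "ext_monomial k S = word (exterior_algebra k S) (ext_gen k S)"
  by (rule ext) (simp add: ext_monomial_def word_def)

text \<open>The common interface for the two matroids, their direct sum and their parallel
  connection: it makes every ordering of a circuit a word over the generators.\<close>

locale circuit_system =
  fixes M :: "'a matroid"
  assumes circuits_ground: "C \<in> circuits M \<Longrightarrow> C \<subseteq> ground M"
begin

text \<open>Replaces \<partial> by the explicit formula, which homomorphisms into other algebras
  preserve.\<close>

lemma os_ideal_eq: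
  "os_ideal k M = Idl\<^bsub>exterior_algebra k (ground M)\<^esub>
     (word_deriv (exterior_algebra k (ground M)) (ext_gen k (ground M)) `
       {ss. distinct ss \<and> set ss \<in> circuits M})"
proof -
  have "{ext_deriv k (ground M) (ext_monomial k (ground M) ss) | ss.
        distinct ss \<and> set ss \<in> circuits M} =
      (word_deriv (exterior_algebra k (ground M)) (ext_gen k (ground M)) `
       {ss. distinct ss \<and> set ss \<in> circuits M})"
  proof -
    have "ext_deriv k (ground M) (ext_monomial k (ground M) ss) =
        word_deriv (exterior_algebra k (ground M)) (ext_gen k (ground M)) ss"
      if "set ss \<in> circuits M" for ss
      unfolding ext_monomial_word by (rule ext_deriv_word) (rule circuits_ground[OF that])
    then show ?thesis by (auto simp: image_iff)
  qed
  then show ?thesis by (simp add: os_ideal_def)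
qed

lemma os_relations_closed:
  "word_deriv (exterior_algebra k (ground M)) (ext_gen k (ground M)) `
     {ss. distinct ss \<and> set ss \<in> circuits M} \<subseteq> carrier (exterior_algebra k (ground M))"
proof -
  interpret anticommuting "exterior_algebra k (ground M)" "ground M" "ext_gen k (ground M)"
    by (rule anticommuting_ext)
  show ?thesis by (auto dest!: circuits_ground)
qed

lemma ideal_os: "ideal (os_ideal k M) (exterior_algebra k (ground M))"
proof -
  interpret anticommuting "exterior_algebra k (ground M)" "ground M" "ext_gen k (ground M)"
    by (rule anticommuting_ext)
  show ?thesis unfolding os_ideal_eq using os_relations_closed by (rule genideal_ideal)
qed

lemma generated_os: "generated (os_algebra k M) (ground M) (os_gen k M)"
proof -
  interpret generated "exterior_algebra k (ground M)" "ground M" "ext_gen k (ground M)"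
    by (rule generated_ext)
  show ?thesis
    using generated_quot[OF ideal_os] unfolding os_algebra_def os_gen_def .
qed

lemma os_proj_hom:
  "kalg_hom (exterior_algebra k (ground M)) (os_algebra k M)
     (\<lambda>x. os_ideal k M +>\<^bsub>exterior_algebra k (ground M)\<^esub> x)"
proof -
  interpret anticommuting "exterior_algebra k (ground M)" "ground M" "ext_gen k (ground M)"
    by (rule anticommuting_ext)
  interpret I: kalg_ideal "exterior_algebra k (ground M)" "os_ideal k M"
    using ideal_os[of k] by (simp add: kalg_axioms kalg_ideal.intro)
  show ?thesis using I.kalg_hom_proj by (simp add: os_algebra_def)
qed

lemma anticommuting_os: "anticommuting (os_algebra k M) (ground M) (os_gen k M)"
proof -
  interpret E: anticommuting "exterior_algebra k (ground M)" "ground M" "ext_gen k (ground M)"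
    by (rule anticommuting_ext)
  interpret p: kalg_hom "exterior_algebra k (ground M)" "os_algebra k M"
    "\<lambda>x. os_ideal k M +>\<^bsub>exterior_algebra k (ground M)\<^esub> x"
    by (rule os_proj_hom)
  show ?thesis
  proof
    fix s t assume st: "s \<in> ground M" "t \<in> ground M"
    let ?s = "ext_gen k (ground M) s" and ?t = "ext_gen k (ground M) t"
    show "os_gen k M s \<otimes>\<^bsub>os_algebra k M\<^esub> os_gen k M t =
        \<ominus>\<^bsub>os_algebra k M\<^esub> (os_gen k M t \<otimes>\<^bsub>os_algebra k M\<^esub> os_gen k M s)"
      using st E.r_anti[of s t] p.mult[of ?s ?t] p.mult[of ?t ?s]
        p.uminus[of "?t \<otimes>\<^bsub>exterior_algebra k (ground M)\<^esub> ?s"]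
      by (simp add: os_gen_def)
  next
    fix s assume s: "s \<in> ground M"
    then show "os_gen k M s \<otimes>\<^bsub>os_algebra k M\<^esub> os_gen k M s = \<zero>\<^bsub>os_algebra k M\<^esub>"
      using E.r_sq[OF s] p.mult[of "ext_gen k (ground M) s" "ext_gen k (ground M) s"] p.zero
      by (simp add: os_gen_def)
  qed (auto simp: os_gen_def)
qed

lemma os_circuit:
  assumes ss: "distinct ss" "set ss \<in> circuits M"
  shows "word_deriv (os_algebra k M) (os_gen k M) ss = \<zero>\<^bsub>os_algebra k M\<^esub>"
proof -
  interpret E: anticommuting "exterior_algebra k (ground M)" "ground M" "ext_gen k (ground M)"
    by (rule anticommuting_ext)
  interpret I: kalg_ideal "exterior_algebra k (ground M)" "os_ideal k M"
    using ideal_os[of k] by (simp add: E.kalg_axioms kalg_ideal.intro)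
  interpret p: kalg_hom "exterior_algebra k (ground M)" "os_algebra k M"
    "\<lambda>x. os_ideal k M +>\<^bsub>exterior_algebra k (ground M)\<^esub> x"
    by (rule os_proj_hom)
  have sub: "set ss \<subseteq> ground M" using ss circuits_ground by blast
  have "E.d ss \<in> os_ideal k M"
    unfolding os_ideal_eq using E.genideal_self[OF os_relations_closed] ss by blast
  then have "I.proj (E.d ss) = \<zero>\<^bsub>os_algebra k M\<^esub>"
    using I.proj_zero_iff[of "E.d ss"] sub by (simp add: os_algebra_def)
  then show ?thesis
    using p.hom_word_deriv[of ss "ext_gen k (ground M)"] sub
    by (simp add: os_gen_def[abs_def] subset_iff)
qed

text \<open>The universal property behind all maps out of an Orlik--Solomon algebra. The lift to the
  exterior algebra sends derivatives of words to derivatives of words, so the relations become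
  conditions inside \<open>R\<close>.\<close>

lemma os_lift:
  fixes k :: "'k::field itself"
  assumes "anticommuting R (ground M) r"
    and circ: "\<And>ss. \<lbrakk>distinct ss; set ss \<in> circuits M\<rbrakk> \<Longrightarrow> word_deriv R r ss = \<zero>\<^bsub>R\<^esub>"
  shows "\<exists>h. kalg_hom (os_algebra k M) R h \<and> (\<forall>s\<in>ground M. h (os_gen k M s) = r s)"
proof -
  let ?E = "exterior_algebra k (ground M)" and ?e = "ext_gen k (ground M)"
  interpret E: anticommuting ?E "ground M" ?e by (rule anticommuting_ext)
  interpret I: kalg_ideal ?E "os_ideal k M"
    using ideal_os[of k] by (simp add: E.kalg_axioms kalg_ideal.intro)
  obtain h where h: "kalg_hom ?E R h" "\<forall>s\<in>ground M. h (?e s) = r s"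
    using ext_lift[OF assms(1)] by blast
  interpret h: kalg_hom ?E R h by (rule h(1))
  have gen: "h x = \<zero>\<^bsub>R\<^esub>" if x: "x \<in> E.d ` {ss. distinct ss \<and> set ss \<in> circuits M}" for x
  proof -
    obtain ss where ss: "x = E.d ss" "distinct ss" "set ss \<in> circuits M" using x by auto
    then have sub: "set ss \<subseteq> ground M" using circuits_ground by blast
    then have "h x = word_deriv R (\<lambda>s. h (?e s)) ss"
      unfolding ss(1) by (intro h.hom_word_deriv) auto
    also have "\<dots> = word_deriv R r ss"
      using h(2) sub by (intro word_deriv_cong) auto
    finally show ?thesis using circ ss by simp
  qed
  have "h x = \<zero>\<^bsub>R\<^esub>" if "x \<in> os_ideal k M" for x
    by (rule h.kernel_genideal[OF os_relations_closed gen that[unfolded os_ideal_eq]])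
  then obtain g where "kalg_hom I.Q R g" "\<forall>x\<in>carrier ?E. g (I.proj x) = h x"
    using I.factor[OF h(1)] by blast
  then show ?thesis using h(2) unfolding os_algebra_def os_gen_def
    by (intro exI[of _ g]) auto
qed

end

text \<open>Justifies the definite description in \<open>os_map\<close>: \<open>os_lift\<close>
  gives existence, agreement on generators gives uniqueness, and restriction to the carrier supplies
  extensionality.\<close>

lemma os_map_hom:
  fixes k :: "'k::field itself"
  assumes M: "circuit_system M" and N: "circuit_system N" and \<phi>: "\<phi> ` ground M \<subseteq> ground N"
    and circ: "\<And>ss. \<lbrakk>distinct ss; set ss \<in> circuits M\<rbrakk> \<Longrightarrow>
      word_deriv (os_algebra k N) (\<lambda>s. os_gen k N (\<phi> s)) ss = \<zero>\<^bsub>os_algebra k N\<^esub>"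
  shows "kalg_hom (os_algebra k M) (os_algebra k N) (os_map k M N \<phi>)"
    and "s \<in> ground M \<Longrightarrow> os_map k M N \<phi> (os_gen k M s) = os_gen k N (\<phi> s)"
proof -
  interpret M: circuit_system M by fact
  interpret N: circuit_system N by fact
  interpret A: generated "os_algebra k M" "ground M" "os_gen k M" by (rule M.generated_os)
  interpret B: anticommuting "os_algebra k N" "ground N" "os_gen k N" by (rule N.anticommuting_os)
  have "anticommuting (os_algebra k N) (ground M) (\<lambda>s. os_gen k N (\<phi> s))"
  proof
    fix s t assume "s \<in> ground M" "t \<in> ground M"
    then show "os_gen k N (\<phi> s) \<otimes>\<^bsub>os_algebra k N\<^esub> os_gen k N (\<phi> t) =
        \<ominus>\<^bsub>os_algebra k N\<^esub> (os_gen k N (\<phi> t) \<otimes>\<^bsub>os_algebra k N\<^esub> os_gen k N (\<phi> s))"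
      using \<phi> by (intro B.r_anti) auto
  qed (use \<phi> in \<open>auto simp: image_subset_iff B.r_sq\<close>)
  then obtain h where h: "kalg_hom (os_algebra k M) (os_algebra k N) h"
    "\<forall>s\<in>ground M. h (os_gen k M s) = os_gen k N (\<phi> s)"
    using M.os_lift[of "os_algebra k N" "\<lambda>s. os_gen k N (\<phi> s)" k, OF _ circ] by auto
  interpret h: kalg_hom "os_algebra k M" "os_algebra k N" h by (rule h(1))
  define f where "f = restrict h (carrier (os_algebra k M))"
  have f: "kalg_hom (os_algebra k M) (os_algebra k N) f"
    by unfold_locales (auto simp: f_def intro!: alg_homI)
  have f_gen: "\<forall>s\<in>ground M. f (os_gen k M s) = os_gen k N (\<phi> s)"
    using h(2) by (simp add: f_def)
  have "os_map k M N \<phi> = f"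
    unfolding os_map_def
  proof (rule the_equality)
    fix g assume g: "g \<in> extensional (carrier (os_algebra k M)) \<and>
      g \<in> alg_hom (os_algebra k M) (os_algebra k N) \<and>
      (\<forall>s\<in>ground M. g (os_gen k M s) = os_gen k N (\<phi> s))"
    then have g': "kalg_hom (os_algebra k M) (os_algebra k N) g"
      by (simp add: kalg_hom_def kalg_hom_axioms_def A.kalg_axioms B.kalg_axioms)
    show "g = f"
    proof (rule extensionalityI[where A = "carrier (os_algebra k M)"])
      fix x assume "x \<in> carrier (os_algebra k M)"
      then show "g x = f x" using A.hom_eq[OF g' f] g f_gen by simp
    qed (use g in \<open>auto simp: f_def\<close>)
  qed (use f f_gen in \<open>auto simp: f_def kalg_hom_def kalg_hom_axioms_def\<close>)
  then show "kalg_hom (os_algebra k M) (os_algebra k N) (os_map k M N \<phi>)"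
    and "s \<in> ground M \<Longrightarrow> os_map k M N \<phi> (os_gen k M s) = os_gen k N (\<phi> s)"
    using f f_gen by auto
qed

section \<open>Parallel connections\<close>

text \<open>Polarization again. Any family of degree 1 elements in such an algebra may thus serve as
  images of generators, in particular shifted generators.\<close>

lemma (in galg) anticommuting_of_squares:
  assumes sq: "\<And>v. v \<in> homog A 1 \<Longrightarrow> v \<otimes> v = \<zero>" and r: "\<And>s. s \<in> S \<Longrightarrow> r s \<in> homog A 1"
  shows "anticommuting A S r"
proof
  fix s t assume st: "s \<in> S" "t \<in> S"
  then have c: "r s \<in> carrier A" "r t \<in> carrier A" using r homog_carrier by blast+
  have "(r s \<oplus> r t) \<otimes> (r s \<oplus> r t) = \<zero>" by (intro sq homog_add r st)
  then have "r s \<otimes> r t \<oplus> r t \<otimes> r s = \<zero>"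
    using sq[OF r[OF st(1)]] sq[OF r[OF st(2)]] c by (simp add: l_distr r_distr a_comm)
  then show "r s \<otimes> r t = \<ominus> (r t \<otimes> r s)" using c by (intro minus_equality[symmetric]) auto
qed (use sq r homog_carrier in blast)+

lemma (in anticommuting) uminus_words:
  assumes "set ss \<subseteq> S"
  shows "word A (\<lambda>s. \<ominus> r s) ss = (- 1) ^ length ss \<odot> w ss"
    and "word_deriv A (\<lambda>s. \<ominus> r s) ss = \<ominus> ((- 1) ^ length ss \<odot> d ss)"
proof -
  have *: "word A (\<lambda>s. \<ominus> r s) ss = (- 1) ^ length ss \<odot> w ss" if "set ss \<subseteq> S" for ss
    using that by (induction ss) (auto simp: l_minus)
  show "word A (\<lambda>s. \<ominus> r s) ss = (- 1) ^ length ss \<odot> w ss" by (rule *[OF assms])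
  show "word_deriv A (\<lambda>s. \<ominus> r s) ss = \<ominus> ((- 1) ^ length ss \<odot> d ss)"
    using assms
    by (induction ss)
      (auto simp: * a_minus_def l_minus r_minus minus_minus smult_r_distr minus_add)
qed

context circuit_system
begin

lemma os_homog_one_sq:
  assumes "v \<in> homog (os_algebra k M) 1"
  shows "v \<otimes>\<^bsub>os_algebra k M\<^esub> v = \<zero>\<^bsub>os_algebra k M\<^esub>"
proof -
  let ?E = "exterior_algebra k (ground M)"
  interpret E: generated ?E "ground M" "ext_gen k (ground M)" by (rule generated_ext)
  interpret I: kalg_ideal ?E "os_ideal k M"
    using ideal_os[of k] by (simp add: E.kalg_axioms kalg_ideal.intro)
  interpret p: kalg_hom ?E "os_algebra k M" I.proj by (rule os_proj_hom)
  obtain x where x: "x \<in> homog ?E 1" "v = I.proj x"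
    using assms by (auto simp: os_algebra_def I.quot_simps)
  then show ?thesis
    using p.mult[of x x] E.homog_carrier[of x 1] ext_homog_one_sq[OF x(1)] p.zero by simp
qed

lemma os_anticommuting:
  assumes "\<And>s. s \<in> S \<Longrightarrow> r s \<in> homog (os_algebra k M) 1"
  shows "anticommuting (os_algebra k M) S r"
proof -
  interpret generated "os_algebra k M" "ground M" "os_gen k M" by (rule generated_os)
  show ?thesis by (rule anticommuting_of_squares[OF os_homog_one_sq assms])
qed

text \<open>Negating all generators multiplies each relation by a sign, so the endomorphism
  descends. It supplies the twist for \<tau>.\<close>

lemma os_involution:
  "\<exists>\<alpha>. kalg_hom (os_algebra k M) (os_algebra k M) \<alpha> \<and>
     (\<forall>s\<in>ground M. \<alpha> (os_gen k M s) = \<ominus>\<^bsub>os_algebra k M\<^esub> os_gen k M s)"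
proof -
  interpret anticommuting "os_algebra k M" "ground M" "os_gen k M" by (rule anticommuting_os)
  show ?thesis
  proof (rule os_lift[OF anticommuting_uminus])
    fix ss assume "distinct ss" "set ss \<in> circuits M"
    then show "word_deriv (os_algebra k M) (\<lambda>s. \<ominus>\<^bsub>os_algebra k M\<^esub> os_gen k M s) ss =
        \<zero>\<^bsub>os_algebra k M\<^esub>"
      using uminus_words(2)[OF circuits_ground, of ss] os_circuit[of ss k] by simp
  qed
qed

end

locale parallel = M1: circuit_system M1 + M2: circuit_system M2
  for M1 M2 :: "'a matroid" +
  fixes i :: 'a
  assumes fin: "finite (ground M1)" "finite (ground M2)"
    and inter: "ground M1 \<inter> ground M2 = {i}"
begin

definition P where "P = parallel_connection i M1 M2"
definition D where "D = direct_sum M1 M2"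

lemma i_ground [simp]: "i \<in> ground M1" "i \<in> ground M2" "i \<in> ground P"
  using inter by (auto simp: P_def parallel_connection_def)

lemma ground_P: "ground P = ground M1 \<union> ground M2"
  by (simp add: P_def parallel_connection_def)

lemma ground_D: "ground D = Inl ` ground M1 \<union> Inr ` ground M2"
  by (auto simp: D_def direct_sum_def)

lemma circuits_P:
  "circuits M1 \<subseteq> circuits P" "circuits M2 \<subseteq> circuits P"
  by (auto simp: P_def parallel_connection_def)

lemma circuit_system_P: "circuit_system P"
  by unfold_locales
    (auto simp: P_def parallel_connection_def dest!: M1.circuits_ground M2.circuits_ground)

lemma circuit_system_D: "circuit_system D"
  by unfold_locales
    (auto simp: D_def direct_sum_def dest!: M1.circuits_ground M2.circuits_ground)

text \<open>The criterion for mapping out of A(P). A glued circuit falls under \<open>glue\<close>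
  with the two circuits stripped of \<open>i\<close>; the pieces are disjoint because the ground
  sets meet only in \<open>i\<close>.\<close>

lemma parallel_relations:
  assumes R: "anticommuting R (ground P) r"
    and 1: "\<And>ss. \<lbrakk>distinct ss; set ss \<in> circuits M1\<rbrakk> \<Longrightarrow> word_deriv R r ss = \<zero>\<^bsub>R\<^esub>"
    and 2: "\<And>ss. \<lbrakk>distinct ss; set ss \<in> circuits M2\<rbrakk> \<Longrightarrow> word_deriv R r ss = \<zero>\<^bsub>R\<^esub>"
    and ss: "distinct ss" "set ss \<in> circuits P"
  shows "word_deriv R r ss = \<zero>\<^bsub>R\<^esub>"
proof -
  interpret anticommuting R "ground P" r by fact
  consider "set ss \<in> circuits M1" | "set ss \<in> circuits M2"
    | C1 C2 where "C1 \<in> circuits M1" "C2 \<in> circuits M2" "i \<in> C1" "i \<in> C2"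
      "set ss = (C1 - {i}) \<union> (C2 - {i})"
    using ss(2) by (auto simp: P_def parallel_connection_def)
  then show ?thesis
  proof cases
    case 3
    have C: "C1 \<subseteq> ground M1" "C2 \<subseteq> ground M2"
      using 3 M1.circuits_ground M2.circuits_ground by blast+
    have "C1 - {i} \<subseteq> ground P" "C2 - {i} \<subseteq> ground P" "(C1 - {i}) \<inter> (C2 - {i}) = {}"
      using C inter by (auto simp: ground_P)
    then show ?thesis
    proof (rule glue[OF i_ground(3) _ _ _ _ _ _ _ ss(1) 3(5)])
      fix xs assume "distinct xs" "set xs = insert i (C1 - {i})"
      then show "d xs = \<zero>\<^bsub>R\<^esub>" using 3 by (intro 1) (simp_all add: insert_absorb)
    next
      fix xs assume "distinct xs" "set xs = insert i (C2 - {i})"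
      then show "d xs = \<zero>\<^bsub>R\<^esub>" using 3 by (intro 2) (simp_all add: insert_absorb)
    qed auto
  qed (use 1 2 ss in auto)
qed

lemma circuit_D_cases:
  assumes "distinct ss" "set ss \<in> circuits D"
  obtains ts where "ss = map Inl ts" "distinct ts" "set ts \<in> circuits M1"
  | ts where "ss = map Inr ts" "distinct ts" "set ts \<in> circuits M2"
proof -
  consider C where "C \<in> circuits M1" "set ss = Inl ` C" | C where "C \<in> circuits M2" "set ss = Inr ` C"
    using assms(2) by (auto simp: D_def direct_sum_def)
  then show thesis
  proof cases
    case 1
    have ss: "map Inl (map projl ss) = ss"
      unfolding map_map by (rule map_idI) (use 1 in auto)
    have "set (map projl ss) = C" using 1(2) by (simp add: image_image)
    moreover have "distinct (map projl ss)" using assms(1) by (subst (asm) ss[symmetric]) (simp only: distinct_map)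
    ultimately show thesis using that(1)[OF ss[symmetric]] 1 by simp
  next
    case 2
    have ss: "map Inr (map projr ss) = ss"
      unfolding map_map by (rule map_idI) (use 2 in auto)
    have "set (map projr ss) = C" using 2(2) by (simp add: image_image)
    moreover have "distinct (map projr ss)" using assms(1) by (subst (asm) ss[symmetric]) (simp only: distinct_map)
    ultimately show thesis using that(2)[OF ss[symmetric]] 2 by simp
  qed
qed

lemma P_circuit:
  assumes "distinct ss" "set ss \<in> circuits M1 \<union> circuits M2"
  shows "word_deriv (os_algebra k P) (os_gen k P) ss = \<zero>\<^bsub>os_algebra k P\<^esub>"
  using circuit_system.os_circuit[OF circuit_system_P assms(1)] assms(2) circuits_P by blast

lemma D_circuit:
  assumes "distinct ss"
  shows "set ss \<in> circuits M1 \<Longrightarrow>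
      word_deriv (os_algebra k D) (\<lambda>s. os_gen k D (Inl s)) ss = \<zero>\<^bsub>os_algebra k D\<^esub>"
    and "set ss \<in> circuits M2 \<Longrightarrow>
      word_deriv (os_algebra k D) (\<lambda>s. os_gen k D (Inr s)) ss = \<zero>\<^bsub>os_algebra k D\<^esub>"
  using circuit_system.os_circuit[OF circuit_system_D, of "map Inl ss" k]
    circuit_system.os_circuit[OF circuit_system_D, of "map Inr ss" k] assms
  by (simp_all add: D_def direct_sum_def distinct_map word_deriv_map)

end

section \<open>The short exact sequence\<close>

context parallel
begin

lemma exact_sequence:
  fixes k :: "'k::field itself"
  shows "\<exists>\<psi>. short_exact (shift (os_algebra k P)) \<psi> (os_algebra k D)
    (os_map k D P identification) (os_algebra k P)"
proof -
  define A where "A = os_algebra k P"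
  define e where "e = os_gen k P"
  define B where "B = os_algebra k D"
  define f where "f = os_gen k D"
  interpret P: circuit_system P by (rule circuit_system_P)
  interpret D: circuit_system D by (rule circuit_system_D)
  interpret A: generated A "ground P" e unfolding A_def e_def by (rule P.generated_os)
  interpret B: generated B "ground D" f unfolding B_def f_def by (rule D.generated_os)
  interpret Aa: anticommuting A "ground P" e unfolding A_def e_def by (rule P.anticommuting_os)
  have fl: "f (Inl s) \<in> homog B 1" if "s \<in> ground M1" for s
    by (rule B.e_homog) (use that in \<open>simp add: ground_D\<close>)
  have fr: "f (Inr s) \<in> homog B 1" if "s \<in> ground M2" for s
    by (rule B.e_homog) (use that in \<open>simp add: ground_D\<close>)
  have fc: "s \<in> ground M1 \<Longrightarrow> f (Inl s) \<in> carrier B" "s \<in> ground M2 \<Longrightarrow> f (Inr s) \<in> carrier B" for s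
    using fl fr B.homog_carrier by blast+
  have e_ident: "e (identification s) \<in> homog A 1" if "s \<in> ground D" for s
    by (rule A.e_homog) (use that in \<open>auto simp: ground_D identification_def ground_P\<close>)

  \<comment> \<open>The map \<phi> and the element \<delta> of its kernel\<close>
  define \<phi> where "\<phi> = os_map k D P identification"
  have ident: "identification ` ground D \<subseteq> ground P"
    by (auto simp: ground_D identification_def ground_P)
  have circ: "word_deriv A (\<lambda>s. e (identification s)) ss = \<zero>\<^bsub>A\<^esub>"
    if "distinct ss" "set ss \<in> circuits D" for ss
    using that by (cases rule: circuit_D_cases)
      (auto simp: word_deriv_map identification_def A_def e_def P_circuit)
  have \<phi>: "kalg_hom B A \<phi>" and \<phi>_gen: "\<And>s. s \<in> ground D \<Longrightarrow> \<phi> (f s) = e (identification s)"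
    unfolding A_def B_def e_def f_def \<phi>_def
    by (rule os_map_hom[OF circuit_system_D circuit_system_P ident circ[unfolded A_def e_def]],
      assumption+)+
  interpret \<phi>: kalg_hom B A \<phi> by (rule \<phi>)
  define \<delta> where "\<delta> = f (Inl i) \<ominus>\<^bsub>B\<^esub> f (Inr i)"
  have \<delta>_homog: "\<delta> \<in> homog B 1" unfolding \<delta>_def by (intro B.homog_minus fl fr) auto
  then have \<delta>c: "\<delta> \<in> carrier B" by (rule B.homog_carrier)
  note sq = D.os_homog_one_sq[of _ k, folded B_def]
  have \<delta>\<delta>: "\<delta> \<otimes>\<^bsub>B\<^esub> \<delta> = \<zero>\<^bsub>B\<^esub>" by (rule sq[OF \<delta>_homog])
  have anti: "x \<otimes>\<^bsub>B\<^esub> y = \<ominus>\<^bsub>B\<^esub> (y \<otimes>\<^bsub>B\<^esub> x)" if "x \<in> homog B 1" "y \<in> homog B 1" for x y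
  proof -
    interpret anticommuting B "{x, y}" "\<lambda>x. x"
      by (rule B.anticommuting_of_squares[OF sq]) (use that in auto)
    show ?thesis by (rule r_anti) auto
  qed

  \<comment> \<open>The section \<sigma>\<close>
  define r where "r s = (if s \<in> ground M1 then f (Inl s) else f (Inr s) \<oplus>\<^bsub>B\<^esub> \<delta>)" for s
  have r1: "r s = f (Inl s)" if "s \<in> ground M1" for s using that by (simp add: r_def)
  \<comment> \<open>The two prescriptions must agree at the common element \<open>i\<close>, and
    this is what determines \<delta>: adding it to the second copy of e_i gives the first.\<close>
  have r2: "r s = f (Inr s) \<oplus>\<^bsub>B\<^esub> \<delta>" if "s \<in> ground M2" for s
  proof (cases "s \<in> ground M1")
    case True
    then have "s = i" using that inter by auto
    have "f (Inr i) \<oplus>\<^bsub>B\<^esub> (\<ominus>\<^bsub>B\<^esub> f (Inr i) \<oplus>\<^bsub>B\<^esub> f (Inl i)) = f (Inl i)"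
      using fc(1)[of i] fc(2)[of i] by (simp add: B.r_neg2)
    then have *: "f (Inr i) \<oplus>\<^bsub>B\<^esub> \<delta> = f (Inl i)"
      using fc(1)[of i] fc(2)[of i] B.a_comm[of "f (Inl i)" "\<ominus>\<^bsub>B\<^esub> f (Inr i)"]
      by (simp add: \<delta>_def a_minus_def)
    then show ?thesis using \<open>s = i\<close> by (simp add: r1)
  qed (simp add: r_def)
  have r_homog: "r s \<in> homog B 1" if "s \<in> ground P" for s
    using that fl B.homog_add[OF fr \<delta>_homog] r1 r2 by (auto simp: ground_P)
  have r_anti: "anticommuting B (ground P) r"
    by (rule B.anticommuting_of_squares[OF sq r_homog])
  have "\<exists>\<sigma>. kalg_hom A B \<sigma> \<and> (\<forall>s\<in>ground P. \<sigma> (e s) = r s)"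
    unfolding A_def e_def
  proof (rule P.os_lift[OF r_anti])
    fix ss assume ss: "distinct ss" "set ss \<in> circuits P"
    show "word_deriv B r ss = \<zero>\<^bsub>B\<^esub>"
    proof (rule parallel_relations[OF r_anti _ _ ss])
      fix ss assume ss: "distinct ss" "set ss \<in> circuits M1"
      have "word_deriv B r ss = word_deriv B (\<lambda>s. f (Inl s)) ss"
        by (rule word_deriv_cong, rule r1) (use M1.circuits_ground ss in blast)
      then show "word_deriv B r ss = \<zero>\<^bsub>B\<^esub>" using D_circuit ss by (simp add: B_def f_def)
    next
      fix ss assume ss: "distinct ss" "set ss \<in> circuits M2"
      then have sub: "set ss \<subseteq> ground M2" using M2.circuits_ground by blast
      interpret anticommuting B "ground M2" "\<lambda>s. f (Inr s)"
        by (rule B.anticommuting_of_squares[OF sq fr])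
      \<comment> \<open>\<open>translate\<close> subtracts its element, so adding \<delta> to the
        generators of the second copy is translation by \<open>- \<delta>\<close>.\<close>
      have t: "\<ominus>\<^bsub>B\<^esub> \<delta> \<in> homog B 1"
        using \<delta>_homog B.homog_smult[of \<delta> 1 "- 1"] \<delta>c by simp
      have "word_deriv B r ss = word_deriv B (\<lambda>s. f (Inr s) \<ominus>\<^bsub>B\<^esub> (\<ominus>\<^bsub>B\<^esub> \<delta>)) ss"
        by (rule word_deriv_cong) (use r2 sub \<delta>c in \<open>auto simp: a_minus_def B.minus_minus\<close>)
      also have "\<dots> = word_deriv B (\<lambda>s. f (Inr s)) ss"
        by (rule conjunct2[OF translate[OF B.homog_carrier[OF t] anti[OF t fr] sq[OF t] sub]])
      finally show "word_deriv B r ss = \<zero>\<^bsub>B\<^esub>" using D_circuit ss by (simp add: B_def f_def)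
    qed
  qed
  then obtain \<sigma> where \<sigma>: "kalg_hom A B \<sigma>" and \<sigma>_gen: "\<And>s. s \<in> ground P \<Longrightarrow> \<sigma> (e s) = r s"
    by blast
  interpret \<sigma>: kalg_hom A B \<sigma> by (rule \<sigma>)
  have \<phi>\<delta>: "\<phi> \<delta> = \<zero>\<^bsub>A\<^esub>"
    using fc(1)[of i] fc(2)[of i] by (simp add: \<delta>_def \<phi>_gen ground_D identification_def A.r_right_minus_eq)
  have \<phi>_r: "\<phi> (r s) = e s" if "s \<in> ground P" for s
    using that r1[of s] r2[of s] \<phi>\<delta> \<delta>c fc[of s]
    by (auto simp: ground_P \<phi>_gen ground_D identification_def)
  have \<phi>\<sigma>: "\<phi> (\<sigma> x) = x" if "x \<in> carrier A" for x
  proof (rule A.hom_eq[OF kalg_hom_compose[OF \<sigma> \<phi>] _ _ that])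
    show "kalg_hom A A (\<lambda>x. x)"
      by (auto simp: kalg_hom_def kalg_hom_axioms_def A.kalg_axioms intro!: alg_homI)
  qed (simp add: \<sigma>_gen \<phi>_r)

  \<comment> \<open>The twisted derivation \<tau>\<close>
  obtain \<alpha> where \<alpha>: "kalg_hom A A \<alpha>" "\<And>s. s \<in> ground P \<Longrightarrow> \<alpha> (e s) = \<ominus>\<^bsub>A\<^esub> e s"
    using P.os_involution[of k] unfolding A_def e_def by blast
  \<comment> \<open>Indices come from the ground set of the direct sum, values lie in A(P), and the
    two copies of \<open>i\<close> share a value. The homomorphism thus starts at \<open>B\<close>
    while its matrices have entries in \<open>A\<close>, which makes \<tau> a derivation along
    \<phi>.\<close>
  interpret odd: odd_family A "ground D" "\<lambda>s. e (identification s)" \<alpha>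
  proof (intro odd_family.intro odd_family_axioms.intro \<alpha>(1))
    show "anticommuting A (ground D) (\<lambda>s. e (identification s))"
      unfolding A_def by (rule P.os_anticommuting) (rule e_ident[unfolded A_def])
  qed (use ident \<alpha>(2) in auto)
  \<comment> \<open>The weights are the coefficients of \<delta> in x - \<sigma>(\<phi>(x)): a
    generator of the first copy equals its image under \<sigma> \<phi>, one of the second copy
    equals its image minus \<delta>.\<close>
  define c :: "'a + 'a \<Rightarrow> 'k" where "c = case_sum (\<lambda>_. 0) (\<lambda>_. - 1)"
  have "\<exists>h. kalg_hom B (tri A \<alpha>) h \<and> (\<forall>s\<in>ground D. h (f s) = odd.weighted c s)"
    unfolding B_def f_def
  proof (rule D.os_lift[OF odd.weighted_anticommuting])
    fix ss assume ss: "distinct ss" "set ss \<in> circuits D"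
    have sub: "set ss \<subseteq> ground D" using ss D.circuits_ground by blast
    \<comment> \<open>A circuit of the direct sum lies in a single copy, and there the weight is
      constant.\<close>
    have "\<exists>c0. \<forall>s\<in>set ss. c s = c0"
      using ss by (cases rule: circuit_D_cases) (auto simp: c_def)
    then obtain c0 where "\<And>s. s \<in> set ss \<Longrightarrow> c s = c0" by blast
    then have "word_deriv (tri A \<alpha>) (odd.weighted c) ss = (odd.d ss, \<zero>\<^bsub>A\<^esub>)"
      by (rule odd.weighted_deriv[OF sub])
    then show "word_deriv (tri A \<alpha>) (odd.weighted c) ss = \<zero>\<^bsub>tri A \<alpha>\<^esub>"
      using circ[OF ss] by simp
  qed
  then obtain h where h: "kalg_hom B (tri A \<alpha>) h"
    and h_gen: "\<And>s. s \<in> ground D \<Longrightarrow> h (f s) = odd.weighted c s" by blast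
  note hh = tri_hom_components[OF h A.kalg_axioms]
  have fst_h: "fst (h x) = \<phi> x" if "x \<in> carrier B" for x
    by (rule B.hom_eq[OF hh(1) \<phi> _ that]) (simp add: h_gen \<phi>_gen)
  define \<tau> where "\<tau> x = snd (h x)" for x
  have \<tau>_lin: "\<tau> \<in> linear_maps B A" using hh(2) unfolding \<tau>_def .
  note \<tau> = linear_mapsD[OF \<tau>_lin]
  have \<tau>_mult: "\<tau> (x \<otimes>\<^bsub>B\<^esub> y) = (\<alpha> (\<phi> x) \<otimes>\<^bsub>A\<^esub> \<tau> y) \<oplus>\<^bsub>A\<^esub> (\<tau> x \<otimes>\<^bsub>A\<^esub> \<phi> y)"
    if "x \<in> carrier B" "y \<in> carrier B" for x y
    using hh(3)[OF that] that by (simp add: \<tau>_def fst_h)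
  have \<tau>_l: "\<tau> (f (Inl s)) = \<zero>\<^bsub>A\<^esub>" if "s \<in> ground M1" for s
    using that h_gen[of "Inl s"] by (simp add: \<tau>_def c_def ground_D)
  have \<tau>_r: "\<tau> (f (Inr s)) = \<ominus>\<^bsub>A\<^esub> \<one>\<^bsub>A\<^esub>" if "s \<in> ground M2" for s
    using that h_gen[of "Inr s"] by (simp add: \<tau>_def c_def ground_D)
  have \<tau>\<delta>: "\<tau> \<delta> = \<one>\<^bsub>A\<^esub>"
  proof -
    have "\<delta> = f (Inl i) \<oplus>\<^bsub>B\<^esub> (- 1) \<odot>\<^bsub>B\<^esub> f (Inr i)" using fc by (simp add: \<delta>_def a_minus_def)
    then show ?thesis using fc[of i] by (simp add: \<tau> \<tau>_l \<tau>_r A.minus_minus del: B.smult_uminus_one B.smult_uminus)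
  qed

  \<comment> \<open>The decomposition of A(M1 + M2) along \<sigma> and \<delta> \<sigma>\<close>
  have decomp: "x = \<sigma> (\<phi> x) \<oplus>\<^bsub>B\<^esub> \<delta> \<otimes>\<^bsub>B\<^esub> \<sigma> (\<tau> x)" if "x \<in> carrier B" for x
  proof -
    have lin: "(\<lambda>x. \<sigma> (\<phi> x) \<oplus>\<^bsub>B\<^esub> \<delta> \<otimes>\<^bsub>B\<^esub> \<sigma> (\<tau> x)) \<in> linear_maps B B"
      by (rule linear_mapsI)
        (use \<tau>(1) \<delta>c in \<open>auto simp: \<tau>(2,3) B.r_distr B.smult_r_distr B.a_ac\<close>)
    have id: "(\<lambda>x. x) \<in> linear_maps B B" by (rule linear_mapsI) auto
    have "\<sigma> (\<phi> x) \<oplus>\<^bsub>B\<^esub> \<delta> \<otimes>\<^bsub>B\<^esub> \<sigma> (\<tau> x) = x"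
    proof (rule B.linear_eq[OF B.kalg_axioms lin id _ that])
      fix ss assume "set ss \<subseteq> ground D"
      then show "\<sigma> (\<phi> (word B f ss)) \<oplus>\<^bsub>B\<^esub> \<delta> \<otimes>\<^bsub>B\<^esub> \<sigma> (\<tau> (word B f ss)) = word B f ss"
      proof (induction ss)
        case Nil
        have "\<tau> \<one>\<^bsub>B\<^esub> = \<zero>\<^bsub>A\<^esub>" using h by (simp add: \<tau>_def kalg_hom.one)
        then show ?case using \<delta>c by simp
      next
        case (Cons s ss)
        define y where "y = word B f ss"
        have y: "y \<in> carrier B" unfolding y_def using Cons.prems by (intro B.word_closed) auto
        define p where "p = \<sigma> (\<phi> y)"
        define q where "q = \<sigma> (\<tau> y)"
        have pq: "p \<in> carrier B" "q \<in> carrier B" using y \<tau>(1) by (auto simp: p_def q_def)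
        have IH: "y = p \<oplus>\<^bsub>B\<^esub> \<delta> \<otimes>\<^bsub>B\<^esub> q" using Cons by (simp add: y_def p_def q_def)
        have fs: "f s \<in> carrier B" "f s \<in> homog B 1" using Cons.prems B.e_homog by auto
        \<comment> \<open>Moving the odd element \<delta> past a generator costs a sign, and the
          twist \<alpha> in the product rule for \<tau> supplies the opposite one.\<close>
        have swap: "\<delta> \<otimes>\<^bsub>B\<^esub> (f s \<otimes>\<^bsub>B\<^esub> q) = \<ominus>\<^bsub>B\<^esub> (f s \<otimes>\<^bsub>B\<^esub> (\<delta> \<otimes>\<^bsub>B\<^esub> q))"
          by (rule B.anti_lcomm[OF \<delta>c fs(1) pq(2) anti[OF \<delta>_homog fs(2)]])
        have \<delta>q: "\<delta> \<otimes>\<^bsub>B\<^esub> (\<delta> \<otimes>\<^bsub>B\<^esub> q) = \<zero>\<^bsub>B\<^esub>"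
          using \<delta>\<delta> \<delta>c pq B.m_assoc[of \<delta> \<delta> q] by simp
        have id: "identification s \<in> ground P" using Cons.prems ident by auto
        have \<phi>s: "\<sigma> (\<phi> (f s \<otimes>\<^bsub>B\<^esub> y)) = r (identification s) \<otimes>\<^bsub>B\<^esub> p"
          using fs y id Cons.prems by (simp add: \<phi>_gen \<sigma>_gen p_def)
        have \<tau>s: "\<sigma> (\<tau> (f s \<otimes>\<^bsub>B\<^esub> y)) =
            \<ominus>\<^bsub>B\<^esub> (r (identification s) \<otimes>\<^bsub>B\<^esub> q) \<oplus>\<^bsub>B\<^esub> \<sigma> (\<tau> (f s)) \<otimes>\<^bsub>B\<^esub> p"
          using fs y id Cons.prems \<tau>(1)[OF fs(1)] \<tau>(1)[OF y] \<alpha>(2)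
          by (simp add: \<tau>_mult \<phi>_gen \<sigma>_gen p_def q_def A.l_minus B.l_minus)
        have canc: "u \<oplus>\<^bsub>B\<^esub> (v \<oplus>\<^bsub>B\<^esub> (\<ominus>\<^bsub>B\<^esub> u \<oplus>\<^bsub>B\<^esub> z)) = v \<oplus>\<^bsub>B\<^esub> z"
          if "u \<in> carrier B" "v \<in> carrier B" "z \<in> carrier B" for u v z
          using that B.a_lcomm[of u v "\<ominus>\<^bsub>B\<^esub> u \<oplus>\<^bsub>B\<^esub> z"] by (simp add: B.r_neg2)
        consider t where "s = Inl t" "t \<in> ground M1" | t where "s = Inr t" "t \<in> ground M2"
          using Cons.prems by (auto simp: ground_D)
        then have "\<sigma> (\<phi> (f s \<otimes>\<^bsub>B\<^esub> y)) \<oplus>\<^bsub>B\<^esub> \<delta> \<otimes>\<^bsub>B\<^esub> \<sigma> (\<tau> (f s \<otimes>\<^bsub>B\<^esub> y)) = f s \<otimes>\<^bsub>B\<^esub> y"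
        proof cases
          case 1
          then have "r (identification s) = f s" "\<tau> (f s) = \<zero>\<^bsub>A\<^esub>"
            by (auto simp: identification_def r1 \<tau>_l)
          then show ?thesis unfolding \<phi>s \<tau>s using fs pq \<delta>c
            by (simp add: IH B.r_distr B.r_minus swap B.minus_minus)
        next
          case 2
          then have "r (identification s) = f s \<oplus>\<^bsub>B\<^esub> \<delta> \<and> \<tau> (f s) = \<ominus>\<^bsub>A\<^esub> \<one>\<^bsub>A\<^esub>"
            by (auto simp: identification_def r2 \<tau>_r)
          \<comment> \<open>On the second copy \<sigma> \<phi> adds the term \<delta> p, which the
            value -1 of \<tau> removes; the remaining extra term contains \<delta> twice and
            vanishes.\<close>
          moreover have "\<delta> \<otimes>\<^bsub>B\<^esub> p \<oplus>\<^bsub>B\<^esub> (f s \<otimes>\<^bsub>B\<^esub> p \<oplus>\<^bsub>B\<^esub>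
              (\<ominus>\<^bsub>B\<^esub> (\<delta> \<otimes>\<^bsub>B\<^esub> p) \<oplus>\<^bsub>B\<^esub> f s \<otimes>\<^bsub>B\<^esub> (\<delta> \<otimes>\<^bsub>B\<^esub> q))) =
              f s \<otimes>\<^bsub>B\<^esub> p \<oplus>\<^bsub>B\<^esub> f s \<otimes>\<^bsub>B\<^esub> (\<delta> \<otimes>\<^bsub>B\<^esub> q)"
            by (rule canc) (use fs pq \<delta>c in auto)
          ultimately show ?thesis unfolding \<phi>s \<tau>s using fs pq \<delta>c
            by (simp add: IH B.r_distr B.l_distr B.r_minus B.l_minus swap \<delta>q B.minus_minus
                B.minus_add B.a_ac B.r_neg B.r_neg2)
        qed
        then show ?case by (simp add: y_def)
      qed
    qed
    then show ?thesis by simp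
  qed

  \<comment> \<open>Exactness\<close>
  define \<psi> where "\<psi> b = \<delta> \<otimes>\<^bsub>B\<^esub> \<sigma> b" for b
  have \<psi>_lin: "\<psi> \<in> linear_maps A B"
    by (rule linear_mapsI) (use \<delta>c in \<open>auto simp: \<psi>_def B.r_distr\<close>)
  \<comment> \<open>As \<phi>(\<delta>) = 0, the Leibniz term that contains the value of \<tau> on
    \<sigma>(b) drops out; the other one is \<tau>(\<delta>) \<phi>(\<sigma>(b)) = b.\<close>
  have \<tau>\<psi>: "\<tau> (\<psi> b) = b" if "b \<in> carrier A" for b
    using that \<delta>c \<tau>(1)[of "\<sigma> b"] kalg_hom.zero[OF \<alpha>(1)] by (simp add: \<psi>_def \<tau>_mult \<phi>\<delta> \<tau>\<delta> \<phi>\<sigma>)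
  have "short_exact (shift A) \<psi> B \<phi> A"
    unfolding short_exact_def
  proof (intro conjI)
    have "\<psi> x \<in> homog B p" if "x \<in> homog (shift A) p" for x p
    proof (cases "p = 0")
      case True
      then show ?thesis using that \<delta>c by (auto simp: shift_def \<psi>_def)
    next
      case False
      then have x: "x \<in> homog A (p - 1)" using that by (simp add: shift_def)
      have "\<sigma> x \<in> homog B (p - 1)"
        by (rule A.hom_homog[OF B.galg_axioms \<sigma> _ x]) (simp only: \<sigma>_gen r_homog)
      then have "\<delta> \<otimes>\<^bsub>B\<^esub> \<sigma> x \<in> homog B (1 + (p - 1))" by (rule B.homog_mult[OF \<delta>_homog])
      then show ?thesis using False by (simp add: \<psi>_def)
    qed
    moreover have "\<psi> \<in> linear_maps (shift A) B"
      using \<psi>_lin by (auto simp: linear_maps_def shift_def)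
    ultimately show "\<psi> \<in> graded_linear_maps (shift A) B"
      by (auto simp: graded_linear_maps_def)
    have "\<phi> x \<in> homog A p" if "x \<in> homog B p" for x p
      by (rule B.hom_homog[OF A.galg_axioms \<phi> _ that]) (simp only: \<phi>_gen e_ident)
    then show "\<phi> \<in> graded_linear_maps B A"
      using \<phi>.linear by (auto simp: graded_linear_maps_def)
    show "inj_on \<psi> (carrier (shift A))"
      by (rule inj_on_inverseI[of _ \<tau>]) (simp add: shift_def \<tau>\<psi>)
    show "\<psi> ` carrier (shift A) = {y \<in> carrier B. \<phi> y = \<zero>\<^bsub>A\<^esub>}"
    proof (intro equalityI subsetI)
      fix y assume "y \<in> {y \<in> carrier B. \<phi> y = \<zero>\<^bsub>A\<^esub>}"
      then have y: "y \<in> carrier B" "\<phi> y = \<zero>\<^bsub>A\<^esub>" by auto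
      then have "y = \<psi> (\<tau> y)" using decomp[OF y(1)] \<delta>c \<tau>(1)[OF y(1)] by (simp add: \<psi>_def)
      then show "y \<in> \<psi> ` carrier (shift A)" using \<tau>(1)[OF y(1)] by (auto simp: shift_def)
    next
      fix y assume "y \<in> \<psi> ` carrier (shift A)"
      then obtain x where x: "x \<in> carrier A" "y = \<delta> \<otimes>\<^bsub>B\<^esub> \<sigma> x" by (auto simp: shift_def \<psi>_def)
      have "\<phi> (\<delta> \<otimes>\<^bsub>B\<^esub> \<sigma> x) = \<zero>\<^bsub>A\<^esub>"
        using \<phi>.mult[OF \<delta>c \<sigma>.closed[OF x(1)]] \<phi>\<sigma>[OF x(1)] x(1) by (simp add: \<phi>\<delta>)
      then show "y \<in> {y \<in> carrier B. \<phi> y = \<zero>\<^bsub>A\<^esub>}" using x \<delta>c by simp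
    qed
    show "\<phi> ` carrier B = carrier A"
    proof (intro equalityI subsetI)
      fix x assume "x \<in> carrier A"
      then show "x \<in> \<phi> ` carrier B" using \<phi>\<sigma>[of x] \<sigma>.closed[of x] by (metis image_eqI)
    qed auto
  qed
  then show ?thesis unfolding A_def B_def \<phi>_def by blast
qed

end

section \<open>The reduced Orlik--Solomon algebra as a retract\<close>

text \<open>This is \<open>translate\<close> with t = e_i: the relations are unchanged, so the
  substitution respects them.\<close>

lemma (in circuit_system) os_shift:
  fixes k :: "'k::field itself"
  assumes i: "i \<in> ground M"
  shows "\<exists>\<rho>. kalg_hom (os_algebra k M) (os_algebra k M) \<rho> \<and>
    (\<forall>s\<in>ground M. \<rho> (os_gen k M s) = os_gen k M s \<ominus>\<^bsub>os_algebra k M\<^esub> os_gen k M i)"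
proof -
  interpret generated "os_algebra k M" "ground M" "os_gen k M" by (rule generated_os)
  interpret anticommuting "os_algebra k M" "ground M" "os_gen k M" by (rule anticommuting_os)
  show ?thesis
  proof (rule os_lift)
    show "anticommuting (os_algebra k M) (ground M) (\<lambda>s. os_gen k M s \<ominus>\<^bsub>os_algebra k M\<^esub> os_gen k M i)"
      by (rule os_anticommuting) (intro homog_minus e_homog i)
    fix ss assume ss: "distinct ss" "set ss \<in> circuits M"
    then show "word_deriv (os_algebra k M)
        (\<lambda>s. os_gen k M s \<ominus>\<^bsub>os_algebra k M\<^esub> os_gen k M i) ss = \<zero>\<^bsub>os_algebra k M\<^esub>"
      using translate[OF e_closed[OF i] r_anti[OF i] r_sq[OF i] circuits_ground[OF ss(2)]]
        os_circuit[of ss k] by simp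
  qed
qed

locale pointed_circuit_system = circuit_system +
  fixes i
  assumes finite_ground: "finite (ground M)" and i: "i \<in> ground M"
begin

lemma sum_zero_vectors_closed:
  "{\<Oplus>\<^bsub>os_algebra k M\<^esub>s\<in>ground M. v s \<odot>\<^bsub>os_algebra k M\<^esub> os_gen k M s | v.
     (\<Sum>s\<in>ground M. v s) = 0} \<subseteq> carrier (os_algebra k M)"
proof -
  interpret generated "os_algebra k M" "ground M" "os_gen k M" by (rule generated_os)
  show ?thesis by (auto intro!: finsum_closed)
qed

lemma reduced_os_galg: "galg (reduced_os_algebra k M)"
proof -
  interpret generated "os_algebra k M" "ground M" "os_gen k M" by (rule generated_os)
  show ?thesis unfolding reduced_os_algebra_def
    by (rule generated_subalgebra_galg[OF sum_zero_vectors_closed])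
qed

lemma reduced_os_simps [simp]:
  shows "x \<oplus>\<^bsub>reduced_os_algebra k M\<^esub> y = x \<oplus>\<^bsub>os_algebra k M\<^esub> y"
    and "x \<otimes>\<^bsub>reduced_os_algebra k M\<^esub> y = x \<otimes>\<^bsub>os_algebra k M\<^esub> y"
    and "c \<odot>\<^bsub>reduced_os_algebra k M\<^esub> x = c \<odot>\<^bsub>os_algebra k M\<^esub> x"
    and "\<one>\<^bsub>reduced_os_algebra k M\<^esub> = \<one>\<^bsub>os_algebra k M\<^esub>"
    and "\<zero>\<^bsub>reduced_os_algebra k M\<^esub> = \<zero>\<^bsub>os_algebra k M\<^esub>"
    and "homog (reduced_os_algebra k M) p =
      homog (os_algebra k M) p \<inter> carrier (reduced_os_algebra k M)"
  by (simp_all add: reduced_os_algebra_def)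

lemma reduced_os_gen:
  fixes k :: "'k::field itself"
  assumes s: "s \<in> ground M"
  shows "os_gen k M s \<ominus>\<^bsub>os_algebra k M\<^esub> os_gen k M i \<in> carrier (reduced_os_algebra k M)"
proof -
  let ?A = "os_algebra k M" and ?e = "os_gen k M"
  interpret generated ?A "ground M" ?e by (rule generated_os)
  \<comment> \<open>A difference of two indicator functions rather than a function with values 1 and
    -1, so that s = i is covered as well.\<close>
  define v where "v t = (if s = t then 1 else 0) - (if i = t then 1 else (0::'k))" for t
  have "(\<Sum>t\<in>ground M. v t) = 0"
    using s i finite_ground by (simp add: v_def sum_subtractf)
  moreover have "(\<Oplus>\<^bsub>?A\<^esub>t\<in>ground M. v t \<odot>\<^bsub>?A\<^esub> ?e t) = ?e s \<ominus>\<^bsub>?A\<^esub> ?e i"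
  proof -
    have "(\<Oplus>\<^bsub>?A\<^esub>t\<in>ground M. v t \<odot>\<^bsub>?A\<^esub> ?e t) = (\<Oplus>\<^bsub>?A\<^esub>t\<in>ground M.
        (if s = t then ?e t else \<zero>\<^bsub>?A\<^esub>) \<oplus>\<^bsub>?A\<^esub> (if i = t then \<ominus>\<^bsub>?A\<^esub> ?e t else \<zero>\<^bsub>?A\<^esub>))"
      by (rule finsum_cong') (auto simp: v_def r_neg)
    also have "\<dots> = (\<Oplus>\<^bsub>?A\<^esub>t\<in>ground M. if s = t then ?e t else \<zero>\<^bsub>?A\<^esub>) \<oplus>\<^bsub>?A\<^esub>
        (\<Oplus>\<^bsub>?A\<^esub>t\<in>ground M. if i = t then \<ominus>\<^bsub>?A\<^esub> ?e t else \<zero>\<^bsub>?A\<^esub>)"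
      by (rule finsum_addf) auto
    also have "\<dots> = ?e s \<oplus>\<^bsub>?A\<^esub> \<ominus>\<^bsub>?A\<^esub> ?e i"
      using s i finite_ground by (subst (1 2) finsum_singleton) auto
    finally show ?thesis by (simp add: a_minus_def)
  qed
  ultimately show ?thesis
    using generated_subalgebra_subring(3)[OF sum_zero_vectors_closed[of k]]
    unfolding reduced_os_algebra_def by blast
qed

text \<open>The elements fixed by \<open>\<rho>\<close> form a subalgebra \<open>F\<close>
  containing the vectors of coordinate sum 0, hence containing the reduced algebra by minimality. In
  the other direction, \<open>\<rho>\<close> turns every word into a product of differences e_s -
  e_i, which are reduced.\<close>

lemma reduced_os_retract:
  fixes k :: "'k::field itself"
  assumes \<rho>: "kalg_hom (os_algebra k M) (os_algebra k M) \<rho>"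
    and gen: "\<And>s. s \<in> ground M \<Longrightarrow> \<rho> (os_gen k M s) = os_gen k M s \<ominus>\<^bsub>os_algebra k M\<^esub> os_gen k M i"
  shows "x \<in> carrier (os_algebra k M) \<Longrightarrow> \<rho> x \<in> carrier (reduced_os_algebra k M)"
    and "x \<in> carrier (reduced_os_algebra k M) \<Longrightarrow> \<rho> x = x"
    and "x \<in> carrier (reduced_os_algebra k M) \<Longrightarrow> x \<in> carrier (os_algebra k M)"
proof -
  let ?A = "os_algebra k M" and ?e = "os_gen k M" and ?R = "reduced_os_algebra k M"
  let ?V = "{\<Oplus>\<^bsub>?A\<^esub>s\<in>ground M. v s \<odot>\<^bsub>?A\<^esub> ?e s | v. (\<Sum>s\<in>ground M. v s) = 0}"
  interpret generated ?A "ground M" ?e by (rule generated_os)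
  interpret \<rho>: kalg_hom ?A ?A \<rho> by (rule \<rho>)
  interpret R: galg ?R by (rule reduced_os_galg)
  define F where "F = {x \<in> carrier ?A. \<rho> x = x}"
  \<comment> \<open>The defect of a linear form under \<open>\<rho>\<close> is its coordinate sum
    times e_i, which explains why exactly the condition of sum 0 occurs.\<close>
  have \<rho>_sum: "\<rho> (\<Oplus>\<^bsub>?A\<^esub>s\<in>G. v s \<odot>\<^bsub>?A\<^esub> ?e s) =
      (\<Oplus>\<^bsub>?A\<^esub>s\<in>G. v s \<odot>\<^bsub>?A\<^esub> ?e s) \<ominus>\<^bsub>?A\<^esub> (\<Sum>s\<in>G. v s) \<odot>\<^bsub>?A\<^esub> ?e i"
    if "finite G" "G \<subseteq> ground M" for G and v :: "'a \<Rightarrow> 'k"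
    using that
  proof (induction G rule: finite_induct)
    case empty
    then show ?case using i by (simp add: a_minus_def)
  next
    case (insert s G)
    then have s: "s \<in> ground M" "G \<subseteq> ground M" by auto
    have c: "(\<Oplus>\<^bsub>?A\<^esub>s\<in>G. v s \<odot>\<^bsub>?A\<^esub> ?e s) \<in> carrier ?A" using s by (intro finsum_closed) auto
    have "(\<Oplus>\<^bsub>?A\<^esub>s\<in>insert s G. v s \<odot>\<^bsub>?A\<^esub> ?e s) =
        v s \<odot>\<^bsub>?A\<^esub> ?e s \<oplus>\<^bsub>?A\<^esub> (\<Oplus>\<^bsub>?A\<^esub>s\<in>G. v s \<odot>\<^bsub>?A\<^esub> ?e s)"
      using s insert.hyps by (intro finsum_insert) auto
    then show ?case using s c insert i
      by (simp add: gen a_minus_def smult_r_distr smult_l_distr minus_add)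
        (simp add: a_ac)
  qed
  have "subring F ?A"
    by (rule subringI) (auto simp: F_def)
  moreover have "c \<odot>\<^bsub>?A\<^esub> x \<in> F" if "x \<in> F" for c x using that by (simp add: F_def)
  moreover have "?V \<subseteq> F"
  proof
    fix x assume x: "x \<in> ?V"
    then obtain v where "x = (\<Oplus>\<^bsub>?A\<^esub>s\<in>ground M. v s \<odot>\<^bsub>?A\<^esub> ?e s)" "(\<Sum>s\<in>ground M. v s) = 0" by blast
    then have "\<rho> x = x \<ominus>\<^bsub>?A\<^esub> 0 \<odot>\<^bsub>?A\<^esub> ?e i"
      using \<rho>_sum[OF finite_ground subset_refl, of v] by simp
    then show "x \<in> F" using x sum_zero_vectors_closed[of k] i by (auto simp: F_def a_minus_def)
  qed
  ultimately have "carrier ?R \<subseteq> F"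
    unfolding reduced_os_algebra_def by (rule generated_subalgebra_minimal)
  then show "x \<in> carrier ?R \<Longrightarrow> \<rho> x = x" and "x \<in> carrier ?R \<Longrightarrow> x \<in> carrier ?A"
    by (auto simp: F_def)
  assume "x \<in> carrier ?A"
  then show "\<rho> x \<in> carrier ?R"
  proof (induction rule: words_induct)
    case (word ss)
    then have "\<rho> (word ?A ?e ss) = word ?A (\<lambda>s. \<rho> (?e s)) ss" by (intro \<rho>.hom_word) auto
    also have "\<dots> = word ?R (\<lambda>s. \<rho> (?e s)) ss" by (induction ss) simp_all
    also have "\<dots> \<in> carrier ?R"
      using word by (intro R.word_closed) (auto simp: gen intro!: reduced_os_gen)
    finally show ?case .
  next
    case zero
    show ?case using R.zero_closed by simp
  next
    case (add x y)
    then show ?case using R.a_closed[of "\<rho> x" "\<rho> y"] by simp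
  next
    case (smult c x)
    then show ?case using R.smult_closed[of "\<rho> x" c] by simp
  qed
qed

end

text \<open>Fact \<open>1\<close> moves one generator past y; induction on words then accumulates
  the Koszul sign. This sign is the one built into the tensor product, so multiplying two
  commuting-up-to-sign images is multiplicative.\<close>

lemma graded_commutative:
  assumes "generated A S e" "anticommuting A S e" and x: "x \<in> homog A p" and y: "y \<in> homog A q"
  shows "x \<otimes>\<^bsub>A\<^esub> y = (- 1) ^ (p * q) \<odot>\<^bsub>A\<^esub> (y \<otimes>\<^bsub>A\<^esub> x)"
proof -
  interpret generated A S e by fact
  interpret anticommuting A S e by fact
  have yc: "y \<in> carrier A" using y homog_carrier by blast
  have 1: "e s \<otimes>\<^bsub>A\<^esub> y = (- 1) ^ q \<odot>\<^bsub>A\<^esub> (y \<otimes>\<^bsub>A\<^esub> e s)" if s: "s \<in> S" for s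
    using y
  proof (induction rule: homog_induct)
    case (word ss)
    then show ?case using anti_word[OF e_closed[OF s] r_anti[OF s]] by simp
  next
    case (add x y)
    then show ?case using homog_carrier s by (simp add: l_distr r_distr smult_r_distr)
  next
    case (smult c x)
    then show ?case using homog_carrier s by (simp add: mult.commute)
  qed (use s in simp)
  show ?thesis using x
  proof (induction rule: homog_induct)
    case (word ss)
    have "w ss \<otimes>\<^bsub>A\<^esub> y = (- 1) ^ (length ss * q) \<odot>\<^bsub>A\<^esub> (y \<otimes>\<^bsub>A\<^esub> w ss)"
      using word(1)
    proof (induction ss)
      case Nil
      then show ?case using yc by simp
    next
      case (Cons s ss)
      then have s: "s \<in> S" "set ss \<subseteq> S" by auto
      have "(e s \<otimes>\<^bsub>A\<^esub> w ss) \<otimes>\<^bsub>A\<^esub> y = e s \<otimes>\<^bsub>A\<^esub> (w ss \<otimes>\<^bsub>A\<^esub> y)"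
        using s yc by (simp add: m_assoc)
      also have "\<dots> = (- 1) ^ (length ss * q) \<odot>\<^bsub>A\<^esub> ((e s \<otimes>\<^bsub>A\<^esub> y) \<otimes>\<^bsub>A\<^esub> w ss)"
        using s yc Cons.IH by (simp add: m_assoc)
      also have "\<dots> = (- 1) ^ (length (s # ss) * q) \<odot>\<^bsub>A\<^esub> (y \<otimes>\<^bsub>A\<^esub> (e s \<otimes>\<^bsub>A\<^esub> w ss))"
        using s yc 1 by (simp add: m_assoc power_add mult.commute)
      finally show ?case by simp
    qed
    then show ?case using word by simp
  next
    case (add u v)
    then show ?case using homog_carrier yc by (simp add: l_distr r_distr smult_r_distr)
  next
    case (smult c u)
    then show ?case using homog_carrier yc by (simp add: mult.commute)
  qed (use yc in simp)
qed

section \<open>Tensor products\<close>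

locale tensor = A: galg A + B: galg B
  for A :: "('k::field, 'x) graded_algebra" and B :: "('k, 'y) graded_algebra"
begin

text \<open>The cocycle identity for the Koszul sign is the equality of exponents q p' + (q + q')
  p'' = q' p'' + q (p' + p'').\<close>

lemma based_free_tensor:
  "based {(p, a, q, b). a \<in> homog A p \<and> b \<in> homog B q}
     (\<lambda>(p, a, q, b) (p', a', q', b'). (p + p', a \<otimes>\<^bsub>A\<^esub> a', q + q', b \<otimes>\<^bsub>B\<^esub> b'))
     (\<lambda>(p, a, q, b) (p', a', q', b'). (- 1 :: 'k) ^ (q * p'))
     (0, \<one>\<^bsub>A\<^esub>, 0, \<one>\<^bsub>B\<^esub>)
     (\<lambda>(p, a, q, b). p + q)"
  by unfold_locales
    (auto simp: A.m_assoc B.m_assoc A.homog_carrier B.homog_carrier algebra_simps power_add)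

sublocale F: based "{(p, a, q, b). a \<in> homog A p \<and> b \<in> homog B q}"
  "\<lambda>(p, a, q, b) (p', a', q', b'). (p + p', a \<otimes>\<^bsub>A\<^esub> a', q + q', b \<otimes>\<^bsub>B\<^esub> b')"
  "\<lambda>(p, a, q, b) (p', a', q', b'). (- 1 :: 'k) ^ (q * p')"
  "(0, \<one>\<^bsub>A\<^esub>, 0, \<one>\<^bsub>B\<^esub>)"
  "\<lambda>(p, a, q, b). p + q"
  by (rule based_free_tensor)

abbreviation "FT \<equiv> free_tensor A B"

lemma free_tensor_eq: "FT = F.X"
  by (simp add: free_tensor_def)

lemma free_simps:
  shows "x \<oplus>\<^bsub>FT\<^esub> y = (\<lambda>w. x w + y w)" "c \<odot>\<^bsub>FT\<^esub> x = (\<lambda>w. c * x w)"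
    "\<one>\<^bsub>FT\<^esub> = basis_vec (0, \<one>\<^bsub>A\<^esub>, 0, \<one>\<^bsub>B\<^esub>)"
  unfolding free_tensor_eq by (rule F.X_simps)+

lemma free_galg: "galg FT"
  unfolding free_tensor_eq by (rule F.galg)

abbreviation bv where "bv p a q b \<equiv> (basis_vec (p, a, q, b) :: nat \<times> 'x \<times> nat \<times> 'y \<Rightarrow> 'k)"

lemma bv_homog: "\<lbrakk>a \<in> homog A p; b \<in> homog B q\<rbrakk> \<Longrightarrow> bv p a q b \<in> homog FT (p + q)"
  unfolding free_tensor_eq by (rule F.basis_vec_homog) auto

lemma bv_carrier: "\<lbrakk>a \<in> homog A p; b \<in> homog B q\<rbrakk> \<Longrightarrow> bv p a q b \<in> carrier FT"
  using bv_homog galg.homog_carrier[OF free_galg] by blast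

text \<open>The bilinearity relations are written with pointwise differences of functions. This and
  the next lemmas restate them with the operations of the free algebra, through which homomorphisms
  can be pushed.\<close>

lemma free_diff:
  "\<lbrakk>x \<in> carrier FT; y \<in> carrier FT\<rbrakk> \<Longrightarrow>
    x \<ominus>\<^bsub>FT\<^esub> y = (\<lambda>w. x w - y w)"
proof -
  interpret ft: galg FT by (rule free_galg)
  assume "x \<in> carrier FT" "y \<in> carrier FT"
  then have "x \<ominus>\<^bsub>FT\<^esub> y = x \<oplus>\<^bsub>FT\<^esub> ((- 1) \<odot>\<^bsub>FT\<^esub> y)"
    by (simp add: a_minus_def)
  then show ?thesis by (simp add: free_simps)
qed

lemma add_left_relation:
  assumes "a \<in> homog A p" "a' \<in> homog A p" "b \<in> homog B q"
  shows "bv p (a \<oplus>\<^bsub>A\<^esub> a') q b \<ominus>\<^bsub>FT\<^esub> bv p a q b \<ominus>\<^bsub>FT\<^esub> bv p a' q b =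
    (\<lambda>w. bv p (a \<oplus>\<^bsub>A\<^esub> a') q b w - bv p a q b w - bv p a' q b w)"
proof -
  interpret ft: galg FT by (rule free_galg)
  have "bv p (a \<oplus>\<^bsub>A\<^esub> a') q b \<ominus>\<^bsub>FT\<^esub> bv p a q b \<in> carrier FT"
    using assms by (simp add: bv_carrier A.homog_add)
  from free_diff[OF this bv_carrier[OF assms(2,3)]] show ?thesis
    using assms
    by (simp add: free_diff bv_carrier A.homog_add)
qed

lemma add_right_relation:
  assumes "a \<in> homog A p" "b \<in> homog B q" "b' \<in> homog B q"
  shows "bv p a q (b \<oplus>\<^bsub>B\<^esub> b') \<ominus>\<^bsub>FT\<^esub> bv p a q b \<ominus>\<^bsub>FT\<^esub> bv p a q b' =
    (\<lambda>w. bv p a q (b \<oplus>\<^bsub>B\<^esub> b') w - bv p a q b w - bv p a q b' w)"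
proof -
  interpret ft: galg FT by (rule free_galg)
  have "bv p a q (b \<oplus>\<^bsub>B\<^esub> b') \<ominus>\<^bsub>FT\<^esub> bv p a q b \<in> carrier FT"
    using assms by (simp add: bv_carrier B.homog_add)
  from free_diff[OF this bv_carrier[OF assms(1,3)]] show ?thesis
    using assms
    by (simp add: free_diff bv_carrier B.homog_add)
qed

lemma smult_relation:
  assumes "a \<in> homog A p" "b \<in> homog B q"
  shows "bv p (c \<odot>\<^bsub>A\<^esub> a) q b \<ominus>\<^bsub>FT\<^esub> c \<odot>\<^bsub>FT\<^esub> bv p a q b =
      (\<lambda>w. bv p (c \<odot>\<^bsub>A\<^esub> a) q b w - c * bv p a q b w)"
    and "bv p a q (c \<odot>\<^bsub>B\<^esub> b) \<ominus>\<^bsub>FT\<^esub> c \<odot>\<^bsub>FT\<^esub> bv p a q b =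
      (\<lambda>w. bv p a q (c \<odot>\<^bsub>B\<^esub> b) w - c * bv p a q b w)"
proof -
  interpret ft: galg FT by (rule free_galg)
  show "bv p (c \<odot>\<^bsub>A\<^esub> a) q b \<ominus>\<^bsub>FT\<^esub> c \<odot>\<^bsub>FT\<^esub> bv p a q b =
      (\<lambda>w. bv p (c \<odot>\<^bsub>A\<^esub> a) q b w - c * bv p a q b w)"
    using assms by (subst free_diff) (simp_all add: bv_carrier A.homog_smult, simp add: free_simps(2))
  show "bv p a q (c \<odot>\<^bsub>B\<^esub> b) \<ominus>\<^bsub>FT\<^esub> c \<odot>\<^bsub>FT\<^esub> bv p a q b =
      (\<lambda>w. bv p a q (c \<odot>\<^bsub>B\<^esub> b) w - c * bv p a q b w)"
    using assms by (subst free_diff) (simp_all add: bv_carrier B.homog_smult, simp add: free_simps(2))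
qed

lemma relationI:
  shows "\<lbrakk>a \<in> homog A p; a' \<in> homog A p; b \<in> homog B q\<rbrakk> \<Longrightarrow>
      bv p (a \<oplus>\<^bsub>A\<^esub> a') q b \<ominus>\<^bsub>FT\<^esub> bv p a q b \<ominus>\<^bsub>FT\<^esub> bv p a' q b
        \<in> bilinearity_relations A B"
    and "\<lbrakk>a \<in> homog A p; b \<in> homog B q; b' \<in> homog B q\<rbrakk> \<Longrightarrow>
      bv p a q (b \<oplus>\<^bsub>B\<^esub> b') \<ominus>\<^bsub>FT\<^esub> bv p a q b \<ominus>\<^bsub>FT\<^esub> bv p a q b'
        \<in> bilinearity_relations A B"
    and "\<lbrakk>a \<in> homog A p; b \<in> homog B q\<rbrakk> \<Longrightarrow>
      bv p (c \<odot>\<^bsub>A\<^esub> a) q b \<ominus>\<^bsub>FT\<^esub> c \<odot>\<^bsub>FT\<^esub> bv p a q b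
        \<in> bilinearity_relations A B"
    and "\<lbrakk>a \<in> homog A p; b \<in> homog B q\<rbrakk> \<Longrightarrow>
      bv p a q (c \<odot>\<^bsub>B\<^esub> b) \<ominus>\<^bsub>FT\<^esub> c \<odot>\<^bsub>FT\<^esub> bv p a q b
        \<in> bilinearity_relations A B"
  by (simp_all only: add_left_relation add_right_relation smult_relation)
    (unfold bilinearity_relations_def, blast+)

lemma relation_cases [consumes 1, case_names add_left add_right smult_left smult_right]:
  assumes "x \<in> bilinearity_relations A B"
  obtains p a a' q b where "a \<in> homog A p" "a' \<in> homog A p" "b \<in> homog B q"
      "x = bv p (a \<oplus>\<^bsub>A\<^esub> a') q b \<ominus>\<^bsub>FT\<^esub> bv p a q b \<ominus>\<^bsub>FT\<^esub> bv p a' q b"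
  | p a q b b' where "a \<in> homog A p" "b \<in> homog B q" "b' \<in> homog B q"
      "x = bv p a q (b \<oplus>\<^bsub>B\<^esub> b') \<ominus>\<^bsub>FT\<^esub> bv p a q b \<ominus>\<^bsub>FT\<^esub> bv p a q b'"
  | p c a q b where "a \<in> homog A p" "b \<in> homog B q"
      "x = bv p (c \<odot>\<^bsub>A\<^esub> a) q b \<ominus>\<^bsub>FT\<^esub> c \<odot>\<^bsub>FT\<^esub> bv p a q b"
  | p c a q b where "a \<in> homog A p" "b \<in> homog B q"
      "x = bv p a q (c \<odot>\<^bsub>B\<^esub> b) \<ominus>\<^bsub>FT\<^esub> c \<odot>\<^bsub>FT\<^esub> bv p a q b"
proof -
  show thesis
    using assms unfolding bilinearity_relations_def
  proof (elim UnE CollectE exE conjE)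
    fix p a a' q b
    assume *: "a \<in> homog A p" "a' \<in> homog A p" "b \<in> homog B q"
      and x: "x = (\<lambda>w. bv p (a \<oplus>\<^bsub>A\<^esub> a') q b w - bv p a q b w - bv p a' q b w)"
    show thesis by (rule that(1)[OF *]) (simp only: x add_left_relation[OF *])
  next
    fix p a q b b'
    assume *: "a \<in> homog A p" "b \<in> homog B q" "b' \<in> homog B q"
      and x: "x = (\<lambda>w. bv p a q (b \<oplus>\<^bsub>B\<^esub> b') w - bv p a q b w - bv p a q b' w)"
    show thesis by (rule that(2)[OF *]) (simp only: x add_right_relation[OF *])
  next
    fix p c a q b
    assume *: "a \<in> homog A p" "b \<in> homog B q"
      and x: "x = (\<lambda>w. bv p (c \<odot>\<^bsub>A\<^esub> a) q b w - c * bv p a q b w)"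
    show thesis by (rule that(3)[OF *]) (simp only: x smult_relation(1)[OF *])
  next
    fix p c a q b
    assume *: "a \<in> homog A p" "b \<in> homog B q"
      and x: "x = (\<lambda>w. bv p a q (c \<odot>\<^bsub>B\<^esub> b) w - c * bv p a q b w)"
    show thesis by (rule that(4)[OF *]) (simp only: x smult_relation(2)[OF *])
  qed
qed

lemma relations_closed: "bilinearity_relations A B \<subseteq> carrier FT"
proof
  interpret ft: galg FT by (rule free_galg)
  fix x assume "x \<in> bilinearity_relations A B"
  then show "x \<in> carrier FT"
    by (cases rule: relation_cases)
      (simp_all add: bv_carrier A.homog_add B.homog_add A.homog_smult B.homog_smult)
qed

sublocale I: kalg_ideal FT "Idl\<^bsub>FT\<^esub> (bilinearity_relations A B)"
proof -
  interpret ft: galg FT by (rule free_galg)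
  show "kalg_ideal FT (Idl\<^bsub>FT\<^esub> (bilinearity_relations A B))"
    by (rule ft.kalg_ideal_genideal[OF relations_closed])
qed

section \<open>The tensor product as a quotient, and its pure tensors\<close>

abbreviation "T \<equiv> tensor_product A B"

lemma T_eq: "T = I.Q" by (simp add: tensor_product_def)

text \<open>The pure tensor, with the degrees kept as arguments; the sign in \<open>ten_mult\<close>
  is read off from them.\<close>

definition ten where "ten p a q b = I.proj (bv p a q b)"

lemma galg_T: "galg T"
  unfolding T_eq by (rule galg.galg_quot[OF free_galg I.I.is_ideal])

lemma proj_hom: "kalg_hom FT T I.proj"
  unfolding T_eq by (rule I.kalg_hom_proj)

sublocale T: galg T by (rule galg_T)

lemma ten_homog: "\<lbrakk>a \<in> homog A p; b \<in> homog B q\<rbrakk> \<Longrightarrow> ten p a q b \<in> homog T (p + q)"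
  using bv_homog[of a p b q] by (auto simp: ten_def T_eq I.quot_simps)

lemma ten_closed: "\<lbrakk>a \<in> homog A p; b \<in> homog B q\<rbrakk> \<Longrightarrow> ten p a q b \<in> carrier T"
  using ten_homog T.homog_carrier by blast

lemma ten_one: "\<one>\<^bsub>T\<^esub> = ten 0 \<one>\<^bsub>A\<^esub> 0 \<one>\<^bsub>B\<^esub>"
  unfolding ten_def T_eq I.quot_simps free_simps ..

lemma ten_mult:
  assumes "a \<in> homog A p" "b \<in> homog B q" "a' \<in> homog A p'" "b' \<in> homog B q'"
  shows "ten p a q b \<otimes>\<^bsub>T\<^esub> ten p' a' q' b' =
    (- 1) ^ (q * p') \<odot>\<^bsub>T\<^esub> ten (p + p') (a \<otimes>\<^bsub>A\<^esub> a') (q + q') (b \<otimes>\<^bsub>B\<^esub> b')"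
proof -
  have "bv p a q b \<otimes>\<^bsub>FT\<^esub> bv p' a' q' b' =
      (- 1) ^ (q * p') \<odot>\<^bsub>FT\<^esub> bv (p + p') (a \<otimes>\<^bsub>A\<^esub> a') (q + q') (b \<otimes>\<^bsub>B\<^esub> b')"
    unfolding free_tensor_eq using assms F.basis_vec_mult[of "(p, a, q, b)" "(p', a', q', b')"] by simp
  then show ?thesis
    using I.quot_simps(3)[OF bv_carrier[OF assms(1,2)] bv_carrier[OF assms(3,4)]]
      I.quot_simps(6)[OF bv_carrier[OF A.homog_mult[OF assms(1,3)] B.homog_mult[OF assms(2,4)]]]
    by (simp add: ten_def T_eq)
qed

lemma proj_relation: "x \<in> bilinearity_relations A B \<Longrightarrow> I.proj x = \<zero>\<^bsub>T\<^esub>"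
proof -
  assume x: "x \<in> bilinearity_relations A B"
  have "x \<in> Idl\<^bsub>FT\<^esub> (bilinearity_relations A B)"
    using x I.genideal_self[OF relations_closed] by blast
  then show ?thesis using I.proj_zero_iff x relations_closed by (auto simp: T_eq)
qed

lemma ten_add_left:
  assumes "a \<in> homog A p" "a' \<in> homog A p" "b \<in> homog B q"
  shows "ten p (a \<oplus>\<^bsub>A\<^esub> a') q b = ten p a q b \<oplus>\<^bsub>T\<^esub> ten p a' q b"
proof -
  interpret pr: kalg_hom FT T I.proj by (rule proj_hom)
  have c: "bv p (a \<oplus>\<^bsub>A\<^esub> a') q b \<in> carrier FT" "bv p a q b \<in> carrier FT"
    "bv p a' q b \<in> carrier FT"
    using assms by (auto intro!: bv_carrier A.homog_add)
  have "bv p (a \<oplus>\<^bsub>A\<^esub> a') q b \<ominus>\<^bsub>FT\<^esub> bv p a q b \<ominus>\<^bsub>FT\<^esub> bv p a' q b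
      \<in> bilinearity_relations A B"
    by (intro relationI assms)
  then have "ten p (a \<oplus>\<^bsub>A\<^esub> a') q b \<ominus>\<^bsub>T\<^esub> ten p a q b \<ominus>\<^bsub>T\<^esub> ten p a' q b = \<zero>\<^bsub>T\<^esub>"
    using c by (auto simp: ten_def dest!: proj_relation)
  then have "ten p (a \<oplus>\<^bsub>A\<^esub> a') q b \<ominus>\<^bsub>T\<^esub> (ten p a q b \<oplus>\<^bsub>T\<^esub> ten p a' q b) = \<zero>\<^bsub>T\<^esub>"
    using assms ten_closed A.homog_add by (simp add: a_minus_def T.minus_add T.a_assoc)
  then show ?thesis using assms ten_closed A.homog_add T.r_right_minus_eq by simp
qed

lemma ten_add_right:
  assumes "a \<in> homog A p" "b \<in> homog B q" "b' \<in> homog B q"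
  shows "ten p a q (b \<oplus>\<^bsub>B\<^esub> b') = ten p a q b \<oplus>\<^bsub>T\<^esub> ten p a q b'"
proof -
  interpret pr: kalg_hom FT T I.proj by (rule proj_hom)
  have c: "bv p a q (b \<oplus>\<^bsub>B\<^esub> b') \<in> carrier FT" "bv p a q b \<in> carrier FT"
    "bv p a q b' \<in> carrier FT"
    using assms by (auto intro!: bv_carrier B.homog_add)
  have "bv p a q (b \<oplus>\<^bsub>B\<^esub> b') \<ominus>\<^bsub>FT\<^esub> bv p a q b \<ominus>\<^bsub>FT\<^esub> bv p a q b'
      \<in> bilinearity_relations A B"
    by (intro relationI assms)
  then have "ten p a q (b \<oplus>\<^bsub>B\<^esub> b') \<ominus>\<^bsub>T\<^esub> ten p a q b \<ominus>\<^bsub>T\<^esub> ten p a q b' = \<zero>\<^bsub>T\<^esub>"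
    using c by (auto simp: ten_def dest!: proj_relation)
  then have "ten p a q (b \<oplus>\<^bsub>B\<^esub> b') \<ominus>\<^bsub>T\<^esub> (ten p a q b \<oplus>\<^bsub>T\<^esub> ten p a q b') = \<zero>\<^bsub>T\<^esub>"
    using assms ten_closed B.homog_add by (simp add: a_minus_def T.minus_add T.a_assoc)
  then show ?thesis using assms ten_closed B.homog_add T.r_right_minus_eq by simp
qed

lemma ten_smult:
  assumes "a \<in> homog A p" "b \<in> homog B q"
  shows "ten p (c \<odot>\<^bsub>A\<^esub> a) q b = c \<odot>\<^bsub>T\<^esub> ten p a q b"
    and "ten p a q (c \<odot>\<^bsub>B\<^esub> b) = c \<odot>\<^bsub>T\<^esub> ten p a q b"
proof -
  interpret pr: kalg_hom FT T I.proj by (rule proj_hom)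
  have c: "bv p (c \<odot>\<^bsub>A\<^esub> a) q b \<in> carrier FT" "bv p a q b \<in> carrier FT"
    "bv p a q (c \<odot>\<^bsub>B\<^esub> b) \<in> carrier FT"
    using assms by (auto intro!: bv_carrier A.homog_smult B.homog_smult)
  have "bv p (c \<odot>\<^bsub>A\<^esub> a) q b \<ominus>\<^bsub>FT\<^esub> c \<odot>\<^bsub>FT\<^esub> bv p a q b
      \<in> bilinearity_relations A B"
    by (intro relationI assms)
  then have "ten p (c \<odot>\<^bsub>A\<^esub> a) q b \<ominus>\<^bsub>T\<^esub> c \<odot>\<^bsub>T\<^esub> ten p a q b = \<zero>\<^bsub>T\<^esub>"
    using c by (auto simp: ten_def dest!: proj_relation)
  then show "ten p (c \<odot>\<^bsub>A\<^esub> a) q b = c \<odot>\<^bsub>T\<^esub> ten p a q b"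
    using assms ten_closed A.homog_smult T.r_right_minus_eq by simp
  have "bv p a q (c \<odot>\<^bsub>B\<^esub> b) \<ominus>\<^bsub>FT\<^esub> c \<odot>\<^bsub>FT\<^esub> bv p a q b
      \<in> bilinearity_relations A B"
    by (intro relationI assms)
  then have "ten p a q (c \<odot>\<^bsub>B\<^esub> b) \<ominus>\<^bsub>T\<^esub> c \<odot>\<^bsub>T\<^esub> ten p a q b = \<zero>\<^bsub>T\<^esub>"
    using c by (auto simp: ten_def dest!: proj_relation)
  then show "ten p a q (c \<odot>\<^bsub>B\<^esub> b) = c \<odot>\<^bsub>T\<^esub> ten p a q b"
    using assms ten_closed B.homog_smult T.r_right_minus_eq by simp
qed

lemma T_span:
  shows "carrier T = lspan T {ten p a q b | p a q b. a \<in> homog A p \<and> b \<in> homog B q}"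
    and "homog T n = lspan T {ten p a q b | p a q b. a \<in> homog A p \<and> b \<in> homog B q \<and> p + q = n}"
proof -
  interpret pr: kalg_hom FT T I.proj by (rule proj_hom)
  have im: "I.proj ` lspan FT (basis_vec ` L) = lspan T ((\<lambda>x. I.proj (basis_vec x)) ` L)"
    if "L \<subseteq> {(p, a, q, b). a \<in> homog A p \<and> b \<in> homog B q}" for L
  proof -
    have "basis_vec x \<in> carrier FT" if "x \<in> L" for x
      using \<open>L \<subseteq> _\<close> that by (cases x) (auto intro: bv_carrier)
    then have "basis_vec ` L \<subseteq> carrier FT" by blast
    from lspan_linear_image[OF I.kalg_axioms T.kalg_axioms pr.linear this]
    show ?thesis by (simp only: image_image)
  qed
  have carr: "carrier FT = lspan FT
      (basis_vec ` {(p, a, q, b). a \<in> homog A p \<and> b \<in> homog B q})"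
    unfolding free_tensor_eq by (rule F.carrier_span)
  have hom: "homog FT n = lspan FT
      (basis_vec ` {x \<in> {(p, a, q, b). a \<in> homog A p \<and> b \<in> homog B q}.
        (\<lambda>(p, a, q, b). p + q) x = n})"
    unfolding free_tensor_eq by (rule F.homog_span)
  have "(\<lambda>x. I.proj (basis_vec x)) ` {(p, a, q, b). a \<in> homog A p \<and> b \<in> homog B q} =
      {ten p a q b | p a q b. a \<in> homog A p \<and> b \<in> homog B q}"
    by (auto simp: ten_def image_iff)
  then show "carrier T = lspan T {ten p a q b | p a q b. a \<in> homog A p \<and> b \<in> homog B q}"
    using im[OF subset_refl] carr by (simp only: T_eq I.quot_simps(1))
  have "(\<lambda>x. I.proj (basis_vec x)) ` {x \<in> {(p, a, q, b). a \<in> homog A p \<and> b \<in> homog B q}.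
        (\<lambda>(p, a, q, b). p + q) x = n} =
      {ten p a q b | p a q b. a \<in> homog A p \<and> b \<in> homog B q \<and> p + q = n}"
    by (auto simp: ten_def image_iff)
  then show "homog T n = lspan T {ten p a q b | p a q b. a \<in> homog A p \<and> b \<in> homog B q \<and> p + q = n}"
    using im[of "{x \<in> {(p, a, q, b). a \<in> homog A p \<and> b \<in> homog B q}.
        (\<lambda>(p, a, q, b). p + q) x = n}"] hom
    by (simp only: T_eq I.quot_simps(7)) auto
qed

text \<open>\<open>\<Phi>\<close> does not see degrees although the symbols do, so the sign in
  \<open>mult\<close> has to be correct for every choice of degrees that contain the given
  elements.\<close>

lemma tensor_lift:
  assumes R: "kalg R"
    and \<Phi>: "\<And>p a q b. \<lbrakk>a \<in> homog A p; b \<in> homog B q\<rbrakk> \<Longrightarrow> \<Phi> a b \<in> carrier R"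
    and add_l: "\<And>p a a' q b. \<lbrakk>a \<in> homog A p; a' \<in> homog A p; b \<in> homog B q\<rbrakk> \<Longrightarrow>
      \<Phi> (a \<oplus>\<^bsub>A\<^esub> a') b = \<Phi> a b \<oplus>\<^bsub>R\<^esub> \<Phi> a' b"
    and add_r: "\<And>p a q b b'. \<lbrakk>a \<in> homog A p; b \<in> homog B q; b' \<in> homog B q\<rbrakk> \<Longrightarrow>
      \<Phi> a (b \<oplus>\<^bsub>B\<^esub> b') = \<Phi> a b \<oplus>\<^bsub>R\<^esub> \<Phi> a b'"
    and smult_l: "\<And>p a q b c. \<lbrakk>a \<in> homog A p; b \<in> homog B q\<rbrakk> \<Longrightarrow> \<Phi> (c \<odot>\<^bsub>A\<^esub> a) b = c \<odot>\<^bsub>R\<^esub> \<Phi> a b"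
    and smult_r: "\<And>p a q b c. \<lbrakk>a \<in> homog A p; b \<in> homog B q\<rbrakk> \<Longrightarrow> \<Phi> a (c \<odot>\<^bsub>B\<^esub> b) = c \<odot>\<^bsub>R\<^esub> \<Phi> a b"
    and mult: "\<And>p a q b p' a' q' b'. \<lbrakk>a \<in> homog A p; b \<in> homog B q; a' \<in> homog A p'; b' \<in> homog B q'\<rbrakk> \<Longrightarrow>
      \<Phi> a b \<otimes>\<^bsub>R\<^esub> \<Phi> a' b' = (- 1) ^ (q * p') \<odot>\<^bsub>R\<^esub> \<Phi> (a \<otimes>\<^bsub>A\<^esub> a') (b \<otimes>\<^bsub>B\<^esub> b')"
    and one: "\<Phi> \<one>\<^bsub>A\<^esub> \<one>\<^bsub>B\<^esub> = \<one>\<^bsub>R\<^esub>"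
  shows "\<exists>h. kalg_hom T R h \<and>
    (\<forall>p a q b. a \<in> homog A p \<longrightarrow> b \<in> homog B q \<longrightarrow> h (ten p a q b) = \<Phi> a b)"
proof -
  interpret R: kalg R by fact
  have "\<exists>h. kalg_hom F.X R h \<and> (\<forall>x\<in>{(p, a, q, b). a \<in> homog A p \<and> b \<in> homog B q}.
      h (basis_vec x) = (case x of (p, a, q, b) \<Rightarrow> \<Phi> a b))"
    by (rule F.extend_hom[OF R]) (auto simp: mult one intro: \<Phi>)
  then obtain h where h: "kalg_hom FT R h"
    and hb: "\<And>p a q b. \<lbrakk>a \<in> homog A p; b \<in> homog B q\<rbrakk> \<Longrightarrow> h (bv p a q b) = \<Phi> a b"
    unfolding free_tensor_eq by fastforce
  interpret h: kalg_hom FT R h by (rule h)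
  have rel: "h x = \<zero>\<^bsub>R\<^esub>" if "x \<in> bilinearity_relations A B" for x
  proof -
    have cancel: "(u \<oplus>\<^bsub>R\<^esub> v) \<ominus>\<^bsub>R\<^esub> u \<ominus>\<^bsub>R\<^esub> v = \<zero>\<^bsub>R\<^esub>" if "u \<in> carrier R" "v \<in> carrier R" for u v
    proof -
      have "(u \<oplus>\<^bsub>R\<^esub> v) \<ominus>\<^bsub>R\<^esub> u \<ominus>\<^bsub>R\<^esub> v = (u \<oplus>\<^bsub>R\<^esub> v) \<ominus>\<^bsub>R\<^esub> (u \<oplus>\<^bsub>R\<^esub> v)"
        using that by (simp add: a_minus_def R.a_assoc R.minus_add)
      then show ?thesis using that R.r_right_minus_eq by simp
    qed
    show ?thesis using that
      by (cases rule: relation_cases)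
        (simp_all add: hb bv_carrier add_l add_r smult_l smult_r A.homog_add B.homog_add
          A.homog_smult B.homog_smult \<Phi> cancel R.r_right_minus_eq)
  qed
  have "h x = \<zero>\<^bsub>R\<^esub>" if "x \<in> Idl\<^bsub>FT\<^esub> (bilinearity_relations A B)" for x
    by (rule h.kernel_genideal[OF relations_closed rel that])
  then obtain g where g: "kalg_hom T R g" "\<And>x. x \<in> carrier FT \<Longrightarrow> g (I.proj x) = h x"
    using I.factor[OF h] unfolding T_eq by blast
  then show ?thesis by (intro exI[of _ g]) (auto simp: ten_def hb bv_carrier)
qed

end

section \<open>The tensor product decomposition\<close>

text \<open>A homomorphism given degree by degree. The maps a -> a \<otimes> 1 and b -> 1 \<otimes>
  b arise in this form because a pure tensor records the degree of its factors; they are not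
  assembled into maps on the whole algebra.\<close>

locale graded_map = A: galg A + T: kalg T
  for A :: "('k::field, 'x) graded_algebra" and T :: "('k, 'y) graded_algebra" +
  fixes J :: "nat \<Rightarrow> 'x \<Rightarrow> 'y"
  assumes J_closed: "a \<in> homog A p \<Longrightarrow> J p a \<in> carrier T"
    and J_add: "\<lbrakk>a \<in> homog A p; b \<in> homog A p\<rbrakk> \<Longrightarrow> J p (a \<oplus>\<^bsub>A\<^esub> b) = J p a \<oplus>\<^bsub>T\<^esub> J p b"
    and J_smult: "a \<in> homog A p \<Longrightarrow> J p (c \<odot>\<^bsub>A\<^esub> a) = c \<odot>\<^bsub>T\<^esub> J p a"
    and J_mult: "\<lbrakk>a \<in> homog A p; b \<in> homog A q\<rbrakk> \<Longrightarrow> J p a \<otimes>\<^bsub>T\<^esub> J q b = J (p + q) (a \<otimes>\<^bsub>A\<^esub> b)"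
    and J_one: "J 0 \<one>\<^bsub>A\<^esub> = \<one>\<^bsub>T\<^esub>"
begin

lemma J_zero: "J p \<zero>\<^bsub>A\<^esub> = \<zero>\<^bsub>T\<^esub>"
  using J_smult[of "\<zero>\<^bsub>A\<^esub>" p 0] J_closed[of "\<zero>\<^bsub>A\<^esub>" p] by simp

lemma J_uminus: "a \<in> homog A p \<Longrightarrow> J p (\<ominus>\<^bsub>A\<^esub> a) = \<ominus>\<^bsub>T\<^esub> J p a"
  using J_smult[of a p "- 1"] J_closed[of a p] A.homog_carrier[of a p] by simp

lemma J_minus:
  assumes "a \<in> homog A p" "b \<in> homog A p"
  shows "J p (a \<ominus>\<^bsub>A\<^esub> b) = J p a \<ominus>\<^bsub>T\<^esub> J p b"
proof -
  have "\<ominus>\<^bsub>A\<^esub> b \<in> homog A p"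
    using A.homog_smult[OF assms(2), of "- 1"] A.homog_carrier[OF assms(2)] by simp
  then show ?thesis using assms by (simp add: a_minus_def J_add J_uminus)
qed

lemma J_word:
  assumes "\<And>s. s \<in> set ss \<Longrightarrow> u s \<in> homog A 1"
  shows "J (length ss) (word A u ss) = word T (\<lambda>s. J 1 (u s)) ss"
  using assms
proof (induction ss)
  case (Cons s ss)
  then have "word A u ss \<in> homog A (length ss)" by (intro A.word_homog) auto
  then show ?case using Cons J_mult[of "u s" 1 "word A u ss" "length ss"] by simp
qed (simp add: J_one)

lemma J_word_deriv:
  assumes "\<And>s. s \<in> set ss \<Longrightarrow> u s \<in> homog A 1"
  shows "J (length ss - 1) (word_deriv A u ss) = word_deriv T (\<lambda>s. J 1 (u s)) ss"
  using assms
proof (induction ss)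
  case (Cons s ss)
  have us: "u s \<in> homog A 1" and ss: "\<And>s. s \<in> set ss \<Longrightarrow> u s \<in> homog A 1"
    using Cons.prems by auto
  have w: "word A u ss \<in> homog A (length ss)" by (rule A.word_homog[OF ss])
  have d: "word_deriv A u ss \<in> homog A (length ss - 1)" by (rule A.word_deriv_homog[OF ss])
  have "u s \<otimes>\<^bsub>A\<^esub> word_deriv A u ss \<in> homog A (length ss) \<and>
    J (length ss) (u s \<otimes>\<^bsub>A\<^esub> word_deriv A u ss) = J 1 (u s) \<otimes>\<^bsub>T\<^esub> J (length ss - 1) (word_deriv A u ss)"
  \<comment> \<open>For empty \<open>ss\<close> the degrees do not add up because of truncated
    subtraction; both sides are zero then.\<close>
  proof (cases ss)
    case Nil
    then show ?thesis using A.homog_carrier[OF us] J_closed[OF us] by (simp add: J_zero)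
  next
    case (Cons t tt)
    then have "1 + (length ss - 1) = length ss" by simp
    then show ?thesis using A.homog_mult[OF us d] J_mult[OF us d] by simp
  qed
  moreover have "J (length ss - 1) (word_deriv A u ss) = word_deriv T (\<lambda>s. J 1 (u s)) ss"
    by (rule Cons.IH[OF ss])
  ultimately show ?case using J_minus[OF w] J_word[of ss u, OF ss] by simp
qed (simp add: J_zero)

end

context pointed_circuit_system
begin

lemma reduced_os_incl: "kalg_hom (reduced_os_algebra k M) (os_algebra k M) (\<lambda>x. x)"
proof -
  interpret generated "os_algebra k M" "ground M" "os_gen k M" by (rule generated_os)
  interpret R: galg "reduced_os_algebra k M" by (rule reduced_os_galg)
  obtain \<rho> where \<rho>: "kalg_hom (os_algebra k M) (os_algebra k M) \<rho>"
    "\<And>s. s \<in> ground M \<Longrightarrow> \<rho> (os_gen k M s) = os_gen k M s \<ominus>\<^bsub>os_algebra k M\<^esub> os_gen k M i"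
    using os_shift[OF i, of k] by blast
  show ?thesis
    by unfold_locales (auto intro!: alg_homI reduced_os_retract(3)[OF \<rho>])
qed

lemma reduced_os_gen_homog:
  assumes "s \<in> ground M"
  shows "os_gen k M s \<ominus>\<^bsub>os_algebra k M\<^esub> os_gen k M i \<in> homog (reduced_os_algebra k M) 1"
proof -
  interpret generated "os_algebra k M" "ground M" "os_gen k M" by (rule generated_os)
  show ?thesis
    using homog_minus[OF e_homog[OF assms] e_homog[OF i]] reduced_os_gen[OF assms, of k] by simp
qed

text \<open>The derivative of the word in the differences e_s - e_i is the image of \<partial>(e_C)
  under the retraction, hence zero already in the reduced algebra; the family \<open>J\<close>
  carries this to \<open>T\<close>.\<close>

lemma graded_map_circuit:
  assumes J: "graded_map (reduced_os_algebra k M) T J"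
    and ss: "distinct ss" "set ss \<in> circuits M"
  shows "word_deriv T (\<lambda>s. J 1 (os_gen k M s \<ominus>\<^bsub>os_algebra k M\<^esub> os_gen k M i)) ss = \<zero>\<^bsub>T\<^esub>"
proof -
  let ?A = "os_algebra k M" and ?e = "os_gen k M" and ?R = "reduced_os_algebra k M"
  interpret A: generated ?A "ground M" ?e by (rule generated_os)
  interpret J: graded_map ?R T J by (rule J)
  interpret inc: kalg_hom ?R ?A "\<lambda>x. x" by (rule reduced_os_incl)
  obtain \<rho> where \<rho>: "kalg_hom ?A ?A \<rho>"
    "\<And>s. s \<in> ground M \<Longrightarrow> \<rho> (?e s) = ?e s \<ominus>\<^bsub>?A\<^esub> ?e i"
    using os_shift[OF i, of k] by blast
  interpret \<rho>: kalg_hom ?A ?A \<rho> by (rule \<rho>(1))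
  have sub: "set ss \<subseteq> ground M" by (rule circuits_ground[OF ss(2)])
  have "word_deriv ?R (\<lambda>s. ?e s \<ominus>\<^bsub>?A\<^esub> ?e i) ss = word_deriv ?A (\<lambda>s. ?e s \<ominus>\<^bsub>?A\<^esub> ?e i) ss"
    using inc.hom_word_deriv[of ss "\<lambda>s. ?e s \<ominus>\<^bsub>?A\<^esub> ?e i"] sub reduced_os_gen by blast
  also have "\<dots> = word_deriv ?A (\<lambda>s. \<rho> (?e s)) ss"
    by (rule word_deriv_cong) (use sub \<rho>(2) in auto)
  also have "\<dots> = \<rho> (word_deriv ?A ?e ss)"
    by (rule \<rho>.hom_word_deriv[symmetric]) (use sub in auto)
  also have "\<dots> = \<zero>\<^bsub>?R\<^esub>" using os_circuit[OF ss, of k] by simp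
  finally have "word_deriv ?R (\<lambda>s. ?e s \<ominus>\<^bsub>?A\<^esub> ?e i) ss = \<zero>\<^bsub>?R\<^esub>" .
  then show ?thesis
    using J.J_word_deriv[of ss "\<lambda>s. ?e s \<ominus>\<^bsub>?A\<^esub> ?e i"] J.J_zero reduced_os_gen_homog sub
    by (metis subsetD)
qed

lemma graded_map_anticommuting:
  assumes J: "graded_map (reduced_os_algebra k M) T J"
  shows "anticommuting T (ground M) (\<lambda>s. J 1 (os_gen k M s \<ominus>\<^bsub>os_algebra k M\<^esub> os_gen k M i))"
proof -
  let ?R = "reduced_os_algebra k M"
  let ?u = "\<lambda>s. os_gen k M s \<ominus>\<^bsub>os_algebra k M\<^esub> os_gen k M i"
  interpret J: graded_map ?R T J by (rule J)
  interpret anticommuting ?R "ground M" ?u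
  proof (rule J.A.anticommuting_of_squares)
    show "v \<otimes>\<^bsub>?R\<^esub> v = \<zero>\<^bsub>?R\<^esub>" if "v \<in> homog ?R 1" for v
      using that os_homog_one_sq[of v k] by simp
  qed (rule reduced_os_gen_homog)
  note u = reduced_os_gen_homog[of _ k]
  show ?thesis
  proof
    fix s t assume st: "s \<in> ground M" "t \<in> ground M"
    have c: "?u t \<otimes>\<^bsub>?R\<^esub> ?u s \<in> homog ?R (1 + 1)" by (rule J.A.homog_mult[OF u u]) (rule st)+
    show "J 1 (?u s) \<otimes>\<^bsub>T\<^esub> J 1 (?u t) = \<ominus>\<^bsub>T\<^esub> (J 1 (?u t) \<otimes>\<^bsub>T\<^esub> J 1 (?u s))"
      unfolding J.J_mult[OF u[OF st(1)] u[OF st(2)]] J.J_mult[OF u[OF st(2)] u[OF st(1)]]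
        r_anti[OF st] by (rule J.J_uminus[OF c])
  next
    fix s assume s: "s \<in> ground M"
    show "J 1 (?u s) \<otimes>\<^bsub>T\<^esub> J 1 (?u s) = \<zero>\<^bsub>T\<^esub>"
      unfolding J.J_mult[OF u[OF s] u[OF s]] r_sq[OF s] by (rule J.J_zero)
  qed (rule J.J_closed[OF u])
qed

text \<open>The degree p part of the reduced algebra is defined as an intersection, with no spanning
  set at hand. The retraction supplies one: each element is its own image under
  \<open>\<rho>\<close>, so the induction runs over words of the full algebra.\<close>

lemma graded_map_hom:
  assumes J: "graded_map (reduced_os_algebra k M) T J" and h: "kalg_hom (os_algebra k M) T h"
    and gen: "\<And>s. s \<in> ground M \<Longrightarrow> h (os_gen k M s \<ominus>\<^bsub>os_algebra k M\<^esub> os_gen k M i) =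
      J 1 (os_gen k M s \<ominus>\<^bsub>os_algebra k M\<^esub> os_gen k M i)"
    and a: "a \<in> homog (reduced_os_algebra k M) p"
  shows "h a = J p a"
proof -
  let ?A = "os_algebra k M" and ?e = "os_gen k M" and ?R = "reduced_os_algebra k M"
  let ?u = "\<lambda>s. ?e s \<ominus>\<^bsub>?A\<^esub> ?e i"
  interpret A: generated ?A "ground M" ?e by (rule generated_os)
  interpret J: graded_map ?R T J by (rule J)
  interpret h: kalg_hom ?A T h by (rule h)
  interpret inc: kalg_hom ?R ?A "\<lambda>x. x" by (rule reduced_os_incl)
  obtain \<rho> where \<rho>: "kalg_hom ?A ?A \<rho>" "\<And>s. s \<in> ground M \<Longrightarrow> \<rho> (?e s) = ?u s"
    using os_shift[OF i, of k] by blast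
  interpret \<rho>: kalg_hom ?A ?A \<rho> by (rule \<rho>(1))
  note retract = reduced_os_retract[OF \<rho>]
  have \<rho>_homog: "\<rho> x \<in> homog ?R p" if "x \<in> homog ?A p" for x
  proof -
    have "\<rho> x \<in> homog ?A p"
    proof (rule A.hom_homog[OF A.galg_axioms \<rho>(1) _ that])
      fix s assume "s \<in> ground M"
      then show "\<rho> (?e s) \<in> homog ?A 1" using \<rho>(2) A.homog_minus[OF A.e_homog A.e_homog[OF i]] by simp
    qed
    then show ?thesis using retract(1) A.homog_carrier[OF that] by simp
  qed
  have "h (\<rho> x) = J p (\<rho> x)" if "x \<in> homog ?A p" for x
    using that
  proof (induction rule: A.homog_induct)
    case (word ss)
    then have sub: "\<And>s. s \<in> set ss \<Longrightarrow> s \<in> ground M" by auto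
    have "\<rho> (word ?A ?e ss) = word ?A (\<lambda>s. \<rho> (?e s)) ss"
      by (rule \<rho>.hom_word) (use sub in auto)
    also have "\<dots> = word ?A ?u ss" by (rule word_cong) (use sub \<rho>(2) in auto)
    finally have 1: "\<rho> (word ?A ?e ss) = word ?A ?u ss" .
    have 2: "word ?R ?u ss = word ?A ?u ss"
      by (rule inc.hom_word) (use sub reduced_os_gen in blast)
    have "h (word ?A ?u ss) = word T (\<lambda>s. h (?u s)) ss"
      by (rule h.hom_word) (use sub i in auto)
    also have "\<dots> = word T (\<lambda>s. J 1 (?u s)) ss"
      by (rule word_cong) (rule gen[OF sub])
    also have "\<dots> = J p (word ?R ?u ss)"
      using J.J_word[of ss ?u, OF reduced_os_gen_homog[OF sub]] by (simp only: word(2))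
    finally show ?case by (simp add: 1 2)
  next
    case zero
    then show ?case using J.J_zero[of p] by simp
  next
    case (add x y)
    then show ?case using J.J_add[OF \<rho>_homog \<rho>_homog, of x y] A.homog_carrier by simp
  next
    case (smult c x)
    then show ?case using J.J_smult[OF \<rho>_homog, of x c] A.homog_carrier by simp
  qed
  moreover have "\<rho> a = a" "a \<in> homog ?A p" using retract(2)[of a] a by auto
  ultimately show ?thesis by metis
qed

end

context tensor
begin

lemma graded_map_left: "graded_map A T (\<lambda>p a. ten p a 0 \<one>\<^bsub>B\<^esub>)"
  by unfold_locales
    (auto simp: ten_closed ten_add_left ten_smult ten_one ten_mult intro!: T.smult_one ten_closed)

lemma graded_map_right: "graded_map B T (\<lambda>q b. ten 0 \<one>\<^bsub>A\<^esub> q b)"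
  by unfold_locales
    (auto simp: ten_closed ten_add_right ten_smult ten_one ten_mult intro!: T.smult_one ten_closed)

lemma ten_left_right:
  assumes "a \<in> homog A p" "b \<in> homog B q"
  shows "ten p a 0 \<one>\<^bsub>B\<^esub> \<otimes>\<^bsub>T\<^esub> ten 0 \<one>\<^bsub>A\<^esub> q b = ten p a q b"
    and "ten 0 \<one>\<^bsub>A\<^esub> q b \<otimes>\<^bsub>T\<^esub> ten p a 0 \<one>\<^bsub>B\<^esub> = (- 1) ^ (q * p) \<odot>\<^bsub>T\<^esub> ten p a q b"
  using assms ten_closed[OF assms] A.homog_carrier[OF assms(1)] B.homog_carrier[OF assms(2)]
  by (auto simp: ten_mult)

end

context parallel
begin

lemma tensor_decomposition:
  fixes k :: "'k::field itself"
  shows "graded_alg_iso (tensor_product (reduced_os_algebra k M1) (reduced_os_algebra k M2))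
    (reduced_os_algebra k P)"
proof -
  define A where "A = os_algebra k P"
  define e where "e = os_gen k P"
  define R where "R = reduced_os_algebra k P"
  define A1 where "A1 = os_algebra k M1"
  define e1 where "e1 = os_gen k M1"
  define R1 where "R1 = reduced_os_algebra k M1"
  define A2 where "A2 = os_algebra k M2"
  define e2 where "e2 = os_gen k M2"
  define R2 where "R2 = reduced_os_algebra k M2"
  note defs = A_def e_def R_def A1_def e1_def R1_def A2_def e2_def R2_def
  interpret P: pointed_circuit_system P i
    by (intro pointed_circuit_system.intro circuit_system_P pointed_circuit_system_axioms.intro)
      (simp_all add: ground_P fin)
  interpret M1: pointed_circuit_system M1 i by unfold_locales (simp_all add: fin)
  interpret M2: pointed_circuit_system M2 i by unfold_locales (simp_all add: fin)
  interpret A: generated A "ground P" e unfolding defs by (rule P.generated_os)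
  interpret A1: generated A1 "ground M1" e1 unfolding defs by (rule M1.generated_os)
  interpret A2: generated A2 "ground M2" e2 unfolding defs by (rule M2.generated_os)
  have A_anti: "anticommuting A (ground P) e" unfolding defs by (rule P.anticommuting_os)
  have gr: "s \<in> ground M1 \<Longrightarrow> s \<in> ground P" "s \<in> ground M2 \<Longrightarrow> s \<in> ground P" for s
    by (simp_all add: ground_P)

  \<comment> \<open>The maps from A(M1) and A(M2) to A(P)\<close>
  have "\<exists>\<iota>. kalg_hom A1 A \<iota> \<and> (\<forall>s\<in>ground M1. \<iota> (e1 s) = e s)"
    unfolding defs
  proof (rule M1.os_lift)
    show "anticommuting (os_algebra k P) (ground M1) (os_gen k P)"
      by (rule P.os_anticommuting) (rule A.e_homog[unfolded defs, OF gr(1)])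
  qed (simp add: P_circuit)
  then obtain \<iota>1 where \<iota>1: "kalg_hom A1 A \<iota>1" and \<iota>1_gen: "\<And>s. s \<in> ground M1 \<Longrightarrow> \<iota>1 (e1 s) = e s"
    by blast
  have "\<exists>\<iota>. kalg_hom A2 A \<iota> \<and> (\<forall>s\<in>ground M2. \<iota> (e2 s) = e s)"
    unfolding defs
  proof (rule M2.os_lift)
    show "anticommuting (os_algebra k P) (ground M2) (os_gen k P)"
      by (rule P.os_anticommuting) (rule A.e_homog[unfolded defs, OF gr(2)])
  qed (simp add: P_circuit)
  then obtain \<iota>2 where \<iota>2: "kalg_hom A2 A \<iota>2" and \<iota>2_gen: "\<And>s. s \<in> ground M2 \<Longrightarrow> \<iota>2 (e2 s) = e s"
    by blast
  interpret \<iota>1: kalg_hom A1 A \<iota>1 by (rule \<iota>1)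
  interpret \<iota>2: kalg_hom A2 A \<iota>2 by (rule \<iota>2)
  have \<iota>_homog: "x \<in> homog A1 p \<Longrightarrow> \<iota>1 x \<in> homog A p" "y \<in> homog A2 p \<Longrightarrow> \<iota>2 y \<in> homog A p" for x y p
    by (rule A1.hom_homog[OF A.galg_axioms \<iota>1], simp only: \<iota>1_gen A.e_homog gr, assumption)
      (rule A2.hom_homog[OF A.galg_axioms \<iota>2], simp only: \<iota>2_gen A.e_homog gr, assumption)
  obtain \<rho> where \<rho>: "kalg_hom A A \<rho>" and \<rho>_gen: "\<And>s. s \<in> ground P \<Longrightarrow> \<rho> (e s) = e s \<ominus>\<^bsub>A\<^esub> e i"
    using P.os_shift[OF P.i, of k] unfolding defs by blast
  have retract: "x \<in> carrier A \<Longrightarrow> \<rho> x \<in> carrier R" "x \<in> carrier R \<Longrightarrow> \<rho> x = x"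
    "x \<in> carrier R \<Longrightarrow> x \<in> carrier A" for x
    using P.reduced_os_retract[of k \<rho> x] \<rho> \<rho>_gen unfolding defs by blast+
  have R_simps: "x \<oplus>\<^bsub>R\<^esub> y = x \<oplus>\<^bsub>A\<^esub> y" "x \<otimes>\<^bsub>R\<^esub> y = x \<otimes>\<^bsub>A\<^esub> y" "c \<odot>\<^bsub>R\<^esub> x = c \<odot>\<^bsub>A\<^esub> x"
    "\<one>\<^bsub>R\<^esub> = \<one>\<^bsub>A\<^esub>" "homog R p = homog A p \<inter> carrier R" for x y c p
    by (simp_all add: R_def A_def)
  have R1_simps: "x \<oplus>\<^bsub>R1\<^esub> y = x \<oplus>\<^bsub>A1\<^esub> y" "x \<otimes>\<^bsub>R1\<^esub> y = x \<otimes>\<^bsub>A1\<^esub> y" "c \<odot>\<^bsub>R1\<^esub> x = c \<odot>\<^bsub>A1\<^esub> x"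
    "\<one>\<^bsub>R1\<^esub> = \<one>\<^bsub>A1\<^esub>" "\<zero>\<^bsub>R1\<^esub> = \<zero>\<^bsub>A1\<^esub>" "homog R1 p = homog A1 p \<inter> carrier R1" for x y c p
    by (simp_all add: R1_def A1_def)
  have R2_simps: "x \<oplus>\<^bsub>R2\<^esub> y = x \<oplus>\<^bsub>A2\<^esub> y" "x \<otimes>\<^bsub>R2\<^esub> y = x \<otimes>\<^bsub>A2\<^esub> y" "c \<odot>\<^bsub>R2\<^esub> x = c \<odot>\<^bsub>A2\<^esub> x"
    "\<one>\<^bsub>R2\<^esub> = \<one>\<^bsub>A2\<^esub>" "\<zero>\<^bsub>R2\<^esub> = \<zero>\<^bsub>A2\<^esub>" "homog R2 p = homog A2 p \<inter> carrier R2" for x y c p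
    by (simp_all add: R2_def A2_def)
  define u1 where "u1 s = e1 s \<ominus>\<^bsub>A1\<^esub> e1 i" for s
  define u2 where "u2 s = e2 s \<ominus>\<^bsub>A2\<^esub> e2 i" for s
  have u1: "u1 s \<in> homog R1 1" if "s \<in> ground M1" for s
    using M1.reduced_os_gen_homog[OF that, of k] by (simp only: u1_def defs)
  have u2: "u2 s \<in> homog R2 1" if "s \<in> ground M2" for s
    using M2.reduced_os_gen_homog[OF that, of k] by (simp only: u2_def defs)
  interpret T: tensor R1 R2
    unfolding defs by (intro tensor.intro M1.reduced_os_galg M2.reduced_os_galg)
  let ?T = "tensor_product R1 R2"
  have sub1: "a \<in> carrier A1" "a \<in> homog A1 p" if "a \<in> homog R1 p" for a p
    using that A1.homog_carrier by (auto simp: R1_simps)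
  have sub2: "b \<in> carrier A2" "b \<in> homog A2 p" if "b \<in> homog R2 p" for b p
    using that A2.homog_carrier by (auto simp: R2_simps)

  \<comment> \<open>The multiplication map f on the tensor product\<close>
  define \<Phi> where "\<Phi> a b = \<iota>1 a \<otimes>\<^bsub>A\<^esub> \<iota>2 b" for a b
  have "\<exists>f. kalg_hom ?T A f \<and>
    (\<forall>p a q b. a \<in> homog R1 p \<longrightarrow> b \<in> homog R2 q \<longrightarrow> f (T.ten p a q b) = \<Phi> a b)"
  proof (rule T.tensor_lift[OF A.kalg_axioms])
    fix p a q b p' a' q' b'
    assume h: "a \<in> homog R1 p" "b \<in> homog R2 q" "a' \<in> homog R1 p'" "b' \<in> homog R2 q'"
    note c = sub1[OF h(1)] sub2[OF h(2)] sub1[OF h(3)] sub2[OF h(4)]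
    have comm: "\<iota>2 b \<otimes>\<^bsub>A\<^esub> \<iota>1 a' = (- 1) ^ (q * p') \<odot>\<^bsub>A\<^esub> (\<iota>1 a' \<otimes>\<^bsub>A\<^esub> \<iota>2 b)"
      by (rule graded_commutative[OF A.generated_axioms A_anti]) (use c \<iota>_homog in auto)
    have "\<Phi> a b \<otimes>\<^bsub>A\<^esub> \<Phi> a' b' = \<iota>1 a \<otimes>\<^bsub>A\<^esub> ((\<iota>2 b \<otimes>\<^bsub>A\<^esub> \<iota>1 a') \<otimes>\<^bsub>A\<^esub> \<iota>2 b')"
      using c by (simp add: \<Phi>_def A.m_assoc)
    also have "\<dots> = (- 1) ^ (q * p') \<odot>\<^bsub>A\<^esub> \<Phi> (a \<otimes>\<^bsub>R1\<^esub> a') (b \<otimes>\<^bsub>R2\<^esub> b')"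
      using c by (simp add: comm \<Phi>_def A.m_assoc R1_simps R2_simps)
    finally show "\<Phi> a b \<otimes>\<^bsub>A\<^esub> \<Phi> a' b' = (- 1) ^ (q * p') \<odot>\<^bsub>A\<^esub> \<Phi> (a \<otimes>\<^bsub>R1\<^esub> a') (b \<otimes>\<^bsub>R2\<^esub> b')" .
  qed (use sub1 sub2 in \<open>auto simp: \<Phi>_def R1_simps(1-5) R2_simps(1-5) A.l_distr A.r_distr\<close>)
  then obtain f where f: "kalg_hom ?T A f"
    and f_ten: "\<And>p a q b. \<lbrakk>a \<in> homog R1 p; b \<in> homog R2 q\<rbrakk> \<Longrightarrow> f (T.ten p a q b) = \<iota>1 a \<otimes>\<^bsub>A\<^esub> \<iota>2 b"
    by (auto simp: \<Phi>_def)
  interpret f: kalg_hom ?T A f by (rule f)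

  \<comment> \<open>The homomorphism g from A(P) to the tensor product\<close>
  define J1 where "J1 p a = T.ten p a 0 \<one>\<^bsub>R2\<^esub>" for p a
  define J2 where "J2 q b = T.ten 0 \<one>\<^bsub>R1\<^esub> q b" for q b
  have J1: "graded_map R1 ?T J1" unfolding J1_def[abs_def] by (rule T.graded_map_left)
  have J2: "graded_map R2 ?T J2" unfolding J2_def[abs_def] by (rule T.graded_map_right)
  have J1': "graded_map (reduced_os_algebra k M1) ?T J1"
    using J1 by (simp only: R1_def)
  interpret J1: graded_map R1 ?T J1 by (rule J1)
  have J2': "graded_map (reduced_os_algebra k M2) ?T J2"
    using J2 by (simp only: R2_def)
  interpret J2: graded_map R2 ?T J2 by (rule J2)
  define r where "r s = (if s \<in> ground M1 then J1 1 (u1 s) else J2 1 (u2 s))" for s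
  \<comment> \<open>At \<open>i\<close> both differences are zero, so the prescriptions through the
    two factors agree on the common element, and g kills e_i.\<close>
  have ui: "u1 i = \<zero>\<^bsub>R1\<^esub>" "u2 i = \<zero>\<^bsub>R2\<^esub>"
    using A1.e_closed[of i] A2.e_closed[of i]
    by (simp_all add: u1_def u2_def R1_simps R2_simps A1.r_right_minus_eq A2.r_right_minus_eq del: A1.e_closed A2.e_closed)
  have ri: "r i = \<zero>\<^bsub>?T\<^esub>" by (simp add: r_def ui J1.J_zero)
  have r1: "r s = J1 1 (u1 s)" if "s \<in> ground M1" for s using that by (simp add: r_def)
  have r2: "r s = J2 1 (u2 s)" if "s \<in> ground M2" for s
  proof (cases "s \<in> ground M1")
    case True
    then have "s = i" using that inter by auto
    then show ?thesis by (simp add: ri ui J2.J_zero)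
  qed (simp add: r_def)
  have r_homog: "r s \<in> homog ?T 1" if "s \<in> ground P" for s
    using that u1 u2 T.ten_homog[of "u1 s" 1 "\<one>\<^bsub>R2\<^esub>" 0] T.ten_homog[of "\<one>\<^bsub>R1\<^esub>" 0 "u2 s" 1]
    by (auto simp: ground_P r1 r2 J1_def J2_def)
  have J1_anti: "anticommuting ?T (ground M1) (\<lambda>s. J1 1 (u1 s))"
    using M1.graded_map_anticommuting[OF J1'] by (simp only: u1_def A1_def e1_def)
  have J2_anti: "anticommuting ?T (ground M2) (\<lambda>s. J2 1 (u2 s))"
    using M2.graded_map_anticommuting[OF J2'] by (simp only: u2_def A2_def e2_def)
  \<comment> \<open>Odd elements of different factors anticommute owing to the Koszul sign with q =
    p' = 1.\<close>
  have J12_anti: "J2 1 (u2 t) \<otimes>\<^bsub>?T\<^esub> J1 1 (u1 s) = \<ominus>\<^bsub>?T\<^esub> (J1 1 (u1 s) \<otimes>\<^bsub>?T\<^esub> J2 1 (u2 t))"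
    if "s \<in> ground M1" "t \<in> ground M2" for s t
    using T.ten_left_right[OF u1 u2, OF that] T.ten_closed[OF u1 u2, OF that]
    by (simp add: J1_def J2_def)
  have r_anti: "anticommuting ?T (ground P) r"
  proof
    fix s t assume "s \<in> ground P" "t \<in> ground P"
    then consider "s \<in> ground M1" "t \<in> ground M1" | "s \<in> ground M2" "t \<in> ground M2"
      | "s \<in> ground M1" "t \<in> ground M2" | "s \<in> ground M2" "t \<in> ground M1"
      by (auto simp: ground_P)
    then show "r s \<otimes>\<^bsub>?T\<^esub> r t = \<ominus>\<^bsub>?T\<^esub> (r t \<otimes>\<^bsub>?T\<^esub> r s)"
    proof cases
      case 1
      show ?thesis unfolding r1[OF 1(1)] r1[OF 1(2)] by (rule anticommuting.r_anti[OF J1_anti 1])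
    next
      case 2
      show ?thesis unfolding r2[OF 2(1)] r2[OF 2(2)] by (rule anticommuting.r_anti[OF J2_anti 2])
    next
      case 4
      then show ?thesis unfolding r2[OF 4(1)] r1[OF 4(2)] by (intro J12_anti)
    next
      case 3
      then show ?thesis unfolding r1[OF 3(1)] r2[OF 3(2)] J12_anti[OF 3]
        by (intro T.T.minus_minus[symmetric] T.T.m_closed J1.J_closed J2.J_closed u1 u2)
    qed
  next
    fix s assume "s \<in> ground P"
    then show "r s \<otimes>\<^bsub>?T\<^esub> r s = \<zero>\<^bsub>?T\<^esub>"
      using anticommuting.r_sq[OF J1_anti] anticommuting.r_sq[OF J2_anti] by (auto simp only: ground_P r1 r2)
  qed (use r_homog T.T.homog_carrier in blast)
  have "\<exists>g. kalg_hom A ?T g \<and> (\<forall>s\<in>ground P. g (e s) = r s)"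
    unfolding A_def e_def
  proof (rule P.os_lift[OF r_anti])
    fix ss assume ss: "distinct ss" "set ss \<in> circuits P"
    show "word_deriv ?T r ss = \<zero>\<^bsub>?T\<^esub>"
    proof (rule parallel_relations[OF r_anti _ _ ss])
      fix ss assume ss: "distinct ss" "set ss \<in> circuits M1"
      have "word_deriv ?T r ss = word_deriv ?T (\<lambda>s. J1 1 (u1 s)) ss"
        by (rule word_deriv_cong, rule r1) (use M1.circuits_ground[OF ss(2)] in blast)
      then show "word_deriv ?T r ss = \<zero>\<^bsub>?T\<^esub>"
        using M1.graded_map_circuit[OF J1[unfolded R1_def] ss] by (simp add: u1_def defs)
    next
      fix ss assume ss: "distinct ss" "set ss \<in> circuits M2"
      have "word_deriv ?T r ss = word_deriv ?T (\<lambda>s. J2 1 (u2 s)) ss"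
        by (rule word_deriv_cong, rule r2) (use M2.circuits_ground[OF ss(2)] in blast)
      then show "word_deriv ?T r ss = \<zero>\<^bsub>?T\<^esub>"
        using M2.graded_map_circuit[OF J2[unfolded R2_def] ss] by (simp add: u2_def defs)
    qed
  qed
  then obtain g where g: "kalg_hom A ?T g" and g_gen: "\<And>s. s \<in> ground P \<Longrightarrow> g (e s) = r s" by blast
  interpret g: kalg_hom A ?T g by (rule g)

  \<comment> \<open>f and g are inverse to each other on the reduced algebra\<close>
  have \<iota>u: "\<iota>1 (u1 s) = e s \<ominus>\<^bsub>A\<^esub> e i" if "s \<in> ground M1" for s
    using that by (simp add: u1_def \<iota>1_gen)
  have \<iota>u': "\<iota>2 (u2 s) = e s \<ominus>\<^bsub>A\<^esub> e i" if "s \<in> ground M2" for s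
    using that by (simp add: u2_def \<iota>2_gen)
  have g_diff: "g (e s \<ominus>\<^bsub>A\<^esub> e i) = r s" if "s \<in> ground P" for s
    using that g_gen[OF that] g_gen[of i] r_homog[OF that] T.T.homog_carrier[of "r s" 1]
    by (simp add: ri a_minus_def)
  have g\<iota>1: "g (\<iota>1 a) = J1 p a" if "a \<in> homog R1 p" for a p
  proof (rule M1.graded_map_hom[OF J1' kalg_hom_compose[OF \<iota>1[unfolded A1_def] g]])
    fix s assume s: "s \<in> ground M1"
    then show "g (\<iota>1 (os_gen k M1 s \<ominus>\<^bsub>os_algebra k M1\<^esub> os_gen k M1 i)) =
        J1 1 (os_gen k M1 s \<ominus>\<^bsub>os_algebra k M1\<^esub> os_gen k M1 i)"
      using \<iota>u[OF s] g_diff[OF gr(1)[OF s]] r1[OF s] by (simp add: u1_def defs)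
  qed (use that in \<open>simp add: R1_def\<close>)
  have g\<iota>2: "g (\<iota>2 b) = J2 q b" if "b \<in> homog R2 q" for b q
  proof (rule M2.graded_map_hom[OF J2' kalg_hom_compose[OF \<iota>2[unfolded A2_def] g]])
    fix s assume s: "s \<in> ground M2"
    then show "g (\<iota>2 (os_gen k M2 s \<ominus>\<^bsub>os_algebra k M2\<^esub> os_gen k M2 i)) =
        J2 1 (os_gen k M2 s \<ominus>\<^bsub>os_algebra k M2\<^esub> os_gen k M2 i)"
      using \<iota>u'[OF s] g_diff[OF gr(2)[OF s]] r2[OF s] by (simp add: u2_def defs)
  qed (use that in \<open>simp add: R2_def\<close>)

  have gf: "g (f x) = x" if "x \<in> carrier ?T" for x
  proof (rule lspan_linear_eq[OF T.T.kalg_axioms T.T.kalg_axioms])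
    show "(\<lambda>x. g (f x)) \<in> linear_maps ?T ?T"
      by (rule kalg_hom.linear[OF kalg_hom_compose[OF f g]])
    show "(\<lambda>x. x) \<in> linear_maps ?T ?T" by (rule linear_mapsI) auto
    show "{T.ten p a q b | p a q b. a \<in> homog R1 p \<and> b \<in> homog R2 q} \<subseteq> carrier ?T"
      using T.ten_closed by blast
    show "x \<in> lspan ?T {T.ten p a q b | p a q b. a \<in> homog R1 p \<and> b \<in> homog R2 q}"
      using that T.T_span(1) by simp
    fix x assume "x \<in> {T.ten p a q b | p a q b. a \<in> homog R1 p \<and> b \<in> homog R2 q}"
    then obtain p a q b where x: "x = T.ten p a q b" "a \<in> homog R1 p" "b \<in> homog R2 q" by blast
    have "g (f x) = g (\<iota>1 a) \<otimes>\<^bsub>?T\<^esub> g (\<iota>2 b)"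
      using x f_ten sub1(1) sub2(1) by simp
    also have "\<dots> = J1 p a \<otimes>\<^bsub>?T\<^esub> J2 q b" by (simp only: g\<iota>1[OF x(2)] g\<iota>2[OF x(3)])
    also have "\<dots> = x" using T.ten_left_right(1)[OF x(2,3)] by (simp add: J1_def J2_def x(1))
    finally show "g (f x) = x" .
  qed
  have fr: "f (r s) = e s \<ominus>\<^bsub>A\<^esub> e i" if "s \<in> ground P" for s
  proof (cases "s \<in> ground M1")
    case True
    have "f (J1 1 (u1 s)) = \<iota>1 (u1 s) \<otimes>\<^bsub>A\<^esub> \<iota>2 \<one>\<^bsub>R2\<^esub>"
      unfolding J1_def by (rule f_ten[OF u1[OF True] T.B.homog_one])
    then show ?thesis using True that by (simp add: r1 \<iota>u R2_simps(4))
  next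
    case False
    then have s: "s \<in> ground M2" using that by (simp add: ground_P)
    have "f (J2 1 (u2 s)) = \<iota>1 \<one>\<^bsub>R1\<^esub> \<otimes>\<^bsub>A\<^esub> \<iota>2 (u2 s)"
      unfolding J2_def by (rule f_ten[OF T.A.homog_one u2[OF s]])
    then show ?thesis using s that by (simp add: r2 \<iota>u' R1_simps(4))
  qed
  \<comment> \<open>On all of A(P) the composite is the retraction and not the identity, since g
    kills e_i; on the reduced algebra the retraction is the identity.\<close>
  have fg: "f (g x) = \<rho> x" if "x \<in> carrier A" for x
    by (rule A.hom_eq[OF kalg_hom_compose[OF g f] \<rho> _ that]) (simp only: g_gen fr \<rho>_gen)
  \<comment> \<open>From g f = id one gets f x = f (g (f x)) = \<rho>(f x), a value of the
    retraction.\<close>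
  have f_R: "f x \<in> carrier R" if "x \<in> carrier ?T" for x
    using fg[of "f x"] gf[OF that] retract(1)[of "f x"] f.closed[OF that] by simp
  have fg_R: "f (g y) = y" if "y \<in> carrier R" for y
    using fg[OF retract(3)[OF that]] retract(2)[OF that] by simp
  have f_homog: "f x \<in> homog A n" if "x \<in> homog ?T n" for x n
  proof -
    let ?X = "{T.ten p a q b | p a q b. a \<in> homog R1 p \<and> b \<in> homog R2 q \<and> p + q = n}"
    have "?X \<subseteq> carrier ?T" using T.ten_closed by blast
    from lspan_linear_image[OF T.T.kalg_axioms A.kalg_axioms f.linear this]
    have "f x \<in> lspan A (f ` ?X)" using that T.T_span(2)[of n] by blast
    moreover have "f ` ?X \<subseteq> homog A n"
    proof
      fix y assume "y \<in> f ` ?X"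
      then obtain p a q b where y: "y = f (T.ten p a q b)" "a \<in> homog R1 p" "b \<in> homog R2 q" "p + q = n"
        by blast
      then have "y = \<iota>1 a \<otimes>\<^bsub>A\<^esub> \<iota>2 b" by (simp only: f_ten)
      then show "y \<in> homog A n"
        using A.homog_mult[OF \<iota>_homog(1)[OF sub1(2)[OF y(2)]] \<iota>_homog(2)[OF sub2(2)[OF y(3)]]] y(4)
        by simp
    qed
    ultimately show ?thesis by (rule A.lspan_homog)
  qed
  have g_homog: "g x \<in> homog ?T n" if "x \<in> homog A n" for x n
    by (rule A.hom_homog[OF T.T.galg_axioms g _ that]) (simp only: g_gen r_homog)
  have "graded_alg_iso ?T R"
    unfolding graded_alg_iso_def
  proof (intro bexI conjI allI)
    show "f \<in> alg_hom ?T R"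
      by (rule alg_homI) (simp_all add: f_R R_simps)
    show "bij_betw f (carrier ?T) (carrier R)"
      by (rule bij_betw_byWitness[where f' = g])
        (use gf fg_R f_R retract(3) in \<open>auto intro: g.closed\<close>)
    fix n
    show "f ` homog ?T n = homog R n"
    proof (intro equalityI subsetI)
      fix y assume "y \<in> f ` homog ?T n"
      then obtain x where "y = f x" "x \<in> homog ?T n" by blast
      then show "y \<in> homog R n"
        using f_homog f_R T.T.homog_carrier by (simp add: R_simps)
    next
      fix y assume "y \<in> homog R n"
      then have "y \<in> homog A n" "y \<in> carrier R" by (auto simp: R_simps)
      then show "y \<in> f ` homog ?T n"
        using g_homog fg_R by (metis image_eqI)
    qed
  qed
  then show ?thesis by (simp add: defs)
qed

end

theorem theorem4p14:
  fixes k :: "'k::field itself" and M\<^sub>1 M\<^sub>2 P :: "'a matroid" and i :: 'a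
  assumes "is_matroid M\<^sub>1" and "is_matroid M\<^sub>2"
    and "ground M\<^sub>1 \<inter> ground M\<^sub>2 = {i}"
    and "flat M\<^sub>1 {i}" and "\<not> is_loop M\<^sub>2 i"
  defines "P \<equiv> parallel_connection i M\<^sub>1 M\<^sub>2"
  shows "(\<exists>\<psi>. short_exact
            (shift (os_algebra k P)) \<psi>
            (os_algebra k (direct_sum M\<^sub>1 M\<^sub>2))
            (os_map k (direct_sum M\<^sub>1 M\<^sub>2) P identification)
            (os_algebra k P)) \<and>
         graded_alg_iso
           (tensor_product (reduced_os_algebra k M\<^sub>1) (reduced_os_algebra k M\<^sub>2))
           (reduced_os_algebra k P)"
proof -
  interpret par: parallel M\<^sub>1 M\<^sub>2 i
    by unfold_locales (use assms(1-3) in \<open>auto simp: is_matroid_def\<close>)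
  show ?thesis
    using par.exact_sequence[of k] par.tensor_decomposition[of k]
    unfolding P_def par.P_def par.D_def by blast
qed

end
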